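(* If $\Gamma$ and $\Gamma'$ are virtual strings whose primitive based matrices $P(\Gamma)$ and $P(\Gamma')$ are isomorphic, then $P(\Gamma_{(n)})$ is isomorphic to $P(\Gamma'_{(n)})$ for every positive integer $n$, where $\Gamma_{(n)}$ denotes the $n$-cable of $\Gamma$.
   Context: Nanowords. A Gauss word is a finite word (possibly empty) in which each letter appears exactly twice or not at all. A nanoword is a Gauss word together with a map $X\mapsto|X|\in\{a,b\}$ from its letters to $\{a,b\}$ ($|X|$ is the type of $X$). An isomorphism of nanowords is a type-preserving relabelling of letters which carries the $k$th letter of one word to the $k$th letter of the other for all $k$. Two nanowords are homotopic if related by a finite sequence of isomorphisms and the following moves and their inverses ($x,y,z,t$ are arbitrary sequences of letters such that both sides are Gauss words, types of letters being unchanged unless stated): shift: $AxAy\leftrightarrow xA'yA'$ where $|A'|\neq|A|$; H1: $xAAy\leftrightarrow xy$; H2: $xAByBAz\leftrightarrow xyz$ where $|A|\ne|B|$; H3: $xAByACzBCt\leftrightarrow xBAyCAzCBt$ where $|A|=|B|=|C|$. Virtual strings. A virtual string is (equivalently to its definition via planar diagrams with real and virtual crossings modulo flattened Reidemeister-type moves) a homotopy class of nanowords. A nanoword represents its class. Head and tail functions. For a letter $X$ of a nanoword $\alpha$, if $|X|=a$ the tail of $X$ is its first occurrence and the head its second occurrence; if $|X|=b$ the tail is the second occurrence and the head the first. For distinct letters $X,Y$, move rightwards along the word cyclically (from the end back to the start) from the tail of $X$ to the head of $X$; $t(X,Y)=1$ if the tail of $Y$ is passed and $0$ otherwise; $h(X,Y)=1$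 if the head of $Y$ is passed and $0$ otherwise. Put $t(X,X)=h(X,X)=0$, and $n(X)=\sum_{Y\in\alpha}\bigl(t(X,Y)-h(X,Y)\bigr)$. Based matrices. A based matrix (over $\mathbb Z$) is a triple $(G,s,b)$ with $G$ a finite set, $s\in G$, and $b:G\times G\to\mathbb Z$ skew-symmetric. An isomorphism of based matrices is a bijection of the underlying sets preserving $s$ and $b$. The based matrix $M(\alpha)=(G,s,b)$ of a nanoword $\alpha$ has $G$ = letters of $\alpha$ together with an extra element $s$, $b(s,s)=0$, $b(X,s)=n(X)=-b(s,X)$ for letters $X$, and for letters $g,k$ $$b(g,k)=t(g,k)-h(g,k)+\sum_{c\in G\setminus\{s\}}\bigl(t(g,c)h(k,c)-h(g,c)t(k,c)\bigr).$$ In a based matrix, $g\in G\setminus\{s\}$ is annihilating if $b(g,k)=0$ for all $k\in G$, and core if $b(g,k)=b(s,k)$ for all $k\in G$; two elements $g,h\in G\setminus\{s\}$ are complementary if $b(g,k)+b(h,k)=b(s,k)$ for all $k\in G$. A based matrix is primitive if it has no annihilating elements, core elements or complementary pairs. Reductions delete an annihilating element, a core element, or a complementary pair (restricting $b$). Every based matrix reduces to a primitive one, known to be unique up to isomorphism. $P(\alpha)$ denotes the primitive based matrix obtained from $M(\alpha)$; up to isomorphism it is known to be a homotopy invariant, so $P(\Gamma)$ is defined as $P(\alpha)$ for any nanoword $\alpha$ representing $\Gamma$. Cables. Let $n\ge1$ and let $\alpha$ be a nanoword. For $0\le i\le n-1$ let $w_i$ be obtained from $\alpha$ by replacing letters as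 follows (first indices modulo $n$): if $|A|=a$, replace the first occurrence of $A$ by $A_{i,0}A_{i,1}\dotso A_{i,n-1}$ and the second by $A_{n-1,i}A_{n-2,i}\dotso A_{0,i}$; if $|A|=b$, replace the first occurrence of $A$ by $A_{0,i}A_{n-1,i}A_{n-2,i}\dotso A_{1,i}$ and the second by $A_{i+1,0}A_{i+1,1}\dotso A_{i+1,n-1}$. The $n$-cable of $\alpha$ is the nanoword $$\alpha_{(n)}=w_0C_0w_1C_1\dotso C_{n-3}w_{n-2}C_{n-2}w_{n-1}C_{n-2}C_{n-3}\dotso C_1C_0$$ with types: all $C_i$ have type $a$; if $|A|=a$ then $|A_{i,j}|=a$ if $i\le j$ and $b$ if $i>j$; if $|A|=b$ then, with $d\in\{0,\dots,n-1\}$ the residue of $i-1$ modulo $n$, $|A_{i,j}|=a$ if $j>d$ and $b$ if $j\le d$. (Geometrically: take $n$ parallel copies of the curve, numbered $0,\dots,n-1$ from left to right, cut at the base point; join the end of copy $i$ to the start of copy $i+1$ for $0\le i\le n-2$, and the end of copy $n-1$ to the start of copy $0$ crossing the other $n-1$ arcs.) Homotopic nanowords have homotopic $n$-cables, so for a virtual string $\Gamma$ represented by $\alpha$, $\Gamma_{(n)}$ is defined as the virtual string represented by $\alpha_{(n)}$. *)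

theory Defs
  imports Main
begin

datatype letter_type = Type_a | Type_b

text \<open>The type map is total; only its values on the letters of the word matter, and
  isomorphisms of nanowords ignore all other values.\<close>

datatype 'a nanoword = Nanoword (word: "'a list") (ltype: "'a \<Rightarrow> letter_type")

definition gauss_word :: "'a list \<Rightarrow> bool" where
  "gauss_word w \<longleftrightarrow> (\<forall>X\<in>set w. count_list w X = 2)"

definition is_nanoword :: "'a nanoword \<Rightarrow> bool" where
  "is_nanoword \<alpha> \<longleftrightarrow> gauss_word (word \<alpha>)"

definition letters :: "'a nanoword \<Rightarrow> 'a set" where
  "letters \<alpha> = set (word \<alpha>)"

definition nanoword_iso :: "'a nanoword \<Rightarrow> 'b nanoword \<Rightarrow> bool" where
  "nanoword_iso \<alpha> \<beta> \<longleftrightarrow>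
     (\<exists>f. inj_on f (letters \<alpha>) \<and> word \<beta> = map f (word \<alpha>) \<and>
          (\<forall>X\<in>letters \<alpha>. ltype \<beta> (f X) = ltype \<alpha> X))"

text \<open>In the moves \<open>H1\<close>, \<open>H2\<close>, \<open>H3\<close> both sides carry the same total type map. This is no
  restriction, because an isomorphism (with identical relabelling) can change the type map
  arbitrarily outside the word.\<close>

inductive homotopy_move :: "'a nanoword \<Rightarrow> 'a nanoword \<Rightarrow> bool" where
  iso: "\<lbrakk>is_nanoword \<alpha>; is_nanoword \<beta>; nanoword_iso \<alpha> \<beta>\<rbrakk> \<Longrightarrow> homotopy_move \<alpha> \<beta>"
| shift: "\<lbrakk>gauss_word ([A] @ x @ [A] @ y); gauss_word (x @ [A'] @ y @ [A']);
           \<tau>' A' \<noteq> \<tau> A; \<forall>X\<in>set x \<union> set y. \<tau>' X = \<tau> X\<rbrakk>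
    \<Longrightarrow> homotopy_move (Nanoword ([A] @ x @ [A] @ y) \<tau>) (Nanoword (x @ [A'] @ y @ [A']) \<tau>')"
| H1: "\<lbrakk>gauss_word (x @ [A, A] @ y); gauss_word (x @ y)\<rbrakk>
    \<Longrightarrow> homotopy_move (Nanoword (x @ [A, A] @ y) \<tau>) (Nanoword (x @ y) \<tau>)"
| H2: "\<lbrakk>gauss_word (x @ [A, B] @ y @ [B, A] @ z); gauss_word (x @ y @ z); \<tau> A \<noteq> \<tau> B\<rbrakk>
    \<Longrightarrow> homotopy_move (Nanoword (x @ [A, B] @ y @ [B, A] @ z) \<tau>) (Nanoword (x @ y @ z) \<tau>)"
| H3: "\<lbrakk>gauss_word (x @ [A, B] @ y @ [A, C] @ z @ [B, C] @ t);
        gauss_word (x @ [B, A] @ y @ [C, A] @ z @ [C, B] @ t); \<tau> A = \<tau> B; \<tau> B = \<tau> C\<rbrakk>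
    \<Longrightarrow> homotopy_move (Nanoword (x @ [A, B] @ y @ [A, C] @ z @ [B, C] @ t) \<tau>)
                      (Nanoword (x @ [B, A] @ y @ [C, A] @ z @ [C, B] @ t) \<tau>)"

definition homotopic :: "'a nanoword \<Rightarrow> 'a nanoword \<Rightarrow> bool" where
  "homotopic \<alpha> \<beta> \<longleftrightarrow> is_nanoword \<alpha> \<and> is_nanoword \<beta> \<and> equivclp homotopy_move \<alpha> \<beta>"

lemma homotopic_part_equivp: "part_equivp (homotopic :: 'a nanoword \<Rightarrow> 'a nanoword \<Rightarrow> bool)"
proof (rule part_equivpI)
  show "\<exists>\<alpha> :: 'a nanoword. homotopic \<alpha> \<alpha>"
    by (rule exI[of _ "Nanoword [] (\<lambda>_. Type_a)"])
      (simp add: homotopic_def is_nanoword_def gauss_word_def)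
  show "symp (homotopic :: 'a nanoword \<Rightarrow> 'a nanoword \<Rightarrow> bool)"
    by (rule sympI) (auto simp: homotopic_def intro: equivclp_sym)
  show "transp (homotopic :: 'a nanoword \<Rightarrow> 'a nanoword \<Rightarrow> bool)"
    by (rule transpI) (auto simp: homotopic_def intro: equivclp_trans)
qed

text \<open>Every nanoword has finitely many letters, so up to isomorphism its letters may be taken
  to be natural numbers.\<close>

quotient_type virtual_string = "nat nanoword" / partial: homotopic
  by (rule homotopic_part_equivp)

definition represents :: "'a nanoword \<Rightarrow> virtual_string \<Rightarrow> bool" where
  "represents \<alpha> \<Gamma> \<longleftrightarrow> is_nanoword \<alpha> \<and>
     (\<exists>\<beta>. is_nanoword \<beta> \<and> nanoword_iso \<alpha> \<beta> \<and> \<Gamma> = abs_virtual_string \<beta>)"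

definition first_pos :: "'a list \<Rightarrow> 'a \<Rightarrow> nat" where
  "first_pos w X = Min {p. p < length w \<and> w ! p = X}"

definition second_pos :: "'a list \<Rightarrow> 'a \<Rightarrow> nat" where
  "second_pos w X = Max {p. p < length w \<and> w ! p = X}"

definition tail_pos :: "'a nanoword \<Rightarrow> 'a \<Rightarrow> nat" where
  "tail_pos \<alpha> X =
     (if ltype \<alpha> X = Type_a then first_pos (word \<alpha>) X else second_pos (word \<alpha>) X)"

definition head_pos :: "'a nanoword \<Rightarrow> 'a \<Rightarrow> nat" where
  "head_pos \<alpha> X =
     (if ltype \<alpha> X = Type_a then second_pos (word \<alpha>) X else first_pos (word \<alpha>) X)"

text \<open>Position \<open>r\<close> is passed when moving cyclically rightwards from \<open>p\<close> to \<open>q\<close>.\<close>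

definition passed :: "nat \<Rightarrow> nat \<Rightarrow> nat \<Rightarrow> bool" where
  "passed p q r \<longleftrightarrow> (if p < q then p < r \<and> r < q else p < r \<or> r < q)"

definition tail_fun :: "'a nanoword \<Rightarrow> 'a \<Rightarrow> 'a \<Rightarrow> int" where
  "tail_fun \<alpha> X Y =
     (if X \<noteq> Y \<and> passed (tail_pos \<alpha> X) (head_pos \<alpha> X) (tail_pos \<alpha> Y) then 1 else 0)"

definition head_fun :: "'a nanoword \<Rightarrow> 'a \<Rightarrow> 'a \<Rightarrow> int" where
  "head_fun \<alpha> X Y =
     (if X \<noteq> Y \<and> passed (tail_pos \<alpha> X) (head_pos \<alpha> X) (head_pos \<alpha> Y) then 1 else 0)"

definition n_fun :: "'a nanoword \<Rightarrow> 'a \<Rightarrow> int" where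
  "n_fun \<alpha> X = (\<Sum>Y\<in>letters \<alpha>. tail_fun \<alpha> X Y - head_fun \<alpha> X Y)"

text \<open>Only the values of \<open>form\<close> on \<open>elements\<close> are relevant, so restricting the form to a
  subset leaves the function itself unchanged.\<close>

datatype 'g based_matrix =
  Based_Matrix (elements: "'g set") (base: 'g) (form: "'g \<Rightarrow> 'g \<Rightarrow> int")

definition is_based_matrix :: "'g based_matrix \<Rightarrow> bool" where
  "is_based_matrix M \<longleftrightarrow> finite (elements M) \<and> base M \<in> elements M \<and>
     (\<forall>g\<in>elements M. \<forall>h\<in>elements M. form M g h = - form M h g)"

definition based_matrix_iso :: "'g based_matrix \<Rightarrow> 'h based_matrix \<Rightarrow> bool" (infix \<open>\<cong>\<^sub>b\<close> 50) where
  "M \<cong>\<^sub>b N \<longleftrightarrow>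
     (\<exists>f. bij_betw f (elements M) (elements N) \<and> f (base M) = base N \<and>
          (\<forall>g\<in>elements M. \<forall>h\<in>elements M. form N (f g) (f h) = form M g h))"

definition annihilating :: "'g based_matrix \<Rightarrow> 'g \<Rightarrow> bool" where
  "annihilating M g \<longleftrightarrow> g \<in> elements M - {base M} \<and> (\<forall>k\<in>elements M. form M g k = 0)"

definition core :: "'g based_matrix \<Rightarrow> 'g \<Rightarrow> bool" where
  "core M g \<longleftrightarrow> g \<in> elements M - {base M} \<and> (\<forall>k\<in>elements M. form M g k = form M (base M) k)"

text \<open>The two elements of a complementary pair are distinct.\<close>

definition complementary :: "'g based_matrix \<Rightarrow> 'g \<Rightarrow> 'g \<Rightarrow> bool" where
  "complementary M g h \<longleftrightarrow> g \<in> elements M - {base M} \<and> h \<in> elements M - {base M} \<and> g \<noteq> h \<and>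
     (\<forall>k\<in>elements M. form M g k + form M h k = form M (base M) k)"

definition primitive :: "'g based_matrix \<Rightarrow> bool" where
  "primitive M \<longleftrightarrow>
     \<not> (\<exists>g. annihilating M g) \<and> \<not> (\<exists>g. core M g) \<and> \<not> (\<exists>g h. complementary M g h)"

definition delete_elements :: "'g set \<Rightarrow> 'g based_matrix \<Rightarrow> 'g based_matrix" where
  "delete_elements D M = Based_Matrix (elements M - D) (base M) (form M)"

inductive reduction :: "'g based_matrix \<Rightarrow> 'g based_matrix \<Rightarrow> bool" where
  "annihilating M g \<Longrightarrow> reduction M (delete_elements {g} M)"
| "core M g \<Longrightarrow> reduction M (delete_elements {g} M)"
| "complementary M g h \<Longrightarrow> reduction M (delete_elements {g, h} M)"

text \<open>The extra element \<open>s\<close> of the based matrix of a nanoword is \<open>None\<close>, and the letter \<open>X\<close>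
  is \<open>Some X\<close>.\<close>

fun nanoword_form :: "'a nanoword \<Rightarrow> 'a option \<Rightarrow> 'a option \<Rightarrow> int" where
  "nanoword_form \<alpha> None None = 0"
| "nanoword_form \<alpha> (Some X) None = n_fun \<alpha> X"
| "nanoword_form \<alpha> None (Some X) = - n_fun \<alpha> X"
| "nanoword_form \<alpha> (Some g) (Some k) = tail_fun \<alpha> g k - head_fun \<alpha> g k +
     (\<Sum>c\<in>letters \<alpha>. tail_fun \<alpha> g c * head_fun \<alpha> k c - head_fun \<alpha> g c * tail_fun \<alpha> k c)"

definition matrix_of :: "'a nanoword \<Rightarrow> 'a option based_matrix" where
  "matrix_of \<alpha> = Based_Matrix (insert None (Some ` letters \<alpha>)) None (nanoword_form \<alpha>)"

text \<open>\<open>P(\<Gamma>)\<close> is only determined up to isomorphism. The predicate says that \<open>M\<close> is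
  a primitive based matrix obtained by reductions from the based matrix of some nanoword
  representing \<open>\<Gamma>\<close>.\<close>

definition is_primitive_matrix_of :: "'a option based_matrix \<Rightarrow> 'a nanoword \<Rightarrow> bool" where
  "is_primitive_matrix_of M \<alpha> \<longleftrightarrow> reduction\<^sup>*\<^sup>* (matrix_of \<alpha>) M \<and> primitive M"

definition is_P :: "'a option based_matrix \<Rightarrow> virtual_string \<Rightarrow> bool" where
  "is_P M \<Gamma> \<longleftrightarrow> (\<exists>\<alpha>. represents \<alpha> \<Gamma> \<and> is_primitive_matrix_of M \<alpha>)"

text \<open>\<open>Crossing A i j\<close> stands for \<open>A\<^sub>i\<^sub>,\<^sub>j\<close> and \<open>Joint i\<close> for \<open>C\<^sub>i\<close>.\<close>

datatype 'a cable_letter = Crossing 'a nat nat | Joint nat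

definition first_block :: "nat \<Rightarrow> nat \<Rightarrow> letter_type \<Rightarrow> 'a \<Rightarrow> 'a cable_letter list" where
  "first_block n i T A =
     (if T = Type_a then map (\<lambda>j. Crossing A i j) [0..<n]
      else Crossing A 0 i # map (\<lambda>j. Crossing A j i) (rev [1..<n]))"

definition second_block :: "nat \<Rightarrow> nat \<Rightarrow> letter_type \<Rightarrow> 'a \<Rightarrow> 'a cable_letter list" where
  "second_block n i T A =
     (if T = Type_a then map (\<lambda>j. Crossing A j i) (rev [0..<n])
      else map (\<lambda>j. Crossing A ((i + 1) mod n) j) [0..<n])"

definition strand :: "nat \<Rightarrow> 'a nanoword \<Rightarrow> nat \<Rightarrow> 'a cable_letter list" where
  "strand n \<alpha> i =
     concat (map (\<lambda>p. let A = word \<alpha> ! p in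
                  if p = first_pos (word \<alpha>) A then first_block n i (ltype \<alpha> A) A
                  else second_block n i (ltype \<alpha> A) A)
             [0..<length (word \<alpha>)])"

text \<open>\<open>(i + n - 1) mod n\<close> is the residue of \<open>i - 1\<close> modulo \<open>n\<close>, avoiding truncated
  subtraction for \<open>i = 0\<close>.\<close>

fun cable_type :: "nat \<Rightarrow> 'a nanoword \<Rightarrow> 'a cable_letter \<Rightarrow> letter_type" where
  "cable_type n \<alpha> (Joint i) = Type_a"
| "cable_type n \<alpha> (Crossing A i j) =
     (if ltype \<alpha> A = Type_a then (if i \<le> j then Type_a else Type_b)
      else (if j > (i + n - 1) mod n then Type_a else Type_b))"

definition cable :: "nat \<Rightarrow> 'a nanoword \<Rightarrow> 'a cable_letter nanoword" where
  "cable n \<alpha> = Nanoword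
     (concat (map (\<lambda>i. strand n \<alpha> i @ [Joint i]) [0..<n - 1]) @ strand n \<alpha> (n - 1) @
      rev (map Joint [0..<n - 1]))
     (cable_type n \<alpha>)"

text \<open>\<open>\<Delta>\<close> is the \<open>n\<close>-cable \<open>\<Gamma>\<^sub>(\<^sub>n\<^sub>)\<close> of \<open>\<Gamma>\<close>, computed from some representative.\<close>

definition is_cable :: "nat \<Rightarrow> virtual_string \<Rightarrow> virtual_string \<Rightarrow> bool" where
  "is_cable n \<Gamma> \<Delta> \<longleftrightarrow> (\<exists>\<alpha> :: nat nanoword. represents \<alpha> \<Gamma> \<and> represents (cable n \<alpha>) \<Delta>)"

lemma gauss_word_card:
  "gauss_word w \<longleftrightarrow> (\<forall>X\<in>set w. card {p. p < length w \<and> w ! p = X} = 2)"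
proof -
  have "{p. p < length w \<and> X = w ! p} = {p. p < length w \<and> w ! p = X}" for X
    by auto
  then show ?thesis
    by (simp add: gauss_word_def count_list_eq_length_filter length_filter_conv_card)
qed

lemma positions:
  assumes "gauss_word w" "X \<in> set w"
  shows "{p. p < length w \<and> w ! p = X} = {first_pos w X, second_pos w X}"
    and "first_pos w X < second_pos w X"
proof -
  have "card {p. p < length w \<and> w ! p = X} = 2"
    using assms by (simp add: gauss_word_card)
  then obtain p q where pq: "{p. p < length w \<and> w ! p = X} = {p, q}" "p \<noteq> q"
    by (auto simp: card_2_iff)
  then show "{p. p < length w \<and> w ! p = X} = {first_pos w X, second_pos w X}"
    and "first_pos w X < second_pos w X"
    unfolding first_pos_def second_pos_def by (auto simp: min_def max_def)
qed

lemma head_tail_skew: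
  assumes "is_nanoword \<alpha>" "X \<in> letters \<alpha>" "Y \<in> letters \<alpha>"
  shows "tail_fun \<alpha> X Y - head_fun \<alpha> X Y = head_fun \<alpha> Y X - tail_fun \<alpha> Y X"
proof (cases "X = Y")
  case True
  then show ?thesis by (simp add: tail_fun_def head_fun_def)
next
  case False
  let ?w = "word \<alpha>"
  have g: "gauss_word ?w" and X: "X \<in> set ?w" and Y: "Y \<in> set ?w"
    using assms by (auto simp: is_nanoword_def letters_def)
  have w: "?w ! p = Z" if "Z \<in> set ?w" "p \<in> {first_pos ?w Z, second_pos ?w Z}" for Z p
    using that positions(1)[OF g that(1)] by blast
  have "p \<noteq> q" if "p \<in> {first_pos ?w X, second_pos ?w X}"
    "q \<in> {first_pos ?w Y, second_pos ?w Y}" for p q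
    using w[OF X that(1)] w[OF Y that(2)] False by blast
  then have "first_pos ?w X \<noteq> first_pos ?w Y" "first_pos ?w X \<noteq> second_pos ?w Y"
    "second_pos ?w X \<noteq> first_pos ?w Y" "second_pos ?w X \<noteq> second_pos ?w Y"
    by blast+
  with positions(2)[OF g X] positions(2)[OF g Y] False show ?thesis
    unfolding tail_fun_def head_fun_def tail_pos_def head_pos_def passed_def
    by (cases "ltype \<alpha> X = Type_a"; cases "ltype \<alpha> Y = Type_a") auto
qed

lemma is_based_matrix_matrix_of:
  assumes "is_nanoword \<alpha>"
  shows "is_based_matrix (matrix_of \<alpha>)"
proof -
  have "nanoword_form \<alpha> (Some g) (Some k) = - nanoword_form \<alpha> (Some k) (Some g)"
    if "g \<in> letters \<alpha>" "k \<in> letters \<alpha>" for g k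
    using head_tail_skew[OF assms that]
    by (simp add: sum_subtractf mult.commute)
  note skew = this
  have "nanoword_form \<alpha> g k = - nanoword_form \<alpha> k g"
    if "g \<in> insert None (Some ` letters \<alpha>)" "k \<in> insert None (Some ` letters \<alpha>)" for g k
  proof (cases g)
    case None
    then show ?thesis by (cases k) simp_all
  next
    case (Some X)
    show ?thesis
    proof (cases k)
      case None
      with Some show ?thesis by simp
    next
      case (Some Y)
      have "X \<in> letters \<alpha>" "Y \<in> letters \<alpha>"
        using that \<open>g = Some X\<close> \<open>k = Some Y\<close> by auto
      then show ?thesis
        unfolding \<open>g = Some X\<close> \<open>k = Some Y\<close> by (rule skew)
    qed
  qed
  moreover have "finite (letters \<alpha>)"
    by (simp add: letters_def)
  ultimately show ?thesis
    unfolding is_based_matrix_def matrix_of_def based_matrix.sel by blast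
qed

lemma represents_nat: "is_nanoword \<beta> \<Longrightarrow> represents \<beta> (abs_virtual_string \<beta>)"
proof -
  assume \<beta>: "is_nanoword \<beta>"
  have "nanoword_iso \<beta> \<beta>"
    unfolding nanoword_iso_def by (rule exI[of _ id]) simp
  with \<beta> show ?thesis
    unfolding represents_def by blast
qed

lemma represents_ex: "\<exists>\<alpha> :: nat nanoword. represents \<alpha> \<Gamma>"
proof -
  obtain \<beta> where "homotopic \<beta> \<beta>" "\<Gamma> = abs_virtual_string \<beta>"
    by (metis Quotient3_virtual_string Quotient3_def)
  then show ?thesis
    using represents_nat by (auto simp: homotopic_def)
qed

lemma is_nanoword_represents:
  fixes \<alpha> :: "'a nanoword"
  assumes "is_nanoword \<alpha>"
  shows "\<exists>\<Gamma>. represents \<alpha> \<Gamma>"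
proof -
  obtain f :: "'a \<Rightarrow> nat" where f: "inj_on f (set (word \<alpha>))"
    using finite_imp_inj_to_nat_seg[of "set (word \<alpha>)"] by auto
  define \<beta> where
    "\<beta> = Nanoword (map f (word \<alpha>)) (\<lambda>k. ltype \<alpha> (inv_into (set (word \<alpha>)) f k))"
  have "count_list (map f (word \<alpha>)) (f X) = count_list (word \<alpha>) X" if "X \<in> set (word \<alpha>)" for X
  proof -
    have "filter (\<lambda>y. f X = f y) (word \<alpha>) = filter (\<lambda>y. X = y) (word \<alpha>)"
      using f that by (intro filter_cong) (auto dest: inj_onD)
    then show ?thesis
      by (simp add: count_list_eq_length_filter filter_map o_def)
  qed
  then have "is_nanoword \<beta>"
    using assms by (auto simp: \<beta>_def is_nanoword_def gauss_word_def)
  moreover have "nanoword_iso \<alpha> \<beta>"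
    using f by (auto simp: nanoword_iso_def \<beta>_def letters_def intro!: exI[of _ f])
  ultimately show ?thesis
    using assms by (auto simp: represents_def)
qed

lemma is_primitive_matrix_ex: "finite (elements M) \<Longrightarrow> \<exists>N. reduction\<^sup>*\<^sup>* M N \<and> primitive N"
proof (induction "card (elements M)" arbitrary: M rule: less_induct)
  case less
  show ?case
  proof (cases "primitive M")
    case False
    then obtain N where N: "reduction M N"
      by (auto simp: primitive_def intro: reduction.intros)
    then have "elements N \<subset> elements M"
      by (auto elim!: reduction.cases
          simp: delete_elements_def annihilating_def core_def complementary_def)
    then have "card (elements N) < card (elements M)" "finite (elements N)"
      using less.prems by (auto intro: psubset_card_mono finite_subset)
    with less.hyps N show ?thesis
      by (meson converse_rtranclp_into_rtranclp)
  qed blast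
qed

lemma is_P_ex: "\<exists>M :: nat option based_matrix. is_P M \<Gamma>"
proof -
  obtain \<alpha> :: "nat nanoword" where "represents \<alpha> \<Gamma>"
    using represents_ex by blast
  moreover have "finite (elements (matrix_of \<alpha>))"
    by (simp add: matrix_of_def letters_def)
  ultimately show ?thesis
    using is_primitive_matrix_ex[of "matrix_of \<alpha>"]
    by (auto simp: is_P_def is_primitive_matrix_of_def)
qed

lemma count_list_concat_map:
  "count_list (concat (map f xs)) y = (\<Sum>x\<leftarrow>xs. count_list (f x) y)"
  by (induction xs) auto

lemma count_list_map_upt:
  assumes "\<And>k. (f k = y) = (P \<and> k = i)"
  shows "count_list (map f [a..<b]) y = (if P \<and> a \<le> i \<and> i < b then 1 else 0)"
proof (induction b)
  case (Suc b)
  show ?case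
  proof (cases "a \<le> b")
    case True
    then have "count_list (map f [a..<Suc b]) y =
        count_list (map f [a..<b]) y + (if P \<and> b = i then 1 else 0)"
      by (simp add: assms)
    with Suc True show ?thesis
      by auto
  next
    case False
    then show ?thesis by auto
  qed
qed simp

lemma count_list_rev_upt:
  "count_list (map f (rev [a..<b])) y = count_list (map f [a..<b]) y"
  by (simp only: rev_map[symmetric] count_list_rev)

lemma count_first_block:
  assumes "k < n"
  shows "count_list (first_block n k T B) (Crossing A i j) =
    (if A = B \<and> i < n \<and> j < n \<and> k = (if T = Type_a then i else j) then 1 else 0)"
proof (cases "T = Type_a")
  case True
  have "count_list (map (\<lambda>l. Crossing B k l) [0..<n]) (Crossing A i j)
        = (if (A = B \<and> i = k) \<and> 0 \<le> j \<and> j < n then 1 else 0)"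
    by (rule count_list_map_upt) auto
  with True assms show ?thesis
    unfolding first_block_def by auto
next
  case False
  have "count_list (map (\<lambda>l. Crossing B l k) [1..<n]) (Crossing A i j)
        = (if (A = B \<and> j = k) \<and> 1 \<le> i \<and> i < n then 1 else 0)"
    by (rule count_list_map_upt) auto
  with False assms show ?thesis
    unfolding first_block_def by (auto simp: count_list_rev_upt)
qed

lemma pred_mod_iff:
  fixes i k n :: nat
  assumes "k < n"
  shows "(i < n \<and> k = (i + n - 1) mod n) \<longleftrightarrow> i = (k + 1) mod n"
proof -
  have s: "(k + 1) mod n = (if k + 1 = n then 0 else k + 1)"
    using assms by simp
  show ?thesis
  proof (cases "i = 0")
    case True
    then show ?thesis using assms s by auto
  next
    case False
    then have "(i + n - 1) mod n = (i - 1 + n) mod n"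
      by (intro arg_cong[of _ _ "\<lambda>x. x mod n"]) linarith
    then have "(i + n - 1) mod n = i - 1" if "i < n"
      using that by (simp only: mod_add_self2) simp
    then show ?thesis
      unfolding s using assms False by (cases "i < n") auto
  qed
qed

lemma count_second_block:
  assumes "k < n"
  shows "count_list (second_block n k T B) (Crossing A i j) =
    (if A = B \<and> i < n \<and> j < n \<and> k = (if T = Type_a then j else (i + n - 1) mod n) then 1 else 0)"
proof (cases "T = Type_a")
  case True
  have "count_list (map (\<lambda>l. Crossing B l k) [0..<n]) (Crossing A i j)
        = (if (A = B \<and> j = k) \<and> 0 \<le> i \<and> i < n then 1 else 0)"
    by (rule count_list_map_upt) auto
  with True assms show ?thesis
    unfolding second_block_def by (auto simp: count_list_rev_upt)
next
  case False
  have "count_list (map (\<lambda>l. Crossing B ((k + 1) mod n) l) [0..<n]) (Crossing A i j)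
        = (if (A = B \<and> i = (k + 1) mod n) \<and> 0 \<le> j \<and> j < n then 1 else 0)"
    by (rule count_list_map_upt) auto
  moreover have "(i < n \<and> k = (i + n - 1) mod n) \<longleftrightarrow> i = (k + 1) mod n"
    using pred_mod_iff[OF assms] .
  ultimately show ?thesis
    using False unfolding second_block_def by auto
qed

lemma count_blocks_Joint:
  "count_list (first_block n k T B) (Joint i) = 0"
  "count_list (second_block n k T B) (Joint i) = 0"
  by (auto simp: first_block_def second_block_def count_list_0_iff)

lemma count_strand_Joint: "count_list (strand n \<alpha> k) (Joint i) = 0"
  unfolding strand_def count_list_concat_map
  by (auto simp: count_blocks_Joint Let_def intro!: sum_list_0)

lemma count_strands_Crossing:
  "(\<Sum>k<n. count_list (strand n \<alpha> k) (Crossing A i j)) =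
     (if i < n \<and> j < n then count_list (word \<alpha>) A else 0)"
proof -
  let ?w = "word \<alpha>"
  let ?f = "\<lambda>k p. count_list (let B = ?w ! p in
                  if p = first_pos ?w B then first_block n k (ltype \<alpha> B) B
                  else second_block n k (ltype \<alpha> B) B) (Crossing A i j)"
  have "(\<Sum>k<n. count_list (strand n \<alpha> k) (Crossing A i j)) = (\<Sum>k<n. \<Sum>p<length ?w. ?f k p)"
    unfolding strand_def count_list_concat_map
    by (simp add: interv_sum_list_conv_sum_set_nat atLeast0LessThan)
  also have "\<dots> = (\<Sum>p<length ?w. \<Sum>k<n. ?f k p)"
    by (rule sum.swap)
  also have "\<dots> = (\<Sum>p<length ?w. if ?w ! p = A \<and> i < n \<and> j < n then 1 else 0)"
  proof (rule sum.cong[OF refl])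
    fix p
    let ?B = "?w ! p"
    define c where "c = (if p = first_pos ?w ?B then (if ltype \<alpha> ?B = Type_a then i else j)
       else (if ltype \<alpha> ?B = Type_a then j else (i + n - 1) mod n))"
    have "(\<Sum>k<n. ?f k p) = (\<Sum>k<n. if k = c then if ?B = A \<and> i < n \<and> j < n then 1 else 0 else 0)"
      by (rule sum.cong) (auto simp: Let_def count_first_block count_second_block c_def)
    also have "\<dots> = (if ?B = A \<and> i < n \<and> j < n then 1 else 0)"
      by (auto simp: sum.delta c_def)
    finally show "(\<Sum>k<n. ?f k p) = (if ?B = A \<and> i < n \<and> j < n then 1 else 0)" .
  qed
  also have "\<dots> = (if i < n \<and> j < n then count_list ?w A else 0)"
    by (auto simp: count_list_eq_length_filter length_filter_conv_card sum.If_cases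
        intro!: arg_cong[of _ _ card])
  finally show ?thesis .
qed

lemma is_nanoword_cable:
  assumes "is_nanoword \<alpha>" "n \<ge> 1"
  shows "is_nanoword (cable n \<alpha>)"
proof -
  obtain m where n: "n = Suc m"
    using assms(2) by (cases n) auto
  have J: "count_list (map Joint [0..<m]) (Joint i) = (if i < m then 1 else 0)" for i
    using count_list_map_upt[of Joint "Joint i" True i 0 m] by auto
  have C: "count_list (map Joint [0..<m]) (Crossing A i j) = 0" for A :: 'a and i j
    by (auto simp: count_list_0_iff)
  have word: "count_list (word (cable n \<alpha>)) y =
      (\<Sum>k<n. count_list (strand n \<alpha> k) y) + 2 * count_list (map Joint [0..<m]) y" for y
  proof -
    have "(\<Sum>k\<leftarrow>[0..<m]. count_list (strand n \<alpha> k @ [Joint k]) y) =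
        (\<Sum>k<m. count_list (strand n \<alpha> k) y) + count_list (map Joint [0..<m]) y"
      by (induction m) auto
    then show ?thesis
      by (simp add: cable_def n count_list_concat_map)
  qed
  show ?thesis
    unfolding is_nanoword_def gauss_word_def
  proof
    fix y assume "y \<in> set (word (cable n \<alpha>))"
    then have ne: "count_list (word (cable n \<alpha>)) y \<noteq> 0"
      by (simp add: count_list_0_iff)
    show "count_list (word (cable n \<alpha>)) y = 2"
    proof (cases y)
      case (Joint i)
      with ne show ?thesis by (auto simp: word count_strand_Joint J split: if_splits)
    next
      case (Crossing A i j)
      with ne have "count_list (word \<alpha>) A \<noteq> 0" "i < n" "j < n"
        by (auto simp: word C count_strands_Crossing split: if_splits)
      with Crossing assms(1) show ?thesis
        by (auto simp: word C count_strands_Crossing is_nanoword_def gauss_word_def count_list_0_iff)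
    qed
  qed
qed

lemma is_cable_ex:
  assumes "n \<ge> 1"
  shows "\<exists>\<Delta>. is_cable n \<Gamma> \<Delta>"
proof -
  obtain \<alpha> :: "nat nanoword" where \<alpha>: "represents \<alpha> \<Gamma>"
    using represents_ex by blast
  then have "is_nanoword (cable n \<alpha>)"
    using is_nanoword_cable[OF _ assms] unfolding represents_def by blast
  then obtain \<Delta> where "represents (cable n \<alpha>) \<Delta>"
    using is_nanoword_represents by blast
  with \<alpha> show ?thesis
    unfolding is_cable_def by blast
qed

end

theory Submission
  imports Defs
begin

text \<open>
  In homological terms a letter \<open>X\<close> is a loop \<open>[X]\<close> on a surface, \<open>s\<close> is the whole curve and
  \<open>b\<close> is the intersection form. The crossing \<open>A\<^sub>i\<^sub>,\<^sub>j\<close> of the \<open>n\<close>-cable has the class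
  \<open>[A] + r s\<close> with \<open>r = (j - i) mod n\<close>, the joint \<open>C\<^sub>i\<close> has the class \<open>(n - 1 - i) s\<close>, and the whole
  cable has the class \<open>n s\<close>. Hence the based matrix of the cable depends only on the based matrix
  of the nanoword, through a construction that makes sense for every based matrix. This
  construction turns a reduction of a based matrix into a sequence of reductions, because the
  classes coming from a deleted element cancel in pairs. Together with the uniqueness of primitive
  reducts (reductions are locally confluent up to isomorphism) and the homotopy invariance of \<open>P\<close>,
  this gives the theorem.
\<close>

section \<open>Reductions of based matrices\<close>

text \<open>Intersection numbers are sums over the self-crossings of the curve. Give each loop a
  weight, twice the indicator of the part of the curve that it runs through (so 2 everywhere for
  \<open>s\<close>); two loops pair through the determinants of their weights at the two ends of
  each letter. Doubling leaves room for the value 1 at the crossing where a loop turns, and explains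
  the factor 4 that accompanies every form. In the cable, the \<open>n * n\<close> crossings lying
  over one letter are indexed by the strand of the tail and the strand of the head, so their
  determinants add up to a single determinant of weights summed over strands. Summing over parallel
  strands projects to the original curve, where the class \<open>[A] + r s\<close> becomes visible
  as the weight of \<open>[A]\<close> plus \<open>2 r\<close>. The obstacle is a loop that turns
  inside a block of parallel crossings: its weight is not constant along that block. The resulting
  corrections do not vanish one by one; in total they are the negative of what the joints
  contribute.\<close>

lemma iso_refl: "M \<cong>\<^sub>b M"
  unfolding based_matrix_iso_def by (rule exI[of _ id]) simp

lemma iso_sym:
  assumes "M \<cong>\<^sub>b N" "is_based_matrix M"
  shows "N \<cong>\<^sub>b M"
proof -
  obtain f where f: "bij_betw f (elements M) (elements N)" "f (base M) = base N"
    "\<And>g h. g \<in> elements M \<Longrightarrow> h \<in> elements M \<Longrightarrow> form N (f g) (f h) = form M g h"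
    using assms(1) unfolding based_matrix_iso_def by blast
  let ?i = "inv_into (elements M) f"
  have i: "?i g \<in> elements M" "f (?i g) = g" if "g \<in> elements N" for g
    using f(1) that by (auto simp: bij_betw_def inv_into_into f_inv_into_f)
  have "?i (base N) = base M"
    using assms(2) f by (metis bij_betw_inv_into_left is_based_matrix_def)
  then show ?thesis
    unfolding based_matrix_iso_def
    using bij_betw_inv_into[OF f(1)] f(3) i by (intro exI[of _ ?i]) (metis (no_types, lifting))
qed

lemma iso_trans [trans]:
  assumes "M \<cong>\<^sub>b N" "N \<cong>\<^sub>b P"
  shows "M \<cong>\<^sub>b P"
proof -
  obtain f g where f: "bij_betw f (elements M) (elements N)" "f (base M) = base N"
      "\<forall>x\<in>elements M. \<forall>y\<in>elements M. form N (f x) (f y) = form M x y"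
    and g: "bij_betw g (elements N) (elements P)" "g (base N) = base P"
      "\<forall>x\<in>elements N. \<forall>y\<in>elements N. form P (g x) (g y) = form N x y"
    using assms unfolding based_matrix_iso_def by blast
  then show ?thesis
    unfolding based_matrix_iso_def
    by (intro exI[of _ "g \<circ> f"]) (auto intro: bij_betw_trans dest: bij_betwE)
qed

lemma is_based_matrixD:
  assumes "is_based_matrix M"
  shows "finite (elements M)" "base M \<in> elements M"
    "\<And>g h. g \<in> elements M \<Longrightarrow> h \<in> elements M \<Longrightarrow> form M g h = - form M h g"
  using assms unfolding is_based_matrix_def by blast+

lemma is_based_matrix_iso:
  assumes "M \<cong>\<^sub>b N" "is_based_matrix M"
  shows "is_based_matrix N"
proof -
  obtain f where f: "bij_betw f (elements M) (elements N)" "f (base M) = base N"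
      "\<And>x y. x \<in> elements M \<Longrightarrow> y \<in> elements M \<Longrightarrow> form N (f x) (f y) = form M x y"
    using assms unfolding based_matrix_iso_def by blast
  then have e: "elements N = f ` elements M"
    by (simp add: bij_betw_def)
  note M = is_based_matrixD[OF assms(2)]
  have "form N (f x) (f y) = - form N (f y) (f x)" if "x \<in> elements M" "y \<in> elements M" for x y
    using f(3)[OF that] f(3)[OF that(2,1)] M(3)[OF that] by presburger
  then show ?thesis
    unfolding is_based_matrix_def e f(2)[symmetric] using M(1,2) by blast
qed

lemma elements_delete [simp]: "elements (delete_elements D M) = elements M - D"
  and base_delete [simp]: "base (delete_elements D M) = base M"
  and form_delete [simp]: "form (delete_elements D M) = form M"
  by (simp_all add: delete_elements_def)

lemma delete_delete:
  "delete_elements D (delete_elements E M) = delete_elements (E \<union> D) M"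
  by (simp add: delete_elements_def Diff_eq Int_ac)

lemma is_based_matrix_delete:
  "is_based_matrix M \<Longrightarrow> base M \<notin> D \<Longrightarrow> is_based_matrix (delete_elements D M)"
  unfolding is_based_matrix_def elements_delete base_delete form_delete by blast

text \<open>Names the deleted set rather than the resulting matrix, so that two reductions of one
  matrix can be compared by how their sets meet.\<close>

inductive removable :: "'g based_matrix \<Rightarrow> 'g set \<Rightarrow> bool" for M where
  annihilating: "annihilating M g \<Longrightarrow> removable M {g}"
| core: "core M g \<Longrightarrow> removable M {g}"
| complementary: "complementary M g h \<Longrightarrow> removable M {g, h}"

lemma reduction_iff: "reduction M N \<longleftrightarrow> (\<exists>D. removable M D \<and> N = delete_elements D M)"
proof
  show "reduction M N \<Longrightarrow> \<exists>D. removable M D \<and> N = delete_elements D M"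
    by (erule reduction.cases) (simp, rule exI, rule conjI, erule removable.intros, rule refl)+
  show "\<exists>D. removable M D \<and> N = delete_elements D M \<Longrightarrow> reduction M N"
    by (elim exE conjE removable.cases) (simp_all add: reduction.intros)
qed

lemma removable_subset: "removable M D \<Longrightarrow> D \<subseteq> elements M - {base M}"
  by (erule removable.cases) (simp_all add: annihilating_def core_def complementary_def)

text \<open>All three conditions are universal over the elements, so they survive the deletion of
  anything outside \<open>D\<close>. This is why independent reductions commute.\<close>

lemma removable_delete:
  assumes "removable M D" "D \<inter> E = {}"
  shows "removable (delete_elements E M) D"
  using assms(1)
proof cases
  case (annihilating g)
  then have "annihilating (delete_elements E M) g"
    using assms(2) by (simp add: annihilating_def)
  then show ?thesis
    using annihilating(1) by (simp add: removable.annihilating)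
next
  case (core g)
  then have "core (delete_elements E M) g"
    using assms(2) by (simp add: core_def)
  then show ?thesis
    using core(1) by (simp add: removable.core)
next
  case (complementary g h)
  then have "complementary (delete_elements E M) g h"
    using assms(2) by (simp add: complementary_def)
  then show ?thesis
    using complementary(1) by (simp add: removable.complementary)
qed

lemma not_primitive_iff: "\<not> primitive M \<longleftrightarrow> (\<exists>N. reduction M N)"
proof
  show "\<not> primitive M \<Longrightarrow> \<exists>N. reduction M N"
    unfolding primitive_def by (auto intro: reduction.intros)
  show "\<exists>N. reduction M N \<Longrightarrow> \<not> primitive M"
    unfolding primitive_def by (elim exE, erule reduction.cases) blast+
qed

lemma is_based_matrix_reduction:
  "reduction M N \<Longrightarrow> is_based_matrix M \<Longrightarrow> is_based_matrix N"
  unfolding reduction_iff using is_based_matrix_delete removable_subset by blast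

lemma is_based_matrix_reductions:
  "reduction\<^sup>*\<^sup>* M N \<Longrightarrow> is_based_matrix M \<Longrightarrow> is_based_matrix N"
  by (induction rule: rtranclp_induct) (auto intro: is_based_matrix_reduction)

lemma card_reduction:
  assumes "reduction M N" "is_based_matrix M"
  shows "card (elements N) < card (elements M)"
proof -
  obtain D where D: "removable M D" "N = delete_elements D M"
    using assms(1) by (auto simp: reduction_iff)
  moreover have "D \<noteq> {}"
    using D(1) by cases simp_all
  ultimately show ?thesis
    using is_based_matrixD(1)[OF assms(2)] removable_subset[OF D(1)]
    by (intro psubset_card_mono) auto
qed

lemma iso_reduction:
  assumes "M \<cong>\<^sub>b M'" "is_based_matrix M" "reduction M N"
  shows "\<exists>N'. reduction M' N' \<and> N \<cong>\<^sub>b N'"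
proof -
  obtain f where f: "bij_betw f (elements M) (elements M')" "f (base M) = base M'"
      "\<And>x y. x \<in> elements M \<Longrightarrow> y \<in> elements M \<Longrightarrow> form M' (f x) (f y) = form M x y"
    using assms unfolding based_matrix_iso_def by blast
  obtain D where D: "removable M D" "N = delete_elements D M"
    using assms(3) by (auto simp: reduction_iff)
  have sub: "D \<subseteq> elements M" and b: "base M \<in> elements M"
    using removable_subset[OF D(1)] is_based_matrixD(2)[OF assms(2)] by blast+
  have e: "elements M' = f ` elements M" and inj: "inj_on f (elements M)"
    using f(1) by (auto simp: bij_betw_def)
  have ne: "f x \<in> elements M' - {base M'}" if "x \<in> elements M - {base M}" for x
    using that b inj_onD[OF inj, of x "base M"] e f(2) by auto
  have eqs: "(\<forall>k\<in>elements M'. P k) \<longleftrightarrow> (\<forall>k\<in>elements M. P (f k))" for P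
    by (simp add: e)
  have fb: "form M' (base M') (f k) = form M (base M) k" if "k \<in> elements M" for k
    using f(3)[OF b that] f(2) by simp
  have ann: "annihilating M' (f g)" if "annihilating M g" for g
    using that ne f(3) by (auto simp: annihilating_def eqs)
  have cor: "core M' (f g)" if "core M g" for g
    using that ne f(3) by (auto simp: core_def eqs fb)
  have com: "complementary M' (f g) (f h)" if "complementary M g h" for g h
  proof -
    have "f g \<noteq> f h"
      using that inj by (auto simp: complementary_def dest: inj_onD)
    with that ne f(3) show ?thesis
      by (auto simp: complementary_def eqs fb)
  qed
  have "removable M' (f ` D)"
    using D(1) by cases (simp_all add: ann cor com removable.intros)
  moreover have "f ` (elements M - D) = elements M' - f ` D"
    using inj sub e by (simp add: inj_on_image_set_diff)
  then have "bij_betw f (elements M - D) (elements M' - f ` D)"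
    using inj by (auto simp: bij_betw_def intro: inj_on_subset)
  then have "N \<cong>\<^sub>b delete_elements (f ` D) M'"
    unfolding based_matrix_iso_def D(2) using f by (intro exI[of _ f]) auto
  ultimately show ?thesis
    by (auto simp: reduction_iff)
qed

section \<open>Confluence up to isomorphism and uniqueness of primitive reducts\<close>

lemma primitive_iso:
  assumes "M \<cong>\<^sub>b N" "is_based_matrix M" "primitive M"
  shows "primitive N"
proof (rule ccontr)
  assume "\<not> primitive N"
  then obtain N' where "reduction N N'"
    by (auto simp: not_primitive_iff)
  from iso_reduction[OF iso_sym[OF assms(1,2)] is_based_matrix_iso[OF assms(1,2)] this]
  show False
    using assms(3) not_primitive_iff by blast
qed

text \<open>If \<open>g\<close> is complementary both to \<open>h\<close> and to \<open>k\<close>, then \<open>h\<close> and \<open>k\<close> have equal rows,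
  so they can be exchanged.\<close>

lemma removable_overlap:
  assumes M: "is_based_matrix M" and D: "removable M D" and E: "removable M E"
    and "D \<noteq> E" "D \<inter> E \<noteq> {}"
  shows "(D \<subseteq> E \<and> removable (delete_elements D M) (E - D)) \<or>
    (E \<subseteq> D \<and> removable (delete_elements E M) (D - E)) \<or>
    delete_elements D M \<cong>\<^sub>b delete_elements E M"
proof -
  \<comment> \<open>The row of \<open>h\<close> is the row of \<open>s\<close> minus the row of
    \<open>g\<close>, so the partner of an annihilating element is core and the partner of a core
    element is annihilating.\<close>
  have single: "removable (delete_elements {g} M) {h}"
    if "annihilating M g \<or> core M g" "complementary M g h" for g h
  proof -
    have "core (delete_elements {g} M) h \<or> annihilating (delete_elements {g} M) h"
      using that by (auto simp: annihilating_def core_def complementary_def)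
    then show ?thesis
      by (auto intro: removable.intros)
  qed
  have comm: "complementary M g h \<longleftrightarrow> complementary M h g" for g h
    by (auto simp: complementary_def add.commute)
  have swap: "delete_elements {g, h} M \<cong>\<^sub>b delete_elements {g, k} M"
    if c: "complementary M g h" "complementary M g k" for g h k
  proof -
    define f where "f x = (if x = k then h else x)" for x
    have row: "form M h x = form M k x" if "x \<in> elements M" for x
      using c that unfolding complementary_def by (metis add_left_cancel)
    have skew: "form M x y = - form M y x" if "x \<in> elements M" "y \<in> elements M" for x y
      using is_based_matrixD(3)[OF M that] .
    have hk: "h \<in> elements M" "k \<in> elements M" "h \<noteq> base M" "k \<noteq> base M" "g \<noteq> h" "g \<noteq> k"
      using c by (auto simp: complementary_def)
    have col: "form M x h = form M x k" if "x \<in> elements M" for x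
      using row[OF that] skew[OF that] hk by metis
    have "bij_betw f (elements M - {g, h}) (elements M - {g, k})"
      unfolding f_def by (rule bij_betw_byWitness[where f' = "\<lambda>x. if x = h then k else x"]) (use hk in auto)
    then show ?thesis
      unfolding based_matrix_iso_def using hk row col
      by (intro exI[of _ f]) (auto simp: f_def)
  qed
  have mixed: "{g} \<subseteq> {h, k} \<and> removable (delete_elements {g} M) ({h, k} - {g})"
    if "annihilating M g \<or> core M g" "complementary M h k" "{g} \<inter> {h, k} \<noteq> {}" for g h k
  proof -
    have "h \<noteq> k"
      using that(2) by (simp add: complementary_def)
    moreover have "g = h \<or> g = k"
      using that(3) by blast
    ultimately show ?thesis
      using single[OF that(1), of k] single[OF that(1), of h] that(2) comm[of h k]
      by (auto simp: insert_Diff_if)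
  qed
  have pairs: "delete_elements {g, h} M \<cong>\<^sub>b delete_elements {g', h'} M"
    if c: "complementary M g h" "complementary M g' h'" and ne: "{g, h} \<inter> {g', h'} \<noteq> {}"
    for g h g' h'
  proof -
    have c': "complementary M h g" "complementary M h' g'"
      using c comm by blast+
    have "g = g' \<or> g = h' \<or> h = g' \<or> h = h'"
      using ne by blast
    then show ?thesis
      using swap[of g h h'] swap[of g h g'] swap[of h g h'] swap[of h g g'] c c'
      by (auto simp: insert_commute)
  qed
  have cases: "(\<exists>g. F = {g} \<and> (annihilating M g \<or> core M g)) \<or>
      (\<exists>g h. F = {g, h} \<and> complementary M g h)" if "removable M F" for F
    using that by cases (simp_all, blast)
  consider g h where "D = {g}" "E = {h}"
    | g h k where "D = {g}" "annihilating M g \<or> core M g" "E = {h, k}" "complementary M h k"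
    | g h k where "E = {g}" "annihilating M g \<or> core M g" "D = {h, k}" "complementary M h k"
    | g h g' h' where "D = {g, h}" "complementary M g h" "E = {g', h'}" "complementary M g' h'"
    using cases[OF D] cases[OF E] by blast
  then show ?thesis
  proof cases
    case (1 g h)
    then show ?thesis
      using \<open>D \<noteq> E\<close> \<open>D \<inter> E \<noteq> {}\<close> by blast
  next
    case (2 g h k)
    then show ?thesis
      using \<open>D \<inter> E \<noteq> {}\<close> mixed[OF 2(2)] by simp
  next
    case (3 g h k)
    moreover have "E \<inter> D \<noteq> {}"
      using \<open>D \<inter> E \<noteq> {}\<close> by blast
    ultimately show ?thesis
      using mixed[OF 3(2)] by simp
  next
    case (4 g h g' h')
    then show ?thesis
      using \<open>D \<inter> E \<noteq> {}\<close> pairs by blast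
  qed
qed

text \<open>Disjoint sets can be deleted in either order, nested sets differ by one further
  reduction, and distinct overlapping pairs already leave isomorphic matrices; hence at most one
  more step is needed on each side.\<close>

lemma local_confluence:
  assumes M: "is_based_matrix M" and "reduction M N" "reduction M N'"
  shows "\<exists>P P'. reduction\<^sup>=\<^sup>= N P \<and> reduction\<^sup>=\<^sup>= N' P' \<and> P \<cong>\<^sub>b P'"
proof -
  obtain D E where D: "removable M D" "N = delete_elements D M"
    and E: "removable M E" "N' = delete_elements E M"
    using assms by (auto simp: reduction_iff)
  consider "D = E" | "D \<inter> E = {}" | "D \<noteq> E" "D \<inter> E \<noteq> {}" by blast
  then show ?thesis
  proof cases
    case 1
    with D E show ?thesis using iso_refl by blast
  next
    case 2
    then have "reduction N (delete_elements (D \<union> E) M)" "reduction N' (delete_elements (D \<union> E) M)"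
      unfolding D(2) E(2) reduction_iff
      using removable_delete[OF D(1), of E] removable_delete[OF E(1), of D]
      by (auto simp: delete_delete Un_commute Int_commute)
    then show ?thesis using iso_refl by blast
  next
    case 3
    from removable_overlap[OF M D(1) E(1) 3] show ?thesis
    proof (elim disjE conjE)
      assume "D \<subseteq> E" "removable (delete_elements D M) (E - D)"
      then have "reduction N N'"
        unfolding reduction_iff D(2) E(2) by (metis delete_delete Un_Diff_cancel sup.absorb2)
      then show ?thesis using iso_refl by blast
    next
      assume "E \<subseteq> D" "removable (delete_elements E M) (D - E)"
      then have "reduction N' N"
        unfolding reduction_iff D(2) E(2) by (metis delete_delete Un_Diff_cancel sup.absorb2)
      then show ?thesis using iso_refl by blast
    qed (auto simp: D E)
  qed
qed

text \<open>Newman's argument modulo isomorphism, with the number of elements as the decreasing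
  measure. Both matrices share one element type because the induction runs at a fixed type;
  \<open>primitive_reduct_unique\<close> lifts this restriction.\<close>

lemma primitive_reduct_unique_aux:
  fixes M M' :: "'g based_matrix"
  assumes "M \<cong>\<^sub>b M'" "is_based_matrix M"
    and "reduction\<^sup>*\<^sup>* M P" "primitive P" "reduction\<^sup>*\<^sup>* M' P'" "primitive P'"
  shows "P \<cong>\<^sub>b P'"
  using assms
proof (induction "card (elements M)" arbitrary: M M' P P' rule: less_induct)
  case less
  have M': "is_based_matrix M'"
    using less.prems is_based_matrix_iso by blast
  show ?case
  proof (cases "primitive M")
    case True
    then have "primitive M'"
      using less.prems primitive_iso by blast
    with True less.prems show ?thesis
      by (metis converse_rtranclpE not_primitive_iff)
  next
    case False
    then have "\<not> primitive M'"
      using less.prems M' primitive_iso iso_sym by blast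
    then obtain N N' where N: "reduction M N" "reduction\<^sup>*\<^sup>* N P"
      and N': "reduction M' N'" "reduction\<^sup>*\<^sup>* N' P'"
      using False less.prems by (metis converse_rtranclpE)
    \<comment> \<open>The step \<open>M'\<close> to \<open>N'\<close> is transported back along the
      isomorphism, so that both reductions start at \<open>M\<close> and local confluence
      applies.\<close>
    obtain K where K: "reduction M K" "N' \<cong>\<^sub>b K"
      using iso_reduction[OF iso_sym] less.prems M' N' by blast
    have bm: "is_based_matrix N" "is_based_matrix K" "is_based_matrix N'"
      using less.prems N K N' M' is_based_matrix_reduction by blast+
    obtain R R' where R: "reduction\<^sup>=\<^sup>= N R" "reduction\<^sup>=\<^sup>= K R'" "R \<cong>\<^sub>b R'"
      using local_confluence[OF less.prems(2) N(1) K(1)] by blast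
    then have NR: "reduction\<^sup>*\<^sup>* N R" and KR: "reduction\<^sup>*\<^sup>* K R'"
      by auto
    have Rb: "is_based_matrix R" "is_based_matrix R'"
      using bm NR KR is_based_matrix_reductions by blast+
    obtain Q Q' where Q: "reduction\<^sup>*\<^sup>* R Q" "primitive Q" "reduction\<^sup>*\<^sup>* R' Q'" "primitive Q'"
      using is_primitive_matrix_ex Rb unfolding is_based_matrix_def by metis
    have cN: "card (elements N) < card (elements M)" and cK: "card (elements K) < card (elements M)"
      using card_reduction N(1) K(1) less.prems(2) by blast+
    have cR: "card (elements R) < card (elements M)"
      using R(1) cN card_reduction[OF _ bm(1), of R] by auto
    have "P \<cong>\<^sub>b Q"
      using less.hyps[OF cN iso_refl bm(1) N(2) less.prems(4) _ Q(2)] rtranclp_trans[OF NR Q(1)]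
      by blast
    also have "Q \<cong>\<^sub>b Q'"
      using less.hyps[OF cR R(3) Rb(1)] Q by blast
    also have "Q' \<cong>\<^sub>b P'"
      using less.hyps[OF cK iso_sym[OF K(2) bm(3)] bm(2) _ Q(4) N'(2) less.prems(6)]
        rtranclp_trans[OF KR Q(3)] by blast
    finally show ?thesis .
  qed
qed

lemma iso_reductions:
  assumes "reduction\<^sup>*\<^sup>* M N" "M \<cong>\<^sub>b M'" "is_based_matrix M"
  shows "\<exists>N'. reduction\<^sup>*\<^sup>* M' N' \<and> N \<cong>\<^sub>b N'"
  using assms(1)
proof (induction rule: rtranclp_induct)
  case base
  then show ?case using assms(2) by blast
next
  case (step K N)
  then obtain K' where "reduction\<^sup>*\<^sup>* M' K'" "K \<cong>\<^sub>b K'" by blast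
  moreover have "is_based_matrix K"
    using step.hyps(1) assms(3) by (rule is_based_matrix_reductions)
  ultimately show ?case
    using iso_reduction[of K K' N] step.hyps(2) by (meson rtranclp.rtrancl_into_rtrancl)
qed

text \<open>The reductions of \<open>M\<close> are replayed in \<open>M'\<close>, which brings both
  primitive reducts into the same type.\<close>

lemma primitive_reduct_unique:
  assumes "M \<cong>\<^sub>b M'" "is_based_matrix M"
    and P: "reduction\<^sup>*\<^sup>* M P" "primitive P" and P': "reduction\<^sup>*\<^sup>* M' P'" "primitive P'"
  shows "P \<cong>\<^sub>b P'"
proof -
  obtain Q where Q: "reduction\<^sup>*\<^sup>* M' Q" "P \<cong>\<^sub>b Q"
    using iso_reductions[OF P(1) assms(1,2)] by blast
  have "primitive Q"
    using primitive_iso[OF Q(2) is_based_matrix_reductions[OF P(1) assms(2)] P(2)] .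
  then have "Q \<cong>\<^sub>b P'"
    using primitive_reduct_unique_aux[OF iso_refl is_based_matrix_iso[OF assms(1,2)] Q(1) _ P'] by blast
  with Q(2) show ?thesis by (rule iso_trans)
qed

text \<open>Equality of the invariant \<open>P\<close>, up to isomorphism. The two element types may
  differ, since a cable has letters of another type. The choice of the reducts is immaterial by
  \<open>matrix_equiv_primitive\<close>.\<close>

definition matrix_equiv :: "'g based_matrix \<Rightarrow> 'h based_matrix \<Rightarrow> bool" (infix \<open>\<sim>\<^sub>b\<close> 50) where
  "M \<sim>\<^sub>b N \<longleftrightarrow> is_based_matrix M \<and> is_based_matrix N \<and>
     (\<exists>P Q. reduction\<^sup>*\<^sup>* M P \<and> primitive P \<and> reduction\<^sup>*\<^sup>* N Q \<and> primitive Q \<and> P \<cong>\<^sub>b Q)"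

lemma matrix_equiv_sym: "M \<sim>\<^sub>b N \<Longrightarrow> N \<sim>\<^sub>b M"
  unfolding matrix_equiv_def using iso_sym is_based_matrix_reductions by blast

lemma matrix_equiv_primitive:
  assumes "M \<sim>\<^sub>b N" "reduction\<^sup>*\<^sup>* M P" "primitive P" "reduction\<^sup>*\<^sup>* N Q" "primitive Q"
  shows "P \<cong>\<^sub>b Q"
proof -
  obtain P' Q' where P': "reduction\<^sup>*\<^sup>* M P'" "primitive P'" and Q': "reduction\<^sup>*\<^sup>* N Q'" "primitive Q'"
    and PQ: "P' \<cong>\<^sub>b Q'" and M: "is_based_matrix M" and N: "is_based_matrix N"
    using assms(1) unfolding matrix_equiv_def by blast
  have "P \<cong>\<^sub>b P'"
    using primitive_reduct_unique[OF iso_refl M assms(2,3) P'] .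
  also note PQ
  also have "Q' \<cong>\<^sub>b Q"
    using primitive_reduct_unique[OF iso_refl N Q' assms(4,5)] .
  finally show ?thesis .
qed

lemma primitive_reduct_ex:
  "is_based_matrix M \<Longrightarrow> \<exists>P. reduction\<^sup>*\<^sup>* M P \<and> primitive P"
  by (simp add: is_primitive_matrix_ex is_based_matrix_def)

lemma matrix_equiv_trans [trans]:
  assumes "M \<sim>\<^sub>b N" "N \<sim>\<^sub>b P"
  shows "M \<sim>\<^sub>b P"
proof -
  have "is_based_matrix M" "is_based_matrix N" "is_based_matrix P"
    using assms by (auto simp: matrix_equiv_def)
  then show ?thesis
    using matrix_equiv_primitive[OF assms(1)] matrix_equiv_primitive[OF assms(2)]
      primitive_reduct_ex iso_trans unfolding matrix_equiv_def by metis
qed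

lemma iso_matrix_equiv: "M \<cong>\<^sub>b N \<Longrightarrow> is_based_matrix M \<Longrightarrow> M \<sim>\<^sub>b N"
  unfolding matrix_equiv_def
  using primitive_reduct_unique primitive_reduct_ex is_based_matrix_iso by metis

lemma reductions_matrix_equiv: "reduction\<^sup>*\<^sup>* M N \<Longrightarrow> is_based_matrix M \<Longrightarrow> M \<sim>\<^sub>b N"
  unfolding matrix_equiv_def
  using primitive_reduct_ex[of N] is_based_matrix_reductions iso_refl
  by (metis rtranclp_trans)

text \<open>The conditions on \<open>x\<close> and \<open>p x\<close> persist when other elements
  disappear, so the orbits of the involution \<open>p\<close> can be deleted one at a time. This
  turns a pairing of crossings of the cable into a chain of reductions.\<close>

lemma delete_paired:
  assumes "finite D" "D \<subseteq> elements M - {base M}"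
    and "\<And>x. x \<in> D \<Longrightarrow> p x \<in> D" "\<And>x. x \<in> D \<Longrightarrow> p (p x) = x"
    and "\<And>x. x \<in> D \<Longrightarrow> p x = x \<Longrightarrow> annihilating M x \<or> core M x"
    and "\<And>x. x \<in> D \<Longrightarrow> p x \<noteq> x \<Longrightarrow> complementary M x (p x)"
  shows "reduction\<^sup>*\<^sup>* M (delete_elements D M)"
  using assms
proof (induction "card D" arbitrary: D M rule: less_induct)
  case less
  show ?case
  proof (cases "D = {}")
    case True
    then show ?thesis by (simp add: delete_elements_def)
  next
    case False
    then obtain x where x: "x \<in> D" by blast
    let ?E = "{x, p x}" and ?M = "delete_elements {x, p x} M"
    have E: "?E \<subseteq> D" using x less.prems(3) by blast
    have "removable M ?E"
      using less.prems(5,6)[OF x] by (cases "p x = x") (auto intro: removable.intros)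
    then have r: "reduction M ?M"
      by (auto simp: reduction_iff)
    have px: "p y \<notin> ?E" if "y \<in> D - ?E" for y
      using that less.prems(4) x by (metis DiffD1 DiffD2 insert_iff singletonD)
    have "reduction\<^sup>*\<^sup>* ?M (delete_elements (D - ?E) ?M)"
    proof (rule less.hyps)
      show "card (D - ?E) < card D"
        using x less.prems(1) by (intro psubset_card_mono) auto
      fix y assume y: "y \<in> D - ?E"
      show "p y \<in> D - ?E" using px[OF y] y less.prems(3) by blast
      show "p (p y) = y" using y less.prems(4) by blast
      show "annihilating ?M y \<or> core ?M y" if "p y = y"
        using less.prems(5)[of y] y that by (auto simp: annihilating_def core_def)
      show "complementary ?M y (p y)" if "p y \<noteq> y"
        using less.prems(6)[of y] y px[OF y] that by (auto simp: complementary_def)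
    qed (use less.prems in auto)
    moreover have "delete_elements (D - ?E) ?M = delete_elements D M"
      using E by (simp only: delete_delete Un_Diff_cancel Un_absorb1)
    ultimately show ?thesis
      using r by (simp add: converse_rtranclp_into_rtranclp)
  qed
qed

section \<open>The based matrix of a nanoword as a bilinear expression\<close>

text \<open>On points other than its ends, \<open>arc t h\<close> is twice the indicator function of the cyclic
  interval from \<open>t\<close> to \<open>h\<close>; at both ends it is \<open>1\<close>. With these weights the whole form,
  including the values at \<open>s\<close>, becomes a single bilinear expression.\<close>

definition arc :: "int \<Rightarrow> int \<Rightarrow> int \<Rightarrow> int" where
  "arc t h x = sgn (x - t) - sgn (x - h) + sgn (t - h) + 1"

definition weight :: "('a \<Rightarrow> int) \<Rightarrow> ('a \<Rightarrow> int) \<Rightarrow> 'a option \<Rightarrow> int \<Rightarrow> int" where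
  "weight t h x p = (case x of None \<Rightarrow> 2 | Some g \<Rightarrow> arc (t g) (h g) p)"

lemma weight_simps [simp]:
  "weight t h None p = 2"
  "weight t h (Some g) p = arc (t g) (h g) p"
  by (simp_all add: weight_def)

text \<open>Four times the form of the based matrix, as each weight is twice an indicator. The set
  \<open>L\<close> and the keys are arguments so that partial sums over some letters, and keys other
  than positions, are instances.\<close>

definition key_form :: "'a set \<Rightarrow> ('a \<Rightarrow> int) \<Rightarrow> ('a \<Rightarrow> int) \<Rightarrow> 'a option \<Rightarrow> 'a option \<Rightarrow> int" where
  "key_form L t h x y =
     (\<Sum>c\<in>L. weight t h x (t c) * weight t h y (h c) - weight t h x (h c) * weight t h y (t c))"

lemma positions_nth:
  assumes "is_nanoword \<alpha>" "X \<in> letters \<alpha>"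
  shows "tail_pos \<alpha> X < length (word \<alpha>)" "head_pos \<alpha> X < length (word \<alpha>)"
    "word \<alpha> ! tail_pos \<alpha> X = X" "word \<alpha> ! head_pos \<alpha> X = X"
    "tail_pos \<alpha> X \<noteq> head_pos \<alpha> X"
    "ltype \<alpha> X = Type_a \<longleftrightarrow> tail_pos \<alpha> X < head_pos \<alpha> X"
    "\<And>p. p < length (word \<alpha>) \<Longrightarrow> word \<alpha> ! p = X \<Longrightarrow> p = tail_pos \<alpha> X \<or> p = head_pos \<alpha> X"
proof -
  have X: "gauss_word (word \<alpha>)" "X \<in> set (word \<alpha>)"
    using assms by (simp_all add: is_nanoword_def letters_def)
  note p = positions[OF X]
  show "ltype \<alpha> X = Type_a \<longleftrightarrow> tail_pos \<alpha> X < head_pos \<alpha> X" "tail_pos \<alpha> X \<noteq> head_pos \<alpha> X"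
    using p(2) by (simp_all add: tail_pos_def head_pos_def)
  have mem: "p < length (word \<alpha>) \<and> word \<alpha> ! p = X \<longleftrightarrow> p = tail_pos \<alpha> X \<or> p = head_pos \<alpha> X" for p
    using arg_cong[OF p(1), of "\<lambda>S. p \<in> S"] by (auto simp: tail_pos_def head_pos_def)
  show "tail_pos \<alpha> X < length (word \<alpha>)" "word \<alpha> ! tail_pos \<alpha> X = X"
    using mem[of "tail_pos \<alpha> X"] by simp_all
  show "head_pos \<alpha> X < length (word \<alpha>)" "word \<alpha> ! head_pos \<alpha> X = X"
    using mem[of "head_pos \<alpha> X"] by simp_all
  show "\<And>p. p < length (word \<alpha>) \<Longrightarrow> word \<alpha> ! p = X \<Longrightarrow> p = tail_pos \<alpha> X \<or> p = head_pos \<alpha> X"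
    using mem by blast
qed

lemma arc_tail_head:
  assumes "is_nanoword \<alpha>" "g \<in> letters \<alpha>" "c \<in> letters \<alpha>"
  shows "arc (int (tail_pos \<alpha> g)) (int (head_pos \<alpha> g)) (int (tail_pos \<alpha> c)) =
      2 * tail_fun \<alpha> g c + (if g = c then 1 else 0)"
    and "arc (int (tail_pos \<alpha> g)) (int (head_pos \<alpha> g)) (int (head_pos \<alpha> c)) =
      2 * head_fun \<alpha> g c + (if g = c then 1 else 0)"
proof -
  note g = positions_nth[OF assms(1,2)] and c = positions_nth[OF assms(1,3)]
  have "tail_pos \<alpha> g \<noteq> tail_pos \<alpha> c \<and> tail_pos \<alpha> g \<noteq> head_pos \<alpha> c \<and>
      head_pos \<alpha> g \<noteq> tail_pos \<alpha> c \<and> head_pos \<alpha> g \<noteq> head_pos \<alpha> c" if "g \<noteq> c"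
    using g(3,4) c(3,4) that by metis
  then show "arc (int (tail_pos \<alpha> g)) (int (head_pos \<alpha> g)) (int (tail_pos \<alpha> c)) =
      2 * tail_fun \<alpha> g c + (if g = c then 1 else 0)"
    and "arc (int (tail_pos \<alpha> g)) (int (head_pos \<alpha> g)) (int (head_pos \<alpha> c)) =
      2 * head_fun \<alpha> g c + (if g = c then 1 else 0)"
    using g(5) by (cases "g = c"; simp add: arc_def tail_fun_def head_fun_def passed_def sgn_if)+
qed

text \<open>The value 1 at the ends of an arc yields \<open>2 (t(g,k) - h(g,k))\<close> from the
  summand \<open>c = k\<close> and \<open>2 (h(k,g) - t(k,g))\<close> from \<open>c = g\<close>.
  These agree by \<open>head_tail_skew\<close> and together form the linear term of the based
  matrix.\<close>

lemma key_form_positions: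
  assumes \<alpha>: "is_nanoword \<alpha>" and "x \<in> elements (matrix_of \<alpha>)" "y \<in> elements (matrix_of \<alpha>)"
  shows "key_form (letters \<alpha>) (\<lambda>c. int (tail_pos \<alpha> c)) (\<lambda>c. int (head_pos \<alpha> c)) x y =
    4 * nanoword_form \<alpha> x y"
proof -
  let ?k = "key_form (letters \<alpha>) (\<lambda>c. int (tail_pos \<alpha> c)) (\<lambda>c. int (head_pos \<alpha> c))"
  have fin: "finite (letters \<alpha>)"
    by (simp add: letters_def)
  have sn: "?k (Some g) None = 4 * n_fun \<alpha> g" if "g \<in> letters \<alpha>" for g
  proof -
    have "?k (Some g) None = (\<Sum>c\<in>letters \<alpha>. 4 * (tail_fun \<alpha> g c - head_fun \<alpha> g c))"
      unfolding key_form_def by (intro sum.cong) (auto simp: arc_tail_head[OF \<alpha> that])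
    then show ?thesis
      by (simp add: n_fun_def sum_distrib_left)
  qed
  have ns: "?k None (Some g) = - 4 * n_fun \<alpha> g" if "g \<in> letters \<alpha>" for g
    using sn[OF that] by (simp add: key_form_def sum_subtractf mult.commute)
  have ss: "?k (Some g) (Some k) = 4 * nanoword_form \<alpha> (Some g) (Some k)"
    if g: "g \<in> letters \<alpha>" and k: "k \<in> letters \<alpha>" for g k
  proof -
    have "?k (Some g) (Some k) = (\<Sum>c\<in>letters \<alpha>.
        4 * (tail_fun \<alpha> g c * head_fun \<alpha> k c - head_fun \<alpha> g c * tail_fun \<alpha> k c) +
        ((if c = k then 2 * (tail_fun \<alpha> g c - head_fun \<alpha> g c) else 0) +
         (if c = g then 2 * (head_fun \<alpha> k c - tail_fun \<alpha> k c) else 0)))"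
      unfolding key_form_def
      by (intro sum.cong) (auto simp: arc_tail_head[OF \<alpha> g] arc_tail_head[OF \<alpha> k] algebra_simps)
    also have "\<dots> = 4 * (\<Sum>c\<in>letters \<alpha>.
        tail_fun \<alpha> g c * head_fun \<alpha> k c - head_fun \<alpha> g c * tail_fun \<alpha> k c) +
        (2 * (tail_fun \<alpha> g k - head_fun \<alpha> g k) + 2 * (head_fun \<alpha> k g - tail_fun \<alpha> k g))"
      using g k fin by (simp add: sum.distrib sum_distrib_left)
    also have "\<dots> = 4 * nanoword_form \<alpha> (Some g) (Some k)"
      using head_tail_skew[OF \<alpha> g k] by (simp add: algebra_simps)
    finally show ?thesis .
  qed
  have nn: "?k None None = 0"
    by (simp add: key_form_def)
  show ?thesis
    using assms(2,3) sn ns ss nn by (cases x; cases y) (auto simp: matrix_of_def)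
qed

text \<open>Only the order of the occurrences matters, so positions may be replaced by arbitrary
  strictly increasing keys.\<close>

definition keyed :: "'a nanoword \<Rightarrow> ('a \<Rightarrow> int) \<Rightarrow> ('a \<Rightarrow> int) \<Rightarrow> bool" where
  "keyed \<alpha> t h \<longleftrightarrow> (\<exists>\<kappa>. (\<forall>p q. p < q \<longrightarrow> q < length (word \<alpha>) \<longrightarrow> \<kappa> p < \<kappa> q) \<and>
     (\<forall>X\<in>letters \<alpha>. t X = \<kappa> (tail_pos \<alpha> X) \<and> h X = \<kappa> (head_pos \<alpha> X)))"

lemma keyed_key_form:
  assumes \<alpha>: "is_nanoword \<alpha>" "keyed \<alpha> t h"
    and xy: "x \<in> elements (matrix_of \<alpha>)" "y \<in> elements (matrix_of \<alpha>)"
  shows "4 * nanoword_form \<alpha> x y = key_form (letters \<alpha>) t h x y"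
proof -
  obtain \<kappa> where mono: "\<And>p q. p < q \<Longrightarrow> q < length (word \<alpha>) \<Longrightarrow> \<kappa> p < \<kappa> q"
    and \<kappa>: "\<And>X. X \<in> letters \<alpha> \<Longrightarrow> t X = \<kappa> (tail_pos \<alpha> X)"
      "\<And>X. X \<in> letters \<alpha> \<Longrightarrow> h X = \<kappa> (head_pos \<alpha> X)"
    using \<alpha>(2) unfolding keyed_def by blast
  have sgn_\<kappa>: "sgn (\<kappa> p - \<kappa> q) = sgn (int p - int q)"
    if "p < length (word \<alpha>)" "q < length (word \<alpha>)" for p q
    using mono[of p q] mono[of q p] that by (cases p q rule: linorder_cases) (auto simp: sgn_if)
  note lt = positions_nth(1,2)[OF \<alpha>(1)]
  have w: "weight t h x (t c) = weight (\<lambda>c. int (tail_pos \<alpha> c)) (\<lambda>c. int (head_pos \<alpha> c)) x (int (tail_pos \<alpha> c))"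
    "weight t h x (h c) = weight (\<lambda>c. int (tail_pos \<alpha> c)) (\<lambda>c. int (head_pos \<alpha> c)) x (int (head_pos \<alpha> c))"
    if "x \<in> elements (matrix_of \<alpha>)" "c \<in> letters \<alpha>" for x c
    using that by (auto simp: matrix_of_def arc_def \<kappa> sgn_\<kappa> lt)
  show ?thesis
    unfolding key_form_positions[OF \<alpha>(1) xy, symmetric] key_form_def
    by (intro sum.cong refl) (simp add: w xy)
qed

text \<open>\<open>zs\<close> is the word with increasing keys attached. A letter occurs just twice,
  so two different keys attached to it sit at its tail and its head, and the type decides which is
  which.\<close>

lemma keyedI:
  assumes \<alpha>: "is_nanoword \<alpha>"
    and zs: "sorted_wrt (<) (map fst zs)" "map snd zs = word \<alpha>"
    and th: "\<And>X. X \<in> letters \<alpha> \<Longrightarrow> (t X, X) \<in> set zs" "\<And>X. X \<in> letters \<alpha> \<Longrightarrow> (h X, X) \<in> set zs"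
    and ne: "\<And>X. X \<in> letters \<alpha> \<Longrightarrow> t X \<noteq> h X"
    and type: "\<And>X. X \<in> letters \<alpha> \<Longrightarrow> ltype \<alpha> X = Type_a \<longleftrightarrow> t X < h X"
  shows "keyed \<alpha> t h"
proof -
  define \<kappa> where "\<kappa> p = map fst zs ! p" for p
  have len: "length zs = length (word \<alpha>)"
    using zs(2) by (metis length_map)
  have mono: "\<kappa> p < \<kappa> q" if "p < q" "q < length (word \<alpha>)" for p q
    unfolding \<kappa>_def using sorted_wrt_nth_less[OF zs(1) that(1)] that(2) len by simp
  have "t X = \<kappa> (tail_pos \<alpha> X) \<and> h X = \<kappa> (head_pos \<alpha> X)" if X: "X \<in> letters \<alpha>" for X
  proof -
    have pos: "\<exists>p. p < length (word \<alpha>) \<and> word \<alpha> ! p = X \<and> \<kappa> p = k" if "(k, X) \<in> set zs" for k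
    proof -
      from that obtain p where "p < length zs" "zs ! p = (k, X)"
        by (auto simp: in_set_conv_nth)
      then show ?thesis
        unfolding zs(2)[symmetric] \<kappa>_def by (intro exI[of _ p]) simp
    qed
    obtain p q where p: "p < length (word \<alpha>)" "word \<alpha> ! p = X" "\<kappa> p = t X"
      and q: "q < length (word \<alpha>)" "word \<alpha> ! q = X" "\<kappa> q = h X"
      using pos th X by metis
    note P = positions_nth[OF \<alpha> X]
    have "p \<noteq> q"
      using ne[OF X] p(3) q(3) by auto
    then consider "p = tail_pos \<alpha> X" "q = head_pos \<alpha> X" | "p = head_pos \<alpha> X" "q = tail_pos \<alpha> X"
      using P(7)[OF p(1,2)] P(7)[OF q(1,2)] by blast
    then show ?thesis
    proof cases
      \<comment> \<open>Exchanged ends would contradict the type, which orders \<open>t X\<close>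
        and \<open>h X\<close> in the same way as tail and head.\<close>
      case 2
      then have "p < q \<longleftrightarrow> q < p"
        using type[OF X] P(6) mono[of p q] mono[of q p] p q \<open>p \<noteq> q\<close>
        by (metis linorder_neqE_nat less_asym)
      with \<open>p \<noteq> q\<close> show ?thesis by linarith
    qed (use p q in simp)
  qed
  with mono show ?thesis
    unfolding keyed_def by blast
qed

section \<open>Homotopy invariance\<close>

lemma elements_matrix_of [simp]: "elements (matrix_of \<alpha>) = insert None (Some ` letters \<alpha>)"
  and base_matrix_of [simp]: "base (matrix_of \<alpha>) = None"
  and form_matrix_of [simp]: "form (matrix_of \<alpha>) = nanoword_form \<alpha>"
  by (simp_all add: matrix_of_def)

lemma finite_letters [simp]: "finite (letters \<alpha>)"
  by (simp add: letters_def)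

definition indexed :: "'a list \<Rightarrow> (int \<times> 'a) list" where
  "indexed w = map (\<lambda>p. (int p, w ! p)) [0..<length w]"

lemma indexed:
  "sorted_wrt (<) (map fst (indexed w))" "map snd (indexed w) = w"
  "p < length w \<Longrightarrow> (int p, w ! p) \<in> set (indexed w)"
  by (auto simp: indexed_def sorted_wrt_map o_def map_nth)

lemma keyed_positions:
  assumes "is_nanoword \<alpha>"
    and p: "\<And>X. X \<in> letters \<alpha> \<Longrightarrow> p X < length (word \<alpha>) \<and> word \<alpha> ! p X = X"
    and q: "\<And>X. X \<in> letters \<alpha> \<Longrightarrow> q X < length (word \<alpha>) \<and> word \<alpha> ! q X = X"
    and "\<And>X. X \<in> letters \<alpha> \<Longrightarrow> p X \<noteq> q X \<and> (ltype \<alpha> X = Type_a \<longleftrightarrow> p X < q X)"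
  shows "keyed \<alpha> (\<lambda>X. int (p X)) (\<lambda>X. int (q X))"
proof (rule keyedI[OF assms(1) indexed(1,2)])
  fix X assume X: "X \<in> letters \<alpha>"
  show "(int (p X), X) \<in> set (indexed (word \<alpha>))" "(int (q X), X) \<in> set (indexed (word \<alpha>))"
    using indexed(3)[of "p X" "word \<alpha>"] p[OF X] indexed(3)[of "q X" "word \<alpha>"] q[OF X] by simp_all
qed (use assms(4) in auto)

lemma keyed_tail_head:
  "is_nanoword \<alpha> \<Longrightarrow> keyed \<alpha> (\<lambda>X. int (tail_pos \<alpha> X)) (\<lambda>X. int (head_pos \<alpha> X))"
  by (rule keyed_positions) (auto simp: positions_nth)

text \<open>Positions in the longer word still increase along the shorter one. With these common
  keys the two forms differ only by the summands of the deleted letters.\<close>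

lemma keyed_filter:
  assumes \<alpha>: "is_nanoword \<alpha>" and \<beta>: "is_nanoword \<beta>"
    and w: "word \<beta> = filter (\<lambda>c. c \<notin> D) (word \<alpha>)"
    and type: "\<And>X. X \<in> letters \<beta> \<Longrightarrow> ltype \<beta> X = ltype \<alpha> X"
  shows "keyed \<beta> (\<lambda>X. int (tail_pos \<alpha> X)) (\<lambda>X. int (head_pos \<alpha> X))"
proof (rule keyedI[OF \<beta>])
  let ?zs = "filter (\<lambda>z. snd z \<notin> D) (indexed (word \<alpha>))"
  show "sorted_wrt (<) (map fst ?zs)"
    using indexed(1)[of "word \<alpha>"] by (simp add: sorted_wrt_map sorted_wrt_filter)
  have "map snd ?zs = filter (\<lambda>c. c \<notin> D) (map snd (indexed (word \<alpha>)))"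
    by (simp add: filter_map o_def)
  then show "map snd ?zs = word \<beta>"
    by (simp add: indexed w)
  fix X assume X: "X \<in> letters \<beta>"
  then have X': "X \<in> letters \<alpha>" "X \<notin> D"
    by (auto simp: letters_def w)
  note P = positions_nth[OF \<alpha> X'(1)]
  show "(int (tail_pos \<alpha> X), X) \<in> set ?zs" "(int (head_pos \<alpha> X), X) \<in> set ?zs"
    using indexed(3)[OF P(1)] indexed(3)[OF P(2)] P(3,4) X'(2) by auto
  show "int (tail_pos \<alpha> X) \<noteq> int (head_pos \<alpha> X)"
    using P(5) by simp
  show "ltype \<beta> X = Type_a \<longleftrightarrow> int (tail_pos \<alpha> X) < int (head_pos \<alpha> X)"
    using P(6) type[OF X] by simp
qed

text \<open>The form is a polynomial in the values of the arcs at the ends of letters, so a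
  relabelling that keeps these values keeps the matrix.\<close>

lemma matrix_of_iso_keys:
  assumes \<alpha>: "is_nanoword \<alpha>" "keyed \<alpha> t h" and \<beta>: "is_nanoword \<beta>" "keyed \<beta> t' h'"
    and f: "inj_on f (letters \<alpha>)" "letters \<beta> = f ` letters \<alpha>"
    and w: "\<And>g c. g \<in> letters \<alpha> \<Longrightarrow> c \<in> letters \<alpha> \<Longrightarrow>
      arc (t' (f g)) (h' (f g)) (t' (f c)) = arc (t g) (h g) (t c) \<and>
      arc (t' (f g)) (h' (f g)) (h' (f c)) = arc (t g) (h g) (h c)"
  shows "matrix_of \<alpha> \<cong>\<^sub>b matrix_of \<beta>"
proof -
  have eq: "nanoword_form \<beta> (map_option f x) (map_option f y) = nanoword_form \<alpha> x y"
    if x: "x \<in> elements (matrix_of \<alpha>)" and y: "y \<in> elements (matrix_of \<alpha>)" for x y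
  proof -
    have m: "map_option f x \<in> elements (matrix_of \<beta>)" "map_option f y \<in> elements (matrix_of \<beta>)"
      using x y f(2) by auto
    have wt: "weight t' h' (map_option f x) (t' (f c)) = weight t h x (t c)"
      "weight t' h' (map_option f x) (h' (f c)) = weight t h x (h c)"
      if "x \<in> elements (matrix_of \<alpha>)" "c \<in> letters \<alpha>" for x c
      using that w by (cases x; auto)+
    have "key_form (letters \<beta>) t' h' (map_option f x) (map_option f y) = key_form (letters \<alpha>) t h x y"
      unfolding key_form_def f(2) sum.reindex[OF f(1)]
      by (intro sum.cong refl) (simp add: wt[OF x] wt[OF y])
    then show ?thesis
      using keyed_key_form[OF \<alpha> x y] keyed_key_form[OF \<beta> m] by simp
  qed
  have "bij_betw (map_option f) (elements (matrix_of \<alpha>)) (elements (matrix_of \<beta>))"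
    using f by (auto simp: bij_betw_def inj_on_def image_image)
  with eq show ?thesis
    unfolding based_matrix_iso_def by (intro exI[of _ "map_option f"]) auto
qed

lemma matrix_of_nanoword_iso:
  assumes \<alpha>: "is_nanoword \<alpha>" and \<beta>: "is_nanoword \<beta>" and "nanoword_iso \<alpha> \<beta>"
  shows "matrix_of \<alpha> \<cong>\<^sub>b matrix_of \<beta>"
proof -
  obtain f where f: "inj_on f (letters \<alpha>)" "word \<beta> = map f (word \<alpha>)"
    "\<And>X. X \<in> letters \<alpha> \<Longrightarrow> ltype \<beta> (f X) = ltype \<alpha> X"
    using assms(3) unfolding nanoword_iso_def by blast
  have L: "letters \<beta> = f ` letters \<alpha>"
    using f(2) by (simp add: letters_def)
  define g where "g = inv_into (letters \<alpha>) f"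
  have g: "g (f X) = X" if "X \<in> letters \<alpha>" for X
    using that f(1) by (simp add: g_def)
  have "keyed \<beta> (\<lambda>Y. int (tail_pos \<alpha> (g Y))) (\<lambda>Y. int (head_pos \<alpha> (g Y)))"
    by (rule keyed_positions[OF \<beta>]) (auto simp: L g f(2,3) positions_nth[OF \<alpha>])
  from matrix_of_iso_keys[OF \<alpha> keyed_tail_head[OF \<alpha>] \<beta> this f(1) L]
  show ?thesis by (simp add: g)
qed

section \<open>Effect of the individual moves on the based matrix\<close>

lemma tail_head_pos_eq:
  assumes "is_nanoword \<alpha>" "p < q" "q < length (word \<alpha>)" "word \<alpha> ! p = X" "word \<alpha> ! q = X"
  shows "tail_pos \<alpha> X = (if ltype \<alpha> X = Type_a then p else q)"
    and "head_pos \<alpha> X = (if ltype \<alpha> X = Type_a then q else p)"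
proof -
  have X: "X \<in> letters \<alpha>"
    using assms by (auto simp: letters_def)
  note P = positions_nth[OF assms(1) X]
  show "tail_pos \<alpha> X = (if ltype \<alpha> X = Type_a then p else q)"
    "head_pos \<alpha> X = (if ltype \<alpha> X = Type_a then q else p)"
    using P(7)[of p] P(7)[of q] assms(2-5) P(6) by auto
qed

lemma arc_adjacent:
  "t \<noteq> p \<Longrightarrow> t \<noteq> p + 1 \<Longrightarrow> h \<noteq> p \<Longrightarrow> h \<noteq> p + 1 \<Longrightarrow> arc t h (p + 1) = arc t h p"
  by (auto simp: arc_def sgn_if)

lemma weight_adjacent:
  assumes \<alpha>: "is_nanoword \<alpha>" and x: "x \<in> elements (matrix_of \<alpha>) - Some ` D"
    and "Suc p < length (word \<alpha>)" "word \<alpha> ! p \<in> D" "word \<alpha> ! Suc p \<in> D"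
  shows "weight (\<lambda>X. int (tail_pos \<alpha> X)) (\<lambda>X. int (head_pos \<alpha> X)) x (int p + 1) =
    weight (\<lambda>X. int (tail_pos \<alpha> X)) (\<lambda>X. int (head_pos \<alpha> X)) x (int p)"
proof (cases x)
  case (Some g)
  then have g: "g \<in> letters \<alpha>" "g \<notin> D"
    using x by auto
  have "tail_pos \<alpha> g \<notin> {p, Suc p}" "head_pos \<alpha> g \<notin> {p, Suc p}"
    using positions_nth(3,4)[OF \<alpha> g(1)] assms(4,5) g(2) by auto
  then show ?thesis
    unfolding Some weight_simps by (intro arc_adjacent) auto
qed simp

text \<open>Common frame of \<open>H1\<close> and \<open>H2\<close>: the deleted letters must be
  removable as elements, and as summation indices they must contribute nothing to the form of the
  remaining elements.\<close>

lemma matrix_equiv_filter: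
  fixes \<alpha> \<beta> :: "'a nanoword"
  defines "t \<equiv> \<lambda>X :: 'a. int (tail_pos \<alpha> X)" and "h \<equiv> \<lambda>X. int (head_pos \<alpha> X)"
  assumes \<alpha>: "is_nanoword \<alpha>" and \<beta>: "is_nanoword \<beta>"
    and w: "word \<beta> = filter (\<lambda>c. c \<notin> D) (word \<alpha>)" and D: "D \<subseteq> letters \<alpha>"
    and type: "\<And>X. X \<in> letters \<beta> \<Longrightarrow> ltype \<beta> X = ltype \<alpha> X"
    and rem: "removable (matrix_of \<alpha>) (Some ` D)"
    and zero: "\<And>x y. x \<in> elements (matrix_of \<alpha>) - Some ` D \<Longrightarrow>
      y \<in> elements (matrix_of \<alpha>) - Some ` D \<Longrightarrow> key_form D t h x y = 0"
  shows "matrix_of \<alpha> \<sim>\<^sub>b matrix_of \<beta>"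
proof -
  have L: "letters \<beta> = letters \<alpha> - D"
    using w by (auto simp: letters_def)
  have e: "elements (matrix_of \<beta>) = elements (matrix_of \<alpha>) - Some ` D"
    by (auto simp: L)
  have "nanoword_form \<beta> x y = nanoword_form \<alpha> x y"
    if x: "x \<in> elements (matrix_of \<beta>)" and y: "y \<in> elements (matrix_of \<beta>)" for x y
  proof -
    have "key_form (letters \<alpha>) t h x y = key_form (letters \<beta>) t h x y + key_form D t h x y"
      unfolding key_form_def L using D by (intro sum.subset_diff) auto
    then show ?thesis
      using zero[of x y] x y keyed_key_form[OF \<alpha> keyed_tail_head[OF \<alpha>], of x y]
        keyed_key_form[OF \<beta> keyed_filter[OF \<alpha> \<beta> w type] x y]
      unfolding e t_def h_def by simp
  qed
  then have "delete_elements (Some ` D) (matrix_of \<alpha>) \<cong>\<^sub>b matrix_of \<beta>"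
    unfolding based_matrix_iso_def elements_delete base_delete form_delete e[symmetric]
    by (intro exI[of _ id]) simp
  moreover have "reduction (matrix_of \<alpha>) (delete_elements (Some ` D) (matrix_of \<alpha>))"
    using rem by (auto simp: reduction_iff)
  ultimately show ?thesis
    using is_based_matrix_matrix_of[OF \<alpha>]
    by (meson iso_matrix_equiv is_based_matrix_reduction matrix_equiv_trans r_into_rtranclp
        reductions_matrix_equiv)
qed

text \<open>The move rotates the word cyclically. Carrying the first occurrence of \<open>A\<close>
  to the end reverses the order of its two occurrences; the change of type compensates this, so
  tails go to tails and heads to heads.\<close>

lemma matrix_of_shift:
  assumes \<alpha>: "is_nanoword \<alpha>" and \<beta>: "is_nanoword \<beta>"
    and w: "word \<alpha> = [A] @ x @ [A] @ y" "word \<beta> = x @ [A'] @ y @ [A']"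
    and type: "ltype \<beta> A' \<noteq> ltype \<alpha> A" "\<forall>X\<in>set x \<union> set y. ltype \<beta> X = ltype \<alpha> X"
  shows "matrix_of \<alpha> \<cong>\<^sub>b matrix_of \<beta>"
proof -
  define f where "f X = (if X = A then A' else X)" for X
  define g where "g X = (if X = A' then A else X)" for X
  define m where "m = length x + length y + 1"
  \<comment> \<open>The rotation of positions; \<open>m\<close> is the last position of both
    words.\<close>
  define s where "s p = (if p = 0 then m else p - 1)" for p :: nat
  have A: "A \<notin> set x" "A \<notin> set y"
    using \<alpha> w by (auto simp: is_nanoword_def gauss_word_def count_list_0_iff)
  have A': "A' \<notin> set x" "A' \<notin> set y"
    using \<beta> w by (auto simp: is_nanoword_def gauss_word_def count_list_0_iff)
  have L: "letters \<alpha> = insert A (set x \<union> set y)" "letters \<beta> = insert A' (set x \<union> set y)"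
    by (auto simp: letters_def w)
  have fL: "letters \<beta> = f ` letters \<alpha>" and inj: "inj_on f (letters \<alpha>)"
    using A A' unfolding L f_def by (auto simp: inj_on_def)
  have gf: "g (f X) = X" if "X \<in> letters \<alpha>" for X
    using that A A' by (auto simp: L f_def g_def)
  have len: "length (word \<alpha>) = m + 1" "length (word \<beta>) = m + 1"
    by (simp_all add: m_def w)
  have nth: "word \<beta> ! s p = f (word \<alpha> ! p)" if "p < m + 1" for p
  proof (cases p)
    case 0
    then show ?thesis
      by (simp add: w s_def m_def f_def nth_append)
  next
    case (Suc k)
    then show ?thesis
      using that A by (auto simp: w s_def m_def f_def nth_append nth_Cons' dest: nth_mem)
  qed
  note P = positions_nth[OF \<alpha>]
  let ?t = "\<lambda>X. tail_pos \<alpha> X" and ?h = "\<lambda>X. head_pos \<alpha> X"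
  have pos0: "?t X = 0 \<or> ?h X = 0 \<longleftrightarrow> X = A" if "X \<in> letters \<alpha>" for X
    using P(3,4)[OF that] P(7)[OF that, of 0] by (auto simp: w)
  have le: "?t X \<le> m" "?h X \<le> m" if "X \<in> letters \<alpha>" for X
    using P(1,2)[OF that] len by simp_all
  have cmp: "s (?t X) \<noteq> s (?h X) \<and> (ltype \<beta> (f X) = Type_a \<longleftrightarrow> s (?t X) < s (?h X))"
    if X: "X \<in> letters \<alpha>" for X
    using P(5,6)[OF X] pos0[OF X] le[OF X] type X A
    by (cases "ltype \<alpha> A"; cases "ltype \<beta> A'"; cases "X = A") (auto simp: s_def f_def L)
  have "keyed \<beta> (\<lambda>Y. int (s (?t (g Y)))) (\<lambda>Y. int (s (?h (g Y))))"
  proof (rule keyed_positions[OF \<beta>])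
    fix Y assume "Y \<in> letters \<beta>"
    then obtain X where X: "X \<in> letters \<alpha>" "Y = f X"
      by (auto simp: fL)
    have "s p < m + 1" if "p \<le> m" for p
      using that by (auto simp: s_def)
    then show "s (?t (g Y)) < length (word \<beta>) \<and> word \<beta> ! s (?t (g Y)) = Y"
      "s (?h (g Y)) < length (word \<beta>) \<and> word \<beta> ! s (?h (g Y)) = Y"
      using nth le[OF X(1)] P(3,4)[OF X(1)] unfolding X(2) gf[OF X(1)] len by simp_all
    show "s (?t (g Y)) \<noteq> s (?h (g Y)) \<and> (ltype \<beta> Y = Type_a \<longleftrightarrow> s (?t (g Y)) < s (?h (g Y)))"
      using cmp[OF X(1)] unfolding X(2) gf[OF X(1)] by simp
  qed
  then show ?thesis
  proof (rule matrix_of_iso_keys[OF \<alpha> keyed_tail_head[OF \<alpha>] \<beta> _ inj fL])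
    \<comment> \<open>Thanks to its summand \<open>sgn (t - h) + 1\<close>, \<open>arc\<close> sees
      only the cyclic order of the positions.\<close>
    have arc: "arc (int (s a)) (int (s b)) (int (s c)) = arc (int a) (int b) (int c)"
      if "a \<le> m" "b \<le> m" "c \<le> m" "a \<noteq> b" for a b c
      using that by (cases "a = 0"; cases "b = 0"; cases "c = 0"; simp add: arc_def s_def sgn_if)
    fix X c assume X: "X \<in> letters \<alpha>" and c: "c \<in> letters \<alpha>"
    show "arc (int (s (?t (g (f X))))) (int (s (?h (g (f X))))) (int (s (?t (g (f c))))) =
          arc (int (?t X)) (int (?h X)) (int (?t c)) \<and>
        arc (int (s (?t (g (f X))))) (int (s (?h (g (f X))))) (int (s (?h (g (f c))))) =
          arc (int (?t X)) (int (?h X)) (int (?h c))"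
      unfolding gf[OF X] gf[OF c] using arc le[OF X] le[OF c] P(5)[OF X] by simp
  qed
qed

lemma arc_ends [simp]: "t \<noteq> h \<Longrightarrow> arc t h t = 1" "t \<noteq> h \<Longrightarrow> arc t h h = 1"
  by (auto simp: arc_def sgn_if)

lemma int_eq_plus1: "int a = int b + 1 \<longleftrightarrow> a = Suc b"
  by linarith

text \<open>The two occurrences of \<open>A\<close> are adjacent, so every element has the same
  weight at both and the summand of \<open>A\<close> vanishes. At the other letters the arc of
  \<open>A\<close> is empty for type \<open>a\<close> (weight 0, hence annihilating) and goes all
  the way round for type \<open>b\<close> (weight 2 like \<open>s\<close>, hence core).\<close>

lemma matrix_equiv_H1:
  assumes \<alpha>: "is_nanoword \<alpha>" and \<beta>: "is_nanoword \<beta>"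
    and w: "word \<alpha> = x @ [A, A] @ y" "word \<beta> = x @ y" and type: "ltype \<beta> = ltype \<alpha>"
  shows "matrix_of \<alpha> \<sim>\<^sub>b matrix_of \<beta>"
proof -
  define p where "p = length x"
  define t where "t X = int (tail_pos \<alpha> X)" for X
  define h where "h X = int (head_pos \<alpha> X)" for X
  have A: "A \<notin> set x" "A \<notin> set y" "A \<in> letters \<alpha>"
    using \<alpha> w by (auto simp: is_nanoword_def gauss_word_def count_list_0_iff letters_def)
  have nth: "Suc p < length (word \<alpha>)" "word \<alpha> ! p = A" "word \<alpha> ! Suc p = A"
    by (simp_all add: w p_def nth_append)
  have tA: "t A = (if ltype \<alpha> A = Type_a then int p else int p + 1)"
    and hA: "h A = (if ltype \<alpha> A = Type_a then int p + 1 else int p)"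
    using tail_head_pos_eq[OF \<alpha> lessI nth] by (simp_all add: t_def h_def)
  have away: "t c \<noteq> int p" "t c \<noteq> int p + 1" "h c \<noteq> int p" "h c \<noteq> int p + 1"
    if "c \<in> letters \<alpha>" "c \<noteq> A" for c
    using positions_nth(3,4)[OF \<alpha> that(1)] nth that(2) by (auto simp: t_def h_def int_eq_plus1)
  have same: "weight t h k (t A) = weight t h k (h A)" if "k \<in> elements (matrix_of \<alpha>)" for k
  proof (cases "k = Some A")
    case True
    then show ?thesis by (simp add: tA hA)
  next
    case False
    then have "k \<in> elements (matrix_of \<alpha>) - Some ` {A}"
      using that by simp
    then have "weight t h k (int p + 1) = weight t h k (int p)"
      using weight_adjacent[OF \<alpha>, of k "{A}" p] nth by (simp add: t_def[abs_def] h_def[abs_def])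
    then show ?thesis
      by (simp add: tA hA)
  qed
  have form: "4 * nanoword_form \<alpha> u v = key_form (letters \<alpha>) t h u v"
    if "u \<in> elements (matrix_of \<alpha>)" "v \<in> elements (matrix_of \<alpha>)" for u v
    using keyed_key_form[OF \<alpha> keyed_tail_head[OF \<alpha>] that] by (simp add: t_def[abs_def] h_def[abs_def])
  define d :: int where "d = (if ltype \<alpha> A = Type_a then 0 else 2)"
  have arc: "arc (t A) (h A) (t c) = d" "arc (t A) (h A) (h c) = d" if "c \<in> letters \<alpha>" "c \<noteq> A" for c
    using away[OF that] by (auto simp: arc_def sgn_if tA hA d_def)
  have row: "key_form (letters \<alpha>) t h (Some A) k =
      (\<Sum>c\<in>letters \<alpha>. d * weight t h k (h c) - d * weight t h k (t c))"
    if "k \<in> elements (matrix_of \<alpha>)" for k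
    unfolding key_form_def
  proof (rule sum.cong[OF refl])
    fix c assume c: "c \<in> letters \<alpha>"
    show "weight t h (Some A) (t c) * weight t h k (h c) - weight t h (Some A) (h c) * weight t h k (t c) =
        d * weight t h k (h c) - d * weight t h k (t c)"
    proof (cases "c = A")
      case True
      have "t A \<noteq> h A" by (simp add: tA hA)
      with True same[OF that] show ?thesis by simp
    qed (simp add: arc c)
  qed
  have "annihilating (matrix_of \<alpha>) (Some A)" if "ltype \<alpha> A = Type_a"
    unfolding annihilating_def
  proof (intro conjI ballI)
    fix k assume k: "k \<in> elements (matrix_of \<alpha>)"
    show "form (matrix_of \<alpha>) (Some A) k = 0"
      using form[OF _ k, of "Some A"] A(3) row[OF k] that by (simp add: d_def)
  qed (use A in simp)
  moreover have "core (matrix_of \<alpha>) (Some A)" if "ltype \<alpha> A \<noteq> Type_a"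
    unfolding core_def
  proof (intro conjI ballI)
    fix k assume k: "k \<in> elements (matrix_of \<alpha>)"
    have "key_form (letters \<alpha>) t h (Some A) k = key_form (letters \<alpha>) t h None k"
      unfolding row[OF k] using that by (simp add: d_def key_form_def)
    then show "form (matrix_of \<alpha>) (Some A) k = form (matrix_of \<alpha>) (base (matrix_of \<alpha>)) k"
      using form[OF _ k, of "Some A"] form[OF _ k, of None] A(3) by simp
  qed (use A in simp)
  ultimately have "removable (matrix_of \<alpha>) (Some ` {A})"
    by (auto intro: removable.intros)
  then show ?thesis
  proof (rule matrix_equiv_filter[OF \<alpha> \<beta>, rotated 3])
    have "filter (\<lambda>c. c \<noteq> A) u = u" if "A \<notin> set u" for u
      using that by (auto simp: filter_id_conv)
    then show "word \<beta> = filter (\<lambda>c. c \<notin> {A}) (word \<alpha>)"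
      using A by (simp add: w)
    fix u v assume "u \<in> elements (matrix_of \<alpha>) - Some ` {A}" "v \<in> elements (matrix_of \<alpha>) - Some ` {A}"
    then show "key_form {A} (\<lambda>X. int (tail_pos \<alpha> X)) (\<lambda>X. int (head_pos \<alpha> X)) u v = 0"
      unfolding t_def[symmetric, abs_def] h_def[symmetric, abs_def]
      using same[of u] same[of v] by (simp add: key_form_def)
  qed (use A type in simp_all)
qed

text \<open>As the types differ, the arcs of \<open>A\<close> and \<open>B\<close> run in opposite
  directions between the same two places. Away from these places they cover the curve exactly once,
  so their weights add up to 2, the weight of \<open>s\<close>.\<close>

lemma matrix_equiv_H2:
  assumes \<alpha>: "is_nanoword \<alpha>" and \<beta>: "is_nanoword \<beta>"
    and w: "word \<alpha> = x @ [A, B] @ y @ [B, A] @ z" "word \<beta> = x @ y @ z"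
    and type: "ltype \<beta> = ltype \<alpha>" and AB: "ltype \<alpha> A \<noteq> ltype \<alpha> B"
  shows "matrix_of \<alpha> \<sim>\<^sub>b matrix_of \<beta>"
proof -
  define p where "p = length x"
  define q where "q = length x + 2 + length y"
  define t where "t X = int (tail_pos \<alpha> X)" for X
  define h where "h X = int (head_pos \<alpha> X)" for X
  have ne: "A \<noteq> B" using AB by blast
  have A: "A \<notin> set x \<union> set y \<union> set z" "B \<notin> set x \<union> set y \<union> set z" "A \<in> letters \<alpha>" "B \<in> letters \<alpha>"
    using \<alpha> w ne by (auto simp: is_nanoword_def gauss_word_def count_list_0_iff letters_def)
  have pq: "p + 1 < q" by (simp add: p_def q_def)
  have nth: "Suc q < length (word \<alpha>)" "word \<alpha> ! p = A" "word \<alpha> ! Suc p = B"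
    "word \<alpha> ! q = B" "word \<alpha> ! Suc q = A"
    by (simp_all add: w p_def q_def nth_append)
  have tA: "t A = (if ltype \<alpha> A = Type_a then int p else int q + 1)"
    and hA: "h A = (if ltype \<alpha> A = Type_a then int q + 1 else int p)"
    using tail_head_pos_eq[OF \<alpha> _ nth(1,2,5)] pq by (simp_all add: t_def h_def)
  have tB: "t B = (if ltype \<alpha> A = Type_a then int q else int p + 1)"
    and hB: "h B = (if ltype \<alpha> A = Type_a then int p + 1 else int q)"
    using tail_head_pos_eq[OF \<alpha> _ _ nth(3,4)] pq nth(1) AB
    by (cases "ltype \<alpha> A"; cases "ltype \<alpha> B"; simp add: t_def h_def)+
  have away: "t c \<notin> {int p, int p + 1, int q, int q + 1}" "h c \<notin> {int p, int p + 1, int q, int q + 1}"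
    if "c \<in> letters \<alpha>" "c \<noteq> A" "c \<noteq> B" for c
    using positions_nth(3,4)[OF \<alpha> that(1)] nth that(2,3) by (auto simp: t_def h_def int_eq_plus1)
  have adj: "weight t h k (int p + 1) = weight t h k (int p)" "weight t h k (int q + 1) = weight t h k (int q)"
    if "k \<in> elements (matrix_of \<alpha>) - Some ` {A, B}" for k
    using weight_adjacent[OF \<alpha> that, of p] weight_adjacent[OF \<alpha> that, of q] nth pq
    by (simp_all add: t_def[abs_def] h_def[abs_def])
  have form: "4 * nanoword_form \<alpha> u v = key_form (letters \<alpha>) t h u v"
    if "u \<in> elements (matrix_of \<alpha>)" "v \<in> elements (matrix_of \<alpha>)" for u v
    using keyed_key_form[OF \<alpha> keyed_tail_head[OF \<alpha>] that] by (simp add: t_def[abs_def] h_def[abs_def])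
  have I: "int p + 1 < int q" using pq by linarith
  have two: "arc (t A) (h A) u + arc (t B) (h B) u = 2"
    if u: "u \<notin> {int p, int p + 1, int q, int q + 1}" for u
  proof -
    consider "u < int p" | "int p + 1 < u" "u < int q" | "int q + 1 < u"
      using u by simp linarith
    then show ?thesis
      using I by cases (simp_all add: arc_def tA hA tB hB)
  qed
  define d :: int where "d = (if ltype \<alpha> A = Type_a then 2 else 0)"
  have self: "arc (t A) (h A) (t A) = 1" "arc (t A) (h A) (h A) = 1"
    "arc (t B) (h B) (t B) = 1" "arc (t B) (h B) (h B) = 1"
    using I by (auto simp: tA hA tB hB)
  have cross: "arc (t A) (h A) (t B) = d" "arc (t A) (h A) (h B) = d"
    "arc (t B) (h B) (t A) = d" "arc (t B) (h B) (h A) = d"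
    using I by (auto simp: arc_def sgn_if tA hA tB hB d_def)
  have bal: "weight t h k (t A) + weight t h k (t B) = weight t h k (h A) + weight t h k (h B)"
    if k: "k \<in> elements (matrix_of \<alpha>)" for k
  proof -
    consider "k = Some A" | "k = Some B" | "k \<in> elements (matrix_of \<alpha>) - Some ` {A, B}"
      using k by auto
    then show ?thesis
    proof cases
      case 3
      from adj[OF this] show ?thesis by (auto simp: tA hA tB hB)
    qed (simp_all add: self cross)
  qed
  have "complementary (matrix_of \<alpha>) (Some A) (Some B)"
    unfolding complementary_def
  proof (intro conjI ballI)
    fix k assume k: "k \<in> elements (matrix_of \<alpha>)"
    let ?W = "weight t h k"
    define F where "F c = (arc (t A) (h A) (t c) + arc (t B) (h B) (t c) - 2) * ?W (h c)
      - (arc (t A) (h A) (h c) + arc (t B) (h B) (h c) - 2) * ?W (t c)" for c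
    have "key_form (letters \<alpha>) t h (Some A) k + key_form (letters \<alpha>) t h (Some B) k
        - key_form (letters \<alpha>) t h None k = sum F (letters \<alpha>)"
      unfolding key_form_def sum.distrib[symmetric] sum_subtractf[symmetric] F_def
      by (intro sum.cong refl) (simp add: algebra_simps)
    also have "\<dots> = sum F {A, B}"
      using A(3,4) away two by (intro sum.mono_neutral_right) (auto simp: F_def)
    \<comment> \<open>At each of the four ends one arc has its own end (weight 1) and the other one
      has weight \<open>d\<close>, so the deviation from 2 is \<open>d - 1\<close> throughout;
      \<open>bal\<close> then cancels the weights of \<open>k\<close>.\<close>
    also have "\<dots> = (d - 1) * (?W (h A) + ?W (h B) - (?W (t A) + ?W (t B)))"
      using ne by (simp add: F_def self cross algebra_simps)
    also have "\<dots> = 0"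
      using bal[OF k] by simp
    finally show "form (matrix_of \<alpha>) (Some A) k + form (matrix_of \<alpha>) (Some B) k =
        form (matrix_of \<alpha>) (base (matrix_of \<alpha>)) k"
      using form[OF _ k, of "Some A"] form[OF _ k, of "Some B"] form[OF _ k, of None] A(3,4) by simp
  qed (use A ne in simp_all)
  then have "removable (matrix_of \<alpha>) (Some ` {A, B})"
    by (auto intro: removable.intros)
  then show ?thesis
  proof (rule matrix_equiv_filter[OF \<alpha> \<beta>, rotated 3])
    have "filter (\<lambda>c. c \<noteq> A \<and> c \<noteq> B) u = u" if "A \<notin> set u" "B \<notin> set u" for u
      using that by (auto simp: filter_id_conv)
    then show "word \<beta> = filter (\<lambda>c. c \<notin> {A, B}) (word \<alpha>)"
      using A by (simp add: w)
    fix u v assume "u \<in> elements (matrix_of \<alpha>) - Some ` {A, B}" "v \<in> elements (matrix_of \<alpha>) - Some ` {A, B}"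
    note uv = adj[OF this(1)] adj[OF this(2)]
    \<comment> \<open>The tail of \<open>A\<close> is adjacent to the head of \<open>B\<close>, and
      the head of \<open>A\<close> to the tail of \<open>B\<close>, so the summands of
      \<open>A\<close> and \<open>B\<close> are opposite.\<close>
    show "key_form {A, B} (\<lambda>X. int (tail_pos \<alpha> X)) (\<lambda>X. int (head_pos \<alpha> X)) u v = 0"
      unfolding t_def[symmetric, abs_def] h_def[symmetric, abs_def]
      using ne by (auto simp: key_form_def tA hA tB hB uv)
  qed (use A type in simp_all)
qed

text \<open>The move transposes three pairs of adjacent positions (the map \<open>s\<close>) and
  keeps all letters. Nothing changes at the ends of other letters. The summands of \<open>A\<close>,
  \<open>B\<close>, \<open>C\<close> do change separately, but their total is the same.\<close>

lemma matrix_of_H3: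
  assumes \<alpha>: "is_nanoword \<alpha>" and \<beta>: "is_nanoword \<beta>"
    and w: "word \<alpha> = x @ [A, B] @ y @ [A, C] @ z @ [B, C] @ v"
      "word \<beta> = x @ [B, A] @ y @ [C, A] @ z @ [C, B] @ v"
    and type: "ltype \<beta> = ltype \<alpha>" and AB: "ltype \<alpha> A = ltype \<alpha> B" "ltype \<alpha> B = ltype \<alpha> C"
  shows "matrix_of \<alpha> \<cong>\<^sub>b matrix_of \<beta>"
proof -
  define i where "i = length x"
  define j where "j = i + 2 + length y"
  define l where "l = j + 2 + length z"
  define s where "s p = (if p \<in> {i, j, l} then p + 1 else if p \<in> {i + 1, j + 1, l + 1} then p - 1 else p)"
    for p
  define t where "t X = int (tail_pos \<alpha> X)" for X
  define h where "h X = int (head_pos \<alpha> X)" for X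
  define t' where "t' X = int (s (tail_pos \<alpha> X))" for X
  define h' where "h' X = int (s (head_pos \<alpha> X))" for X
  have ord: "i + 1 < j" "j + 1 < l" by (simp_all add: j_def l_def)
  have ne: "A \<noteq> B" "A \<noteq> C" "B \<noteq> C"
    using \<alpha> by (auto simp: is_nanoword_def gauss_word_def w split: if_splits)
  have L: "letters \<beta> = letters \<alpha>"
    by (auto simp: letters_def w)
  have mem: "A \<in> letters \<alpha>" "B \<in> letters \<alpha>" "C \<in> letters \<alpha>"
    by (auto simp: letters_def w)
  have len: "length (word \<beta>) = length (word \<alpha>)" "l + 1 < length (word \<alpha>)"
    by (simp_all add: w i_def j_def l_def)
  have nth: "word \<alpha> ! i = A" "word \<alpha> ! Suc i = B" "word \<alpha> ! j = A" "word \<alpha> ! Suc j = C"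
    "word \<alpha> ! l = B" "word \<alpha> ! Suc l = C"
    by (simp_all add: w i_def j_def l_def nth_append)
  have nth_\<beta>: "word \<beta> ! i = B" "word \<beta> ! Suc i = A" "word \<beta> ! j = C" "word \<beta> ! Suc j = A"
    "word \<beta> ! l = C" "word \<beta> ! Suc l = B"
    by (simp_all add: w i_def j_def l_def nth_append)
  have s_eqs: "s i = Suc i" "s (Suc i) = i" "s j = Suc j" "s (Suc j) = j" "s l = Suc l" "s (Suc l) = l"
    using ord by (auto simp: s_def)
  have nth': "word \<beta> ! s p = word \<alpha> ! p" if "p < length (word \<alpha>)" for p
  proof -
    consider "p \<in> {i, Suc i, j, Suc j, l, Suc l}" | "p \<notin> {i, Suc i, j, Suc j, l, Suc l}" by blast
    then show ?thesis
    proof cases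
      case 1
      then show ?thesis
        using nth nth_\<beta> s_eqs by auto
    next
      case 2
      then have "s p = p"
        by (simp add: s_def)
      moreover have "word \<beta> ! p = word \<alpha> ! p"
        using 2 by (auto simp: w i_def j_def l_def nth_append nth_Cons')
      ultimately show ?thesis by simp
    qed
  qed
  have s_lt: "s p < length (word \<alpha>)" if "p < length (word \<alpha>)" for p
    using that len(2) ord by (auto simp: s_def)
  note AA = tail_head_pos_eq[OF \<alpha> _ _ nth(1,3)]
  note BB = tail_head_pos_eq[OF \<alpha> _ _ nth(2,5)]
  note CC = tail_head_pos_eq[OF \<alpha> _ _ nth(4,6)]
  let ?a = "ltype \<alpha> A = Type_a"
  have pos: "tail_pos \<alpha> A = (if ?a then i else j)" "head_pos \<alpha> A = (if ?a then j else i)"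
    "tail_pos \<alpha> B = (if ?a then Suc i else l)" "head_pos \<alpha> B = (if ?a then l else Suc i)"
    "tail_pos \<alpha> C = (if ?a then Suc j else Suc l)" "head_pos \<alpha> C = (if ?a then Suc l else Suc j)"
    using AA BB CC ord len(2) AB by simp_all
  have away: "tail_pos \<alpha> c \<notin> {i, Suc i, j, Suc j, l, Suc l}" "head_pos \<alpha> c \<notin> {i, Suc i, j, Suc j, l, Suc l}"
    if "c \<in> letters \<alpha>" "c \<notin> {A, B, C}" for c
    using positions_nth(3,4)[OF \<alpha> that(1)] nth that(2) by auto
  have keep: "s (tail_pos \<alpha> c) = tail_pos \<alpha> c" "s (head_pos \<alpha> c) = head_pos \<alpha> c"
    if "c \<in> letters \<alpha>" "c \<notin> {A, B, C}" for c
    using away[OF that] by (simp_all add: s_def)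
  have key': "keyed \<beta> t' h'"
    unfolding t'_def[abs_def] h'_def[abs_def]
  proof (rule keyed_positions[OF \<beta>])
    fix X assume X: "X \<in> letters \<beta>"
    then have X': "X \<in> letters \<alpha>" by (simp add: L)
    note P = positions_nth[OF \<alpha> X']
    show "s (tail_pos \<alpha> X) < length (word \<beta>) \<and> word \<beta> ! s (tail_pos \<alpha> X) = X"
      "s (head_pos \<alpha> X) < length (word \<beta>) \<and> word \<beta> ! s (head_pos \<alpha> X) = X"
      using P(1-4) s_lt nth' len by simp_all
    show "s (tail_pos \<alpha> X) \<noteq> s (head_pos \<alpha> X) \<and>
        (ltype \<beta> X = Type_a \<longleftrightarrow> s (tail_pos \<alpha> X) < s (head_pos \<alpha> X))"
    proof (cases "X \<in> {A, B, C}")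
      case True
      then show ?thesis
        using AB ord by (auto simp: pos s_eqs type split: if_splits)
    next
      case False
      then show ?thesis
        using P(5,6) keep[OF X'] by (simp add: type)
    qed
  qed
  have key: "keyed \<alpha> t h"
    unfolding t_def[abs_def] h_def[abs_def] by (rule keyed_tail_head[OF \<alpha>])
  define I J K where "I = int i" and "J = int j" and "K = int l"
  have IJK: "I + 1 < J" "J + 1 < K"
    using ord by (simp_all add: I_def J_def K_def)
  have th: "t A = (if ?a then I else J)" "h A = (if ?a then J else I)"
    "t B = (if ?a then I + 1 else K)" "h B = (if ?a then K else I + 1)"
    "t C = (if ?a then J + 1 else K + 1)" "h C = (if ?a then K + 1 else J + 1)"
    "t' A = (if ?a then I + 1 else J + 1)" "h' A = (if ?a then J + 1 else I + 1)"
    "t' B = (if ?a then I else K + 1)" "h' B = (if ?a then K + 1 else I)"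
    "t' C = (if ?a then J else K)" "h' C = (if ?a then K else J)"
    by (simp_all add: t_def h_def t'_def h'_def pos s_eqs I_def J_def K_def)
  have far: "t' c = t c" "h' c = h c" "t c \<notin> {I, I + 1, J, J + 1, K, K + 1}"
    "h c \<notin> {I, I + 1, J, J + 1, K, K + 1}"
    if "c \<in> letters \<alpha>" "c \<notin> {A, B, C}" for c
    using away[OF that] keep[OF that]
    by (auto simp: t_def h_def t'_def h'_def I_def J_def K_def int_eq_plus1)
  let ?W = "weight t h" and ?W' = "weight t' h'"
  have rest: "?W' u p = ?W u p"
    if u: "u \<in> elements (matrix_of \<alpha>)" and p: "p \<notin> {I, I + 1, J, J + 1, K, K + 1}" for u p
  proof (cases u)
    case (Some g)
    then have g: "g \<in> letters \<alpha>" using u by auto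
    show ?thesis
    proof (cases "g \<in> {A, B, C}")
      case True
      have adj: "sgn (p - (I + 1)) = sgn (p - I)" "sgn (p - (J + 1)) = sgn (p - J)"
        "sgn (p - (K + 1)) = sgn (p - K)"
        using p by (auto simp: sgn_if)
      have ord: "sgn (I - J) = -1" "sgn (J - I) = 1" "sgn (I + 1 - (J + 1)) = -1" "sgn (J + 1 - (I + 1)) = 1"
        "sgn (I + 1 - K) = -1" "sgn (K - (I + 1)) = 1" "sgn (I - (K + 1)) = -1" "sgn (K + 1 - I) = 1"
        "sgn (J + 1 - (K + 1)) = -1" "sgn (K + 1 - (J + 1)) = 1" "sgn (J - K) = -1" "sgn (K - J) = 1"
        using IJK by simp_all
      from True show ?thesis
        unfolding Some weight_simps
        by (elim insertE emptyE; cases ?a; simp only: th simp_thms if_True if_False arc_def adj ord)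
    next
      case False
      then show ?thesis
        using far[OF g] unfolding Some by simp
    qed
  qed simp
  have other: "?W' u p = ?W u p" "?W u (I + 1) = ?W u I" "?W u (J + 1) = ?W u J" "?W u (K + 1) = ?W u K"
    if "u \<in> elements (matrix_of \<alpha>) - Some ` {A, B, C}" for u p
  proof -
    have "u = None \<or> (\<exists>g. u = Some g \<and> g \<in> letters \<alpha> \<and> g \<notin> {A, B, C})"
      using that by auto
    then show "?W' u p = ?W u p" "?W u (I + 1) = ?W u I" "?W u (J + 1) = ?W u J" "?W u (K + 1) = ?W u K"
      using far by (auto simp: arc_adjacent)
  qed
  define F where "F u v c = ?W u (t c) * ?W v (h c) - ?W u (h c) * ?W v (t c)" for u v c
  define F' where "F' u v c = ?W' u (t' c) * ?W' v (h' c) - ?W' u (h' c) * ?W' v (t' c)" for u v c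
  have split: "sum f (letters \<alpha>) = f A + f B + f C + sum f (letters \<alpha> - {A, B, C})" for f :: "_ \<Rightarrow> int"
    using sum.subset_diff[of "{A, B, C}" "letters \<alpha>" f] mem ne by simp
  \<comment> \<open>The arcs of \<open>A\<close>, \<open>B\<close>, \<open>C\<close> before and
    after the move, for either common type, at all six exchanged positions. Other elements have
    equal weights at adjacent positions, so this reduces the comparison of the totals to finitely
    many cases.\<close>
  have table:
    "arc I J I = 1" "arc I J (I + 1) = 2" "arc I J J = 1"
    "arc I J (J + 1) = 0" "arc I J K = 0" "arc I J (K + 1) = 0"
    "arc J I I = 1" "arc J I (I + 1) = 0" "arc J I J = 1"
    "arc J I (J + 1) = 2" "arc J I K = 2" "arc J I (K + 1) = 2"
    "arc (I + 1) K I = 0" "arc (I + 1) K (I + 1) = 1" "arc (I + 1) K J = 2"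
    "arc (I + 1) K (J + 1) = 2" "arc (I + 1) K K = 1" "arc (I + 1) K (K + 1) = 0"
    "arc K (I + 1) I = 2" "arc K (I + 1) (I + 1) = 1" "arc K (I + 1) J = 0"
    "arc K (I + 1) (J + 1) = 0" "arc K (I + 1) K = 1" "arc K (I + 1) (K + 1) = 2"
    "arc (J + 1) (K + 1) I = 0" "arc (J + 1) (K + 1) (I + 1) = 0" "arc (J + 1) (K + 1) J = 0"
    "arc (J + 1) (K + 1) (J + 1) = 1" "arc (J + 1) (K + 1) K = 2" "arc (J + 1) (K + 1) (K + 1) = 1"
    "arc (K + 1) (J + 1) I = 2" "arc (K + 1) (J + 1) (I + 1) = 2" "arc (K + 1) (J + 1) J = 2"
    "arc (K + 1) (J + 1) (J + 1) = 1" "arc (K + 1) (J + 1) K = 0" "arc (K + 1) (J + 1) (K + 1) = 1"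
    "arc (I + 1) (J + 1) I = 0" "arc (I + 1) (J + 1) (I + 1) = 1" "arc (I + 1) (J + 1) J = 2"
    "arc (I + 1) (J + 1) (J + 1) = 1" "arc (I + 1) (J + 1) K = 0" "arc (I + 1) (J + 1) (K + 1) = 0"
    "arc (J + 1) (I + 1) I = 2" "arc (J + 1) (I + 1) (I + 1) = 1" "arc (J + 1) (I + 1) J = 0"
    "arc (J + 1) (I + 1) (J + 1) = 1" "arc (J + 1) (I + 1) K = 2" "arc (J + 1) (I + 1) (K + 1) = 2"
    "arc I (K + 1) I = 1" "arc I (K + 1) (I + 1) = 2" "arc I (K + 1) J = 2"
    "arc I (K + 1) (J + 1) = 2" "arc I (K + 1) K = 2" "arc I (K + 1) (K + 1) = 1"
    "arc (K + 1) I I = 1" "arc (K + 1) I (I + 1) = 0" "arc (K + 1) I J = 0"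
    "arc (K + 1) I (J + 1) = 0" "arc (K + 1) I K = 0" "arc (K + 1) I (K + 1) = 1"
    "arc J K I = 0" "arc J K (I + 1) = 0" "arc J K J = 1"
    "arc J K (J + 1) = 2" "arc J K K = 1" "arc J K (K + 1) = 0"
    "arc K J I = 2" "arc K J (I + 1) = 2" "arc K J J = 1"
    "arc K J (J + 1) = 0" "arc K J K = 1" "arc K J (K + 1) = 2"
    using IJK by (simp_all add: arc_def sgn_if)
  have main: "F' u v A + F' u v B + F' u v C = F u v A + F u v B + F u v C"
    if u: "u \<in> elements (matrix_of \<alpha>)" and v: "v \<in> elements (matrix_of \<alpha>)" for u v
  proof -
    have cases: "u = Some A \<or> u = Some B \<or> u = Some C \<or> u \<in> elements (matrix_of \<alpha>) - Some ` {A, B, C}"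
      if "u \<in> elements (matrix_of \<alpha>)" for u
      using that by blast
    show ?thesis
      using cases[OF u] cases[OF v]
      by (elim disjE; cases ?a; simp only: F_def F'_def th weight_simps table other if_True if_False simp_thms)
  qed
  have "nanoword_form \<beta> u v = nanoword_form \<alpha> u v"
    if u: "u \<in> elements (matrix_of \<alpha>)" and v: "v \<in> elements (matrix_of \<alpha>)" for u v
  proof -
    have "key_form (letters \<alpha>) t' h' u v = key_form (letters \<alpha>) t h u v"
      unfolding key_form_def F_def[symmetric] F'_def[symmetric] split main[OF u v]
      unfolding add_left_cancel
    proof (rule sum.cong[OF refl])
      fix c assume "c \<in> letters \<alpha> - {A, B, C}"
      then have "c \<in> letters \<alpha>" "c \<notin> {A, B, C}" by auto
      note far[OF this]
      then show "F' u v c = F u v c"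
        using rest[OF u] rest[OF v] unfolding F_def F'_def by metis
    qed
    then show ?thesis
      using keyed_key_form[OF \<alpha> key u v] keyed_key_form[OF \<beta> key', of u v] u v by (simp add: L)
  qed
  then show ?thesis
    unfolding based_matrix_iso_def by (intro exI[of _ id]) (simp add: L)
qed

section \<open>From single moves to virtual strings\<close>

lemma homotopy_move_is_nanoword:
  "homotopy_move \<alpha> \<beta> \<Longrightarrow> is_nanoword \<alpha> \<and> is_nanoword \<beta>"
  by (erule homotopy_move.cases) (simp_all add: is_nanoword_def)

lemma homotopy_move_matrix_equiv:
  assumes "homotopy_move \<alpha> \<beta>"
  shows "matrix_of \<alpha> \<sim>\<^sub>b matrix_of \<beta>"
proof -
  have \<alpha>: "is_nanoword \<alpha>" and \<beta>: "is_nanoword \<beta>"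
    using homotopy_move_is_nanoword[OF assms] by blast+
  note equiv = iso_matrix_equiv[OF _ is_based_matrix_matrix_of[OF \<alpha>]]
  show ?thesis
    using assms
  proof cases
    case iso
    then show ?thesis by (intro equiv matrix_of_nanoword_iso)
  next
    case (shift A x y A' \<tau>' \<tau>)
    then show ?thesis
      by (intro equiv matrix_of_shift[OF \<alpha> \<beta>, of A x y A']) auto
  next
    case (H1 x A y \<tau>)
    then show ?thesis
      by (intro matrix_equiv_H1[OF \<alpha> \<beta>, of x A y]) auto
  next
    case (H2 x A B y z \<tau>)
    then show ?thesis
      by (intro matrix_equiv_H2[OF \<alpha> \<beta>, of x A B y z]) auto
  next
    case (H3 x A B y C z t \<tau>)
    then show ?thesis
      by (intro equiv matrix_of_H3[OF \<alpha> \<beta>, of x A B y C z t]) auto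
  qed
qed

lemma homotopic_matrix_equiv:
  assumes "homotopic \<alpha> \<beta>"
  shows "matrix_of \<alpha> \<sim>\<^sub>b matrix_of \<beta>"
proof -
  have "is_nanoword \<alpha>" "equivclp homotopy_move \<alpha> \<beta>"
    using assms by (auto simp: homotopic_def)
  from this(2) show ?thesis
  proof (induction rule: equivclp_induct)
    case base
    show ?case
      using iso_matrix_equiv[OF iso_refl is_based_matrix_matrix_of] \<open>is_nanoword \<alpha>\<close> by blast
  next
    case (step \<beta> \<gamma>)
    then show ?case
      using homotopy_move_matrix_equiv matrix_equiv_sym matrix_equiv_trans by blast
  qed
qed

text \<open>Virtual strings are classes of nanowords over the natural numbers, whereas a cable has
  other letters; both words are therefore replaced by isomorphic ones over the natural
  numbers.\<close>

lemma represents_matrix_equiv: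
  assumes "represents \<alpha> \<Gamma>" "represents \<beta> \<Gamma>"
  shows "matrix_of \<alpha> \<sim>\<^sub>b matrix_of \<beta>"
proof -
  have rep: "\<exists>\<alpha>'. homotopic \<alpha>' \<alpha>' \<and> matrix_of \<alpha> \<sim>\<^sub>b matrix_of \<alpha>' \<and> \<Gamma> = abs_virtual_string \<alpha>'"
    if r: "represents \<alpha> \<Gamma>" for \<alpha> :: "'c nanoword"
  proof -
    obtain \<alpha>' where \<alpha>': "is_nanoword \<alpha>" "is_nanoword \<alpha>'" "nanoword_iso \<alpha> \<alpha>'"
      "\<Gamma> = abs_virtual_string \<alpha>'"
      using r unfolding represents_def by blast
    have "homotopic \<alpha>' \<alpha>'"
      using \<alpha>'(2) by (simp add: homotopic_def)
    moreover have "matrix_of \<alpha> \<sim>\<^sub>b matrix_of \<alpha>'"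
      using iso_matrix_equiv[OF matrix_of_nanoword_iso[OF \<alpha>'(1-3)] is_based_matrix_matrix_of[OF \<alpha>'(1)]] .
    ultimately show ?thesis
      using \<alpha>'(4) by blast
  qed
  obtain \<alpha>' where \<alpha>': "homotopic \<alpha>' \<alpha>'" "matrix_of \<alpha> \<sim>\<^sub>b matrix_of \<alpha>'" "\<Gamma> = abs_virtual_string \<alpha>'"
    using rep[OF assms(1)] by blast
  obtain \<beta>' where \<beta>': "homotopic \<beta>' \<beta>'" "matrix_of \<beta> \<sim>\<^sub>b matrix_of \<beta>'" "\<Gamma> = abs_virtual_string \<beta>'"
    using rep[OF assms(2)] by blast
  have "homotopic \<alpha>' \<beta>'"
    using Quotient3_rel[OF Quotient3_virtual_string, of \<alpha>' \<beta>'] \<alpha>'(1,3) \<beta>'(1,3) by simp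
  note \<alpha>'(2)
  also note homotopic_matrix_equiv[OF \<open>homotopic \<alpha>' \<beta>'\<close>]
  also note matrix_equiv_sym[OF \<beta>'(2)]
  finally show ?thesis .
qed

section \<open>Cables of based matrices\<close>

text \<open>A pair \<open>(g, r)\<close> stands for \<open>g + r s\<close>. Multiples of
  \<open>s\<close> are written with \<open>g = s\<close>, so their coefficient is one less:
  \<open>n s\<close> becomes \<open>(s, n - 1)\<close> and \<open>(n - 1 - i) s\<close> becomes
  \<open>(s, n - 2 - i)\<close>.\<close>

fun cable_class :: "nat \<Rightarrow> 'g \<Rightarrow> 'g cable_letter option \<Rightarrow> 'g \<times> int" where
  "cable_class n s None = (s, int n - 1)"
| "cable_class n s (Some (Crossing g i j)) = (g, (int j - int i) mod int n)"
| "cable_class n s (Some (Joint i)) = (s, int n - 2 - int i)"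

text \<open>The bilinear extension of \<open>b\<close> to the classes \<open>g + r s\<close>; the
  term with both coefficients drops out because \<open>b(s,s) = 0\<close>.\<close>

definition lift_form :: "'g based_matrix \<Rightarrow> 'g \<times> int \<Rightarrow> 'g \<times> int \<Rightarrow> int" where
  "lift_form M x y = form M (fst x) (fst y) + snd y * form M (fst x) (base M) +
     snd x * form M (base M) (fst y)"

definition cable_crossings :: "nat \<Rightarrow> 'g set \<Rightarrow> 'g cable_letter set" where
  "cable_crossings n G = {Crossing g i j | g i j. g \<in> G \<and> i < n \<and> j < n}"

lemma mem_cable_crossings [simp]:
  "Crossing g i j \<in> cable_crossings n G \<longleftrightarrow> g \<in> G \<and> i < n \<and> j < n"
  "Joint i \<notin> cable_crossings n G"
  by (auto simp: cable_crossings_def)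

lemma Some_mem_image [simp]: "Some x \<in> Some ` S \<longleftrightarrow> x \<in> S" "None \<notin> Some ` S"
  and Joint_mem_image [simp]: "Joint i \<in> Joint ` I \<longleftrightarrow> i \<in> I" "Crossing g i j \<notin> Joint ` I"
  by auto

definition cable_matrix :: "nat \<Rightarrow> 'g based_matrix \<Rightarrow> 'g cable_letter option based_matrix" where
  "cable_matrix n M = Based_Matrix
     (insert None (Some ` (cable_crossings n (elements M - {base M}) \<union> Joint ` {..<n - 1}))) None
     (\<lambda>x y. lift_form M (cable_class n (base M) x) (cable_class n (base M) y))"

lemma cable_matrix_sel [simp]:
  "elements (cable_matrix n M) =
     insert None (Some ` (cable_crossings n (elements M - {base M}) \<union> Joint ` {..<n - 1}))"
  "base (cable_matrix n M) = None"
  "form (cable_matrix n M) x y = lift_form M (cable_class n (base M) x) (cable_class n (base M) y)"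
  by (simp_all add: cable_matrix_def)

lemma cable_class_elements:
  assumes "x \<in> elements (cable_matrix n M)" "base M \<in> elements M"
  shows "fst (cable_class n (base M) x) \<in> elements M"
  using assms by (auto simp: cable_crossings_def)

lemma is_based_matrix_cable_matrix:
  assumes "is_based_matrix M"
  shows "is_based_matrix (cable_matrix n M)"
proof -
  note M = is_based_matrixD[OF assms]
  have "cable_crossings n (elements M - {base M}) \<subseteq>
      (\<lambda>(g, i, j). Crossing g i j) ` (elements M \<times> {..<n} \<times> {..<n})"
    by (force simp: cable_crossings_def)
  then have "finite (cable_crossings n (elements M - {base M}))"
    by (rule finite_subset) (simp add: M(1))
  moreover have "lift_form M x y = - lift_form M y x" if "fst x \<in> elements M" "fst y \<in> elements M" for x y
    using M(3)[OF that] M(3)[OF that(1) M(2)] M(3)[OF that(2) M(2)]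
    by (simp add: lift_form_def)
  ultimately show ?thesis
    unfolding is_based_matrix_def using cable_class_elements[OF _ M(2)]
    by (metis (no_types, lifting) cable_matrix_sel finite_Un finite_imageI finite_insert
        finite_lessThan insertI1)
qed

lemma cable_matrix_iso:
  assumes "M \<cong>\<^sub>b N" "base M \<in> elements M"
  shows "cable_matrix n M \<cong>\<^sub>b cable_matrix n N"
proof -
  obtain f where f: "bij_betw f (elements M) (elements N)" "f (base M) = base N"
      "\<And>x y. x \<in> elements M \<Longrightarrow> y \<in> elements M \<Longrightarrow> form N (f x) (f y) = form M x y"
    using assms unfolding based_matrix_iso_def by blast
  let ?F = "map_option (map_cable_letter f)"
  have inj: "inj_on f (elements M)" and e: "elements N = f ` elements M"
    using f(1) by (auto simp: bij_betw_def)
  have cls: "cable_class n (base N) (?F x) = map_prod f id (cable_class n (base M) x)" for x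
    by (cases "(n, base M, x)" rule: cable_class.cases) (simp_all add: f(2))
  have "lift_form N (map_prod f id x) (map_prod f id y) = lift_form M x y"
    if "fst x \<in> elements M" "fst y \<in> elements M" for x y
    using that f(3) assms(2) by (simp add: lift_form_def f(2)[symmetric])
  then have form: "form (cable_matrix n N) (?F x) (?F y) = form (cable_matrix n M) x y"
    if "x \<in> elements (cable_matrix n M)" "y \<in> elements (cable_matrix n M)" for x y
    using that cable_class_elements assms(2) by (metis cable_matrix_sel(3) cls)
  have ne: "f ` (elements M - {base M}) = elements N - {base N}"
    using inj assms(2) by (auto simp: e f(2)[symmetric] dest: inj_onD)
  have cr: "map_cable_letter f ` cable_crossings n G = cable_crossings n (f ` G)" for G
    by (force simp: cable_crossings_def)
  have jo: "map_cable_letter f ` Joint ` {..<n - 1} = Joint ` {..<n - 1}"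
    by (simp add: image_image)
  have "inj_on ?F (elements (cable_matrix n M))"
  proof (rule inj_onI)
    fix x y assume "x \<in> elements (cable_matrix n M)" "y \<in> elements (cable_matrix n M)" "?F x = ?F y"
    then show "x = y"
      using inj by (cases x; cases y; (cases "the x"; cases "the y")?) (auto dest: inj_onD)
  qed
  moreover have "?F ` insert None (Some ` S) = insert None (Some ` map_cable_letter f ` S)" for S
    by (simp add: image_image)
  then have "?F ` elements (cable_matrix n M) = elements (cable_matrix n N)"
    unfolding cable_matrix_sel by (simp only:) (simp only: image_Un cr jo ne)
  ultimately show ?thesis
    unfolding based_matrix_iso_def using form
    by (intro exI[of _ ?F]) (auto simp: bij_betw_def)
qed

text \<open>Used with \<open>k\<close> equal to \<open>n\<close>, \<open>n - 2\<close> and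
  \<open>n - 1\<close>, the totals of the two residues in a cancelling pair when the deleted element
  is annihilating, core, or one of a complementary pair.\<close>

lemma diff_mod_eq:
  fixes a k m n :: int
  assumes "a mod n \<le> k" "k - a mod n < n" "(m - (k - a)) mod n = 0"
  shows "m mod n = k - a mod n"
proof -
  have "m mod n = (k - a) mod n"
    using assms(3) by (simp add: mod_eq_dvd_iff mod_0_imp_dvd)
  also have "\<dots> = (k - a mod n) mod n"
    by (simp add: mod_diff_right_eq)
  also have "\<dots> = k - a mod n"
    using assms(1,2) by (simp add: mod_pos_pos_trivial)
  finally show ?thesis .
qed

lemma delete_cable_matrix:
  assumes "base M \<notin> D" "D \<subseteq> elements M"
  shows "cable_matrix n (delete_elements D M) =
    delete_elements (Some ` cable_crossings n D) (cable_matrix n M)"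
proof -
  have "elements (cable_matrix n (delete_elements D M)) =
      elements (cable_matrix n M) - Some ` cable_crossings n D"
  proof (rule set_eqI)
    fix x
    show "x \<in> elements (cable_matrix n (delete_elements D M)) \<longleftrightarrow>
        x \<in> elements (cable_matrix n M) - Some ` cable_crossings n D"
    proof (cases x)
      case (Some c)
      then show ?thesis by (cases c) auto
    qed simp
  qed
  moreover have "lift_form (delete_elements D M) = lift_form M"
    by (intro ext) (simp add: lift_form_def)
  ultimately show ?thesis
    by (simp add: cable_matrix_def delete_elements_def)
qed

text \<open>The class of a crossing is \<open>g + r s\<close> with \<open>r = (j - i) mod n\<close>, and the base element
  is \<open>n s\<close>. So if \<open>g\<close> vanishes, the classes \<open>r s\<close> and \<open>(n - r) s\<close> are complementary;
  if \<open>g = s\<close>, the classes \<open>(r + 1) s\<close> and \<open>(n - r - 1) s\<close> are; and if \<open>g + h = s\<close>, the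
  classes \<open>g + r s\<close> and \<open>h + (n - 1 - r) s\<close> are.\<close>

lemma cable_matrix_reduction:
  assumes M: "is_based_matrix M" and "reduction M N" and n: "n \<ge> 1"
  shows "reduction\<^sup>*\<^sup>* (cable_matrix n M) (cable_matrix n N)"
proof -
  obtain D where D: "removable M D" "N = delete_elements D M"
    using assms(2) by (auto simp: reduction_iff)
  let ?s = "base M" and ?C = "cable_matrix n M"
  note bm = is_based_matrixD[OF M]
  have sub: "D \<subseteq> elements M - {?s}"
    by (rule removable_subset[OF D(1)])
  have N: "cable_matrix n N = delete_elements (Some ` cable_crossings n D) ?C"
    unfolding D(2) using sub by (intro delete_cable_matrix) auto
  have ss: "form M ?s ?s = 0"
    using bm(3)[OF bm(2) bm(2)] by simp
  have csub: "Some ` cable_crossings n D \<subseteq> elements ?C - {base ?C}"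
  proof
    fix x assume "x \<in> Some ` cable_crossings n D"
    then obtain g i j where "x = Some (Crossing g i j)" "g \<in> D" "i < n" "j < n"
      by (auto simp: cable_crossings_def)
    then show "x \<in> elements ?C - {base ?C}"
      using sub by auto
  qed
  have fin: "finite (Some ` cable_crossings n D)"
    using finite_subset[OF csub] is_based_matrixD(1)[OF is_based_matrix_cable_matrix[OF M]] by simp
  have memC: "Some (Crossing g i j) \<in> elements ?C - {base ?C}"
    if "g \<in> elements M - {?s}" "i < n" "j < n" for g i j
    using that by simp
  have baseC: "form ?C (base ?C) y = int n * form M ?s (fst (cable_class n ?s y))" for y
    by (simp add: lift_form_def ss algebra_simps)
  have crossC: "form ?C (Some (Crossing g i j)) y = form M g (fst (cable_class n ?s y)) +
      snd (cable_class n ?s y) * form M g ?s +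
      (int j - int i) mod int n * form M ?s (fst (cable_class n ?s y))" for g i j y
    by (simp add: lift_form_def)
  have cls: "fst (cable_class n ?s y) \<in> elements M" if "y \<in> elements ?C" for y
    using cable_class_elements[OF that bm(2)] .
  have n0: "0 < int n" using n by simp
  have r: "0 \<le> a mod int n" "a mod int n < int n" for a
    using n0 by simp_all
  have "reduction\<^sup>*\<^sup>* ?C (delete_elements (Some ` cable_crossings n D) ?C)"
    using D(1)
  proof cases
    case (annihilating g)
    then have g: "g \<in> elements M - {?s}" "\<And>k. k \<in> elements M \<Longrightarrow> form M g k = 0"
      by (auto simp: annihilating_def)
    have form: "form ?C (Some (Crossing g i j)) y =
        (int j - int i) mod int n * form M ?s (fst (cable_class n ?s y))" if "y \<in> elements ?C" for i j y
      unfolding crossC using g(2)[OF cls[OF that]] g(2)[OF bm(2)] by simp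
    \<comment> \<open>Exchanging the indices negates \<open>r = (j - i) mod n\<close>. The fixed
      points are those with \<open>i = j\<close>, where \<open>r = 0\<close> and the class
      vanishes.\<close>
    define p where "p x = (case x of Some (Crossing h i j) \<Rightarrow> Some (Crossing h j i) | _ \<Rightarrow> x)"
      for x :: "'a cable_letter option"
    show ?thesis
    proof (rule delete_paired[OF fin csub, of p])
      fix x assume "x \<in> Some ` cable_crossings n D"
      then obtain i j where x: "x = Some (Crossing g i j)" "i < n" "j < n"
        using annihilating by (auto simp: cable_crossings_def)
      have px: "p x = Some (Crossing g j i)"
        by (simp add: x(1) p_def)
      show "p x \<in> Some ` cable_crossings n D" "p (p x) = x"
        using x(2,3) annihilating(1) unfolding px by (simp_all add: p_def x(1))
      show "annihilating ?C x \<or> core ?C x" if "p x = x"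
      proof -
        have "i = j"
          using that[unfolded px] unfolding x(1) option.inject cable_letter.inject by blast
        then have "annihilating ?C x"
          unfolding annihilating_def x(1) using memC[OF g(1) x(2,3)] form \<open>i = j\<close>
          by (simp del: cable_matrix_sel)
        then show ?thesis ..
      qed
      show "complementary ?C x (p x)" if "p x \<noteq> x"
      proof -
        have ne: "i \<noteq> j"
          using that[unfolded px] unfolding x(1) option.inject cable_letter.inject by blast
        have "(int j - int i) mod int n \<noteq> 0"
        proof
          assume "(int j - int i) mod int n = 0"
          then have "int j mod int n = int i mod int n"
            by (simp add: mod_eq_dvd_iff mod_0_imp_dvd)
          with ne x show False by simp
        qed
        then have "(int i - int j) mod int n = int n - (int j - int i) mod int n"
          using r[of "int j - int i"] by (intro diff_mod_eq) auto
        then have "form ?C (Some (Crossing g i j)) y + form ?C (Some (Crossing g j i)) y =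
            form ?C (base ?C) y" if "y \<in> elements ?C" for y
          unfolding baseC form[OF that] distrib_right[symmetric] by simp
        with ne show ?thesis
          unfolding complementary_def px unfolding x(1)
          using memC[OF g(1) x(2,3)] memC[OF g(1) x(3,2)] by (simp del: cable_matrix_sel)
      qed
    qed
  next
    case (core g)
    then have g: "g \<in> elements M - {?s}" "\<And>k. k \<in> elements M \<Longrightarrow> form M g k = form M ?s k"
      by (auto simp: core_def)
    have form: "form ?C (Some (Crossing g i j)) y =
        ((int j - int i) mod int n + 1) * form M ?s (fst (cable_class n ?s y))" if "y \<in> elements ?C" for i j y
      unfolding crossC using g(2)[OF cls[OF that]] g(2)[OF bm(2)] ss by (simp add: algebra_simps)
    \<comment> \<open>The new residue is that of \<open>(i - 1) - (j + 1)\<close>, so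
      \<open>r\<close> goes to \<open>n - 2 - r\<close> and the classes \<open>(r + 1) s\<close> add
      up to \<open>n s\<close>. The fixed points have \<open>r = n - 1\<close>: their class is
      \<open>n s\<close>, which makes them core.\<close>
    define p where "p x = (case x of
        Some (Crossing h i j) \<Rightarrow> Some (Crossing h ((j + 1) mod n) ((i + n - 1) mod n)) | _ \<Rightarrow> x)"
      for x :: "'a cable_letter option"
    show ?thesis
    proof (rule delete_paired[OF fin csub, of p])
      fix x assume "x \<in> Some ` cable_crossings n D"
      then obtain i j where x: "x = Some (Crossing g i j)" "i < n" "j < n"
        using core by (auto simp: cable_crossings_def)
      define i' where "i' = (j + 1) mod n"
      define j' where "j' = (i + n - 1) mod n"
      have ij': "i' < n" "j' < n" using n by (simp_all add: i'_def j'_def)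
      have px: "p x = Some (Crossing g i' j')"
        by (simp add: x(1) p_def i'_def j'_def)
      have inv: "(j' + 1) mod n = i" "(i' + n - 1) mod n = j"
        using pred_mod_iff[of j' n i] pred_mod_iff[of j n i'] ij' x by (auto simp: i'_def j'_def)
      show "p x \<in> Some ` cable_crossings n D"
        using core(1) ij' unfolding px by simp
      show "p (p x) = x"
        unfolding px by (simp only: p_def option.case cable_letter.case inv x(1))
      have cong: "(int j' - int i' - (int n - 2 - (int j - int i))) mod int n = 0"
      proof -
        have "int i' mod int n = (int j + 1) mod int n"
          by (simp add: i'_def zmod_int add.commute)
        moreover have "(int j' + 1) mod int n = int i mod int n"
          using arg_cong[OF inv(1), of int] x(2) by (simp add: zmod_int add.commute)
        ultimately have "int n dvd int i' - (int j + 1)" "int n dvd int j' + 1 - int i"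
          by (simp_all add: mod_eq_dvd_iff)
        then have "int n dvd (int j' + 1 - int i) - (int i' - (int j + 1)) - int n"
          by (metis dvd_diff dvd_refl)
        then show ?thesis
          by (simp add: algebra_simps)
      qed
      show "annihilating ?C x \<or> core ?C x" if "p x = x"
      proof -
        have "i = (j + 1) mod n" using that[unfolded px] unfolding x(1) by (simp add: i'_def)
        then have "(int j - int i) mod int n = int n - 1"
          using x(3) n by (cases "j + 1 = n") (auto simp: zmod_minus1)
        then have "core ?C x"
          unfolding core_def x(1) baseC using memC[OF g(1) x(2,3)] form
          by (simp del: cable_matrix_sel)
        then show ?thesis ..
      qed
      show "complementary ?C x (p x)" if "p x \<noteq> x"
      proof -
        have "(int j - int i) mod int n \<noteq> int n - 1"
        proof
          assume "(int j - int i) mod int n = int n - 1"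
          then have "(int j - int i) mod int n = - 1 mod int n"
            using n0 by (simp add: zmod_minus1)
          then have "(int j + 1) mod int n = int i mod int n"
            by (simp add: mod_eq_dvd_iff algebra_simps)
          then have "int i' = int i"
            using x(2) by (simp add: i'_def zmod_int add.commute)
          then have "i' = i" "j' = j"
            using inv(2) by (simp_all add: j'_def)
          with that[unfolded px] show False by (simp add: x(1))
        qed
        then have "(int j' - int i') mod int n = int n - 2 - (int j - int i) mod int n"
          using r[of "int j - int i"] cong by (intro diff_mod_eq) auto
        then have "form ?C (Some (Crossing g i j)) y + form ?C (Some (Crossing g i' j')) y =
            form ?C (base ?C) y" if "y \<in> elements ?C" for y
          unfolding baseC form[OF that] distrib_right[symmetric] by simp
        moreover have "Some (Crossing g i j) \<noteq> Some (Crossing g i' j')"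
          using that[unfolded px] unfolding x(1) by metis
        ultimately show ?thesis
          unfolding complementary_def px unfolding x(1)
          using memC[OF g(1) x(2,3)] memC[OF g(1) ij'] by (simp del: cable_matrix_sel)
      qed
    qed
  next
    case (complementary g h)
    then have gh: "g \<in> elements M - {?s}" "h \<in> elements M - {?s}" "g \<noteq> h"
      "\<And>k. k \<in> elements M \<Longrightarrow> form M g k + form M h k = form M ?s k"
      by (auto simp: complementary_def)
    \<comment> \<open>From \<open>g\<close> to \<open>h\<close> the residue becomes that of
      \<open>i - (j + 1)\<close>, which is \<open>n - 1 - r\<close>; the other branch is the inverse
      map. There are no fixed points because \<open>g\<close> and \<open>h\<close> differ.\<close>
    define p where "p x = (case x of
        Some (Crossing k i j) \<Rightarrow> if k = g then Some (Crossing h ((j + 1) mod n) i)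
          else Some (Crossing g j ((i + n - 1) mod n)) | _ \<Rightarrow> x)"
      for x :: "'a cable_letter option"
    have compl: "complementary ?C (Some (Crossing g i j)) (Some (Crossing h ((j + 1) mod n) i))"
      if "i < n" "j < n" for i j
    proof -
      have "(int i - int ((j + 1) mod n)) mod int n = int n - 1 - (int j - int i) mod int n"
      proof (rule diff_mod_eq)
        have "int n dvd (int j + 1) - (int j + 1) mod int n - int n"
          by (intro dvd_diff dvd_minus_mod dvd_refl)
        then show "(int i - int ((j + 1) mod n) - (int n - 1 - (int j - int i))) mod int n = 0"
          by (simp add: zmod_int algebra_simps)
      qed (use r[of "int j - int i"] in auto)
      then have sum: "(int j - int i) mod int n + (int i - int ((j + 1) mod n)) mod int n = int n - 1"
        by simp
      have "form ?C (Some (Crossing g i j)) y + form ?C (Some (Crossing h ((j + 1) mod n) i)) y =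
          form ?C (base ?C) y" if y: "y \<in> elements ?C" for y
      proof -
        let ?k = "fst (cable_class n ?s y)" and ?q = "snd (cable_class n ?s y)"
        have "form ?C (Some (Crossing g i j)) y + form ?C (Some (Crossing h ((j + 1) mod n) i)) y =
            (form M g ?k + form M h ?k) + ?q * (form M g ?s + form M h ?s) +
            ((int j - int i) mod int n + (int i - int ((j + 1) mod n)) mod int n) * form M ?s ?k"
          unfolding crossC by (simp add: algebra_simps)
        also have "\<dots> = int n * form M ?s ?k"
          unfolding sum gh(4)[OF cls[OF y]] gh(4)[OF bm(2)] ss by (simp add: algebra_simps)
        finally show ?thesis by (simp only: baseC)
      qed
      then show ?thesis
        unfolding complementary_def
        using memC[OF gh(1) that] memC[OF gh(2), of "(j + 1) mod n" i] that n gh(3) by auto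
    qed
    have comm: "complementary ?C x y \<Longrightarrow> complementary ?C y x" for x y
      by (auto simp: complementary_def add.commute)
    show ?thesis
    proof (rule delete_paired[OF fin csub, of p])
      fix x assume "x \<in> Some ` cable_crossings n D"
      then obtain k i j where x: "x = Some (Crossing k i j)" "k = g \<or> k = h" "i < n" "j < n"
        using complementary by (auto simp: cable_crossings_def)
      have pm: "(j + 1) mod n < n" "(i + n - 1) mod n < n" using n by simp_all
      have inv: "((j + 1) mod n + n - 1) mod n = j" "((i + n - 1) mod n + 1) mod n = i"
        using pred_mod_iff[of j n "(j + 1) mod n"] pred_mod_iff[of "(i + n - 1) mod n" n i] x pm
        by auto
      show "p x \<in> Some ` cable_crossings n D"
        using x pm complementary by (auto simp: p_def cable_crossings_def)
      show "p (p x) = x"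
        using x(2) gh(3) inv by (auto simp: p_def x(1))
      show "annihilating ?C x \<or> core ?C x" if "p x = x"
        using that x(2) gh(3) by (auto simp: p_def x(1) split: if_splits)
      show "complementary ?C x (p x)"
        using x(2)
      proof
        assume "k = g"
        then show ?thesis using compl[OF x(3,4)] by (simp add: x(1) p_def)
      next
        assume "k = h"
        then show ?thesis
          using comm[OF compl[OF x(4) pm(2)]] gh(3) inv by (simp add: x(1) p_def)
      qed
    qed
  qed
  then show ?thesis
    by (simp only: N)
qed

text \<open>Reductions of \<open>M\<close> and \<open>N\<close> to isomorphic primitive matrices are
  carried over to the cables. The cable of a primitive matrix need not be primitive (joints can be
  complementary), hence the formulation with equivalence.\<close>

lemma cable_matrix_equiv:
  assumes "M \<sim>\<^sub>b N" "n \<ge> 1"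
  shows "cable_matrix n M \<sim>\<^sub>b cable_matrix n N"
proof -
  obtain P Q where P: "reduction\<^sup>*\<^sup>* M P" and Q: "reduction\<^sup>*\<^sup>* N Q" and PQ: "P \<cong>\<^sub>b Q"
    and M: "is_based_matrix M" and N: "is_based_matrix N"
    using assms(1) unfolding matrix_equiv_def by blast
  have red: "reduction\<^sup>*\<^sup>* (cable_matrix n M) (cable_matrix n P)"
    if "reduction\<^sup>*\<^sup>* M P" "is_based_matrix M" for M P :: "'c based_matrix"
    using that(1)
  proof (induction rule: rtranclp_induct)
    case (step K L)
    then show ?case
      using cable_matrix_reduction[OF is_based_matrix_reductions[OF step(1) that(2)] step(2) assms(2)]
      by simp
  qed simp
  note bP = is_based_matrix_reductions[OF P M]
  have "cable_matrix n M \<sim>\<^sub>b cable_matrix n P"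
    using reductions_matrix_equiv[OF red[OF P M] is_based_matrix_cable_matrix[OF M]] .
  also have "cable_matrix n P \<sim>\<^sub>b cable_matrix n Q"
    using iso_matrix_equiv[OF cable_matrix_iso[OF PQ is_based_matrixD(2)[OF bP]]
        is_based_matrix_cable_matrix[OF bP]] .
  also have "cable_matrix n Q \<sim>\<^sub>b cable_matrix n N"
    using matrix_equiv_sym[OF reductions_matrix_equiv[OF red[OF Q N] is_based_matrix_cable_matrix[OF N]]] .
  finally show ?thesis .
qed

section \<open>The based matrix of a cable\<close>

lemma sorted_wrt_concat_map:
  assumes "\<And>x. x \<in> set xs \<Longrightarrow> sorted_wrt R (f x)"
    and "sorted_wrt (\<lambda>x y. \<forall>a\<in>set (f x). \<forall>b\<in>set (f y). R a b) xs"
  shows "sorted_wrt R (concat (map f xs))"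
  using assms by (induction xs) (auto simp: sorted_wrt_append)

lemma less_mult_add:
  fixes a b k k' n :: int
  assumes "a < b" "k < n" "0 \<le> k'" "0 < n"
  shows "a * n + k < b * n + k'"
proof -
  have "(a + 1) * n \<le> b * n"
    using assms by (intro mult_right_mono) auto
  with assms show ?thesis by (simp add: algebra_simps)
qed

section \<open>The order of the occurrences in a cable\<close>

definition block :: "nat \<Rightarrow> 'a nanoword \<Rightarrow> nat \<Rightarrow> nat \<Rightarrow> 'a cable_letter list" where
  "block n \<alpha> i p = (let A = word \<alpha> ! p in
     if p = first_pos (word \<alpha>) A then first_block n i (ltype \<alpha> A) A
     else second_block n i (ltype \<alpha> A) A)"

lemma strand_block: "strand n \<alpha> i = concat (map (block n \<alpha> i) [0..<length (word \<alpha>)])"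
  by (simp add: strand_def block_def[abs_def])

lemma length_block: "n \<ge> 1 \<Longrightarrow> length (block n \<alpha> i p) = n"
  by (simp add: block_def first_block_def second_block_def Let_def)

text \<open>The strand of a crossing \<open>A\<^sub>i\<^sub>,\<^sub>j\<close> at the tail of \<open>A\<close> is \<open>i\<close> or \<open>i - 1\<close>, depending on the
  type of \<open>A\<close>, while the strand at the head of \<open>A\<close> is always \<open>j\<close>.\<close>

definition tail_strand :: "nat \<Rightarrow> letter_type \<Rightarrow> nat \<Rightarrow> nat" where
  "tail_strand n T i = (if T = Type_a then i else (i + n - 1) mod n)"

definition tail_index :: "nat \<Rightarrow> letter_type \<Rightarrow> nat \<Rightarrow> nat" where
  "tail_index n T d = (if T = Type_a then d else (d + 1) mod n)"

lemma tail_strand_less: "i < n \<Longrightarrow> tail_strand n T i < n"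
  and tail_index_less: "d < n \<Longrightarrow> tail_index n T d < n"
  by (auto simp: tail_strand_def tail_index_def)

lemma tail_index_strand: "i < n \<Longrightarrow> tail_index n T (tail_strand n T i) = i"
  using pred_mod_iff[of "(i + n - 1) mod n" n i] by (auto simp: tail_strand_def tail_index_def)

lemma tail_strand_index: "d < n \<Longrightarrow> tail_strand n T (tail_index n T d) = d"
  using pred_mod_iff[of d n "(d + 1) mod n"] by (auto simp: tail_strand_def tail_index_def)

locale cabled_nanoword =
  fixes n :: nat and \<alpha> :: "'a nanoword"
  assumes nano: "is_nanoword \<alpha>" and n: "n \<ge> 1"
begin

definition len :: nat where "len = length (word \<alpha>)"

text \<open>An occurrence in the cable is determined by its strand, its position in the original word
  and its index within the block; keys encode the lexicographic order. The joints sit at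
  position \<open>len\<close>.\<close>

definition key :: "nat \<Rightarrow> nat \<Rightarrow> nat \<Rightarrow> int" where
  "key i p k = (int i * (int len + 1) + int p) * int n + int k"

lemma key_less:
  assumes "i < i' \<or> i = i' \<and> (p < p' \<or> p = p' \<and> k < k')" "p \<le> len" "k < n"
  shows "key i p k < key i' p' k'"
proof -
  have less: "key i p k < key i' p' k'"
    if "int i * (int len + 1) + int p < int i' * (int len + 1) + int p'"
    unfolding key_def by (rule less_mult_add[OF that]) (use assms n in auto)
  have "int i * (int len + 1) + int p < int i' * (int len + 1) + int p'" if "i < i'"
    by (rule less_mult_add) (use that assms in auto)
  with assms less show ?thesis
    by (auto simp: key_def)
qed

text \<open>The sign of the lexicographic comparison of \<open>(e, q)\<close> with
  \<open>(d, p)\<close>: it compares occurrences by strand and position, ignoring the index inside a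
  block.\<close>

definition lex :: "nat \<Rightarrow> nat \<Rightarrow> nat \<Rightarrow> nat \<Rightarrow> int" where
  "lex e d q p = sgn (int e - int d) + (if e = d then sgn (int q - int p) else 0)"

lemma sgn_key:
  assumes "p \<le> len" "k < n" "p' \<le> len" "k' < n"
  shows "sgn (key i p k - key i' p' k') =
    lex i i' p p' + (if i = i' \<and> p = p' then sgn (int k - int k') else 0)"
proof -
  consider "i < i' \<or> i = i' \<and> (p < p' \<or> p = p' \<and> k < k')"
    | "i' < i \<or> i' = i \<and> (p' < p \<or> p' = p \<and> k' < k)" | "i = i'" "p = p'" "k = k'"
    by linarith
  then show ?thesis
  proof cases
    case 1
    from key_less[OF this assms(1,2)] 1 show ?thesis
      by (auto simp: lex_def)
  next
    case 2
    from key_less[OF this assms(3,4)] 2 show ?thesis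
      by (auto simp: lex_def)
  qed (simp add: lex_def)
qed

fun tkey :: "'a cable_letter \<Rightarrow> int" where
  "tkey (Crossing A i j) = key (tail_strand n (ltype \<alpha> A) i) (tail_pos \<alpha> A) j"
| "tkey (Joint i) = key i len 0"

text \<open>For both types, the block at a head lists its crossings by decreasing strand of the
  tail. The joints closing the word are reversed as well, which gives the index
  \<open>n - 2 - i\<close>.\<close>

fun hkey :: "'a cable_letter \<Rightarrow> int" where
  "hkey (Crossing A i j) = key j (head_pos \<alpha> A) (n - 1 - tail_strand n (ltype \<alpha> A) i)"
| "hkey (Joint i) = key (n - 1) len (n - 2 - i)"

definition keyed_strand :: "nat \<Rightarrow> (int \<times> 'a cable_letter) list" where
  "keyed_strand i = concat (map (\<lambda>p. map (\<lambda>k. (key i p k, block n \<alpha> i p ! k)) [0..<n]) [0..<len])"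

definition keyed_word :: "(int \<times> 'a cable_letter) list" where
  "keyed_word = concat (map (\<lambda>i. keyed_strand i @ [(key i len 0, Joint i)]) [0..<n - 1]) @
     keyed_strand (n - 1) @ map (\<lambda>k. (key (n - 1) len k, Joint (n - 2 - k))) [0..<n - 1]"

lemma map_snd_keyed_strand: "map snd (keyed_strand i) = strand n \<alpha> i"
proof -
  have "map (\<lambda>k. block n \<alpha> i p ! k) [0..<n] = block n \<alpha> i p" for p
    using map_nth[of "block n \<alpha> i p"] unfolding length_block[OF n] .
  then show ?thesis
    by (simp add: keyed_strand_def strand_block map_concat o_def len_def)
qed

lemma map_snd_keyed_word: "map snd keyed_word = word (cable n \<alpha>)"
proof -
  have "map (\<lambda>k. Joint (n - 2 - k)) [0..<n - 1] = (rev (map Joint [0..<n - 1]) :: 'a cable_letter list)"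
    by (rule nth_equalityI) (auto simp: rev_nth)
  then show ?thesis
    by (simp add: keyed_word_def cable_def map_concat o_def map_snd_keyed_strand)
qed

lemma set_keyed_strand:
  "set (keyed_strand i) = {(key i p k, block n \<alpha> i p ! k) | p k. p < len \<and> k < n}"
  by (force simp: keyed_strand_def)

lemma sorted_keyed_strand: "sorted_wrt (\<lambda>a b. fst a < fst b) (keyed_strand i)"
  unfolding keyed_strand_def
proof (rule sorted_wrt_concat_map)
  fix p assume "p \<in> set [0..<len]"
  then show "sorted_wrt (\<lambda>a b. fst a < fst b) (map (\<lambda>k. (key i p k, block n \<alpha> i p ! k)) [0..<n])"
    by (auto simp: sorted_wrt_map sorted_wrt_iff_nth_less intro!: key_less)
qed (auto simp: sorted_wrt_iff_nth_less intro!: key_less)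

lemma sorted_keyed_word: "sorted_wrt (<) (map fst keyed_word)"
proof -
  have n1: "n - 1 < n" using n by simp
  have "sorted_wrt (\<lambda>a b. fst a < fst b) keyed_word"
    unfolding keyed_word_def sorted_wrt_append
  proof (intro conjI ballI)
    show "sorted_wrt (\<lambda>a b. fst a < fst b)
        (concat (map (\<lambda>i. keyed_strand i @ [(key i len 0, Joint i)]) [0..<n - 1]))"
    proof (rule sorted_wrt_concat_map)
      show "sorted_wrt (\<lambda>a b. fst a < fst b) (keyed_strand i @ [(key i len 0, Joint i)])" for i
        using sorted_keyed_strand[of i]
        by (auto simp: sorted_wrt_append set_keyed_strand intro!: key_less)
    qed (use n in \<open>auto simp: sorted_wrt_iff_nth_less set_keyed_strand intro!: key_less\<close>)
    show "sorted_wrt (\<lambda>a b. fst a < fst b) (keyed_strand (n - 1))"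
      by (rule sorted_keyed_strand)
    show "sorted_wrt (\<lambda>a b. fst a < fst b)
        (map (\<lambda>k. (key (n - 1) len k, Joint (n - 2 - k))) [0..<n - 1])"
      by (auto simp: sorted_wrt_map sorted_wrt_iff_nth_less intro!: key_less)
  qed (use n in \<open>auto simp: set_keyed_strand intro!: key_less\<close>)
  then show ?thesis
    by (simp add: sorted_wrt_map)
qed

lemma tail_block:
  assumes "A \<in> letters \<alpha>" "i < n" "j < n"
  shows "block n \<alpha> (tail_strand n (ltype \<alpha> A) i) (tail_pos \<alpha> A) ! j = Crossing A i j"
proof -
  have "gauss_word (word \<alpha>)" "A \<in> set (word \<alpha>)"
    using nano assms(1) by (auto simp: is_nanoword_def letters_def)
  note P = positions(2)[OF this]
  have w: "word \<alpha> ! tail_pos \<alpha> A = A"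
    by (rule positions_nth(3)[OF nano assms(1)])
  show ?thesis
  proof (cases "ltype \<alpha> A = Type_a")
    case True
    then show ?thesis
      using assms w by (simp add: block_def Let_def tail_pos_def tail_strand_def first_block_def)
  next
    case False
    moreover have "((i + n - 1) mod n + 1) mod n = i"
      using tail_index_strand[OF assms(2), of Type_b] by (simp add: tail_index_def tail_strand_def)
    ultimately show ?thesis
      using assms w P by (simp add: block_def Let_def tail_pos_def tail_strand_def second_block_def)
  qed
qed

lemma head_block:
  assumes "A \<in> letters \<alpha>" "i < n" "j < n"
  shows "block n \<alpha> j (head_pos \<alpha> A) ! (n - 1 - tail_strand n (ltype \<alpha> A) i) = Crossing A i j"
proof -
  have "gauss_word (word \<alpha>)" "A \<in> set (word \<alpha>)"
    using nano assms(1) by (auto simp: is_nanoword_def letters_def)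
  note P = positions(2)[OF this]
  have w: "word \<alpha> ! head_pos \<alpha> A = A"
    by (rule positions_nth(4)[OF nano assms(1)])
  show ?thesis
  proof (cases "ltype \<alpha> A = Type_a")
    case True
    then show ?thesis
      using assms w P
      by (simp add: block_def Let_def head_pos_def tail_strand_def second_block_def rev_nth)
  next
    case False
    show ?thesis
    \<comment> \<open>For type \<open>b\<close> the block at the head opens with
      \<open>Crossing A 0 j\<close>, whose tail lies on the last strand
      \<open>n - 1\<close>.\<close>
    proof (cases "i = 0")
      case True
      with False show ?thesis
        using assms w by (simp add: block_def Let_def head_pos_def tail_strand_def first_block_def)
    next
      case i: False
      then have d: "(i + n - 1) mod n = i - 1"
        using assms(2) pred_mod_iff[of "i - 1" n i] by auto
      have "n - 1 - (i - 1) = Suc (n - 1 - i)"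
        using i assms(2) by simp
      moreover have "rev [1..<n] ! (n - 1 - i) = i"
        using i assms(2) by (simp add: rev_nth)
      ultimately show ?thesis
        using assms w False d i
        by (simp add: block_def Let_def head_pos_def tail_strand_def first_block_def)
    qed
  qed
qed

lemma letters_cable:
  "letters (cable n \<alpha>) = cable_crossings n (letters \<alpha>) \<union> Joint ` {..<n - 1}"
proof (intro set_eqI iffI)
  fix c assume c: "c \<in> letters (cable n \<alpha>)"
  show "c \<in> cable_crossings n (letters \<alpha>) \<union> Joint ` {..<n - 1}"
  proof (cases c)
    case (Joint i)
    have "Joint i \<notin> set (strand n \<alpha> k)" for k
      using count_strand_Joint[of n \<alpha> k i] by (simp add: count_list_0_iff)
    with c Joint show ?thesis
      by (auto simp: letters_def cable_def)
  next
    case (Crossing A i j)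
    have "(\<exists>k<n - 1. Crossing A i j \<in> set (strand n \<alpha> k)) \<or> Crossing A i j \<in> set (strand n \<alpha> (n - 1))"
      using c unfolding Crossing letters_def cable_def by auto
    then have "\<exists>k<n. Crossing A i j \<in> set (strand n \<alpha> k)"
    proof
      assume "Crossing A i j \<in> set (strand n \<alpha> (n - 1))"
      then show ?thesis using n by (intro exI[of _ "n - 1"]) simp
    qed (meson less_imp_diff_less less_le_trans diff_le_self)
    then have "(\<Sum>k<n. count_list (strand n \<alpha> k) (Crossing A i j)) \<noteq> 0"
      by (auto simp: count_list_0_iff)
    then have "count_list (word \<alpha>) A \<noteq> 0" "i < n" "j < n"
      unfolding count_strands_Crossing by (simp_all split: if_splits)
    then show ?thesis
      unfolding Crossing count_list_0_iff by (simp add: letters_def)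
  qed
next
  fix c assume c: "c \<in> cable_crossings n (letters \<alpha>) \<union> Joint ` {..<n - 1}"
  show "c \<in> letters (cable n \<alpha>)"
  proof (cases c)
    case (Joint i)
    with c show ?thesis
      by (auto simp: letters_def cable_def)
  next
    case (Crossing A i j)
    with c have A: "A \<in> letters \<alpha>" "i < n" "j < n" by auto
    let ?d = "tail_strand n (ltype \<alpha> A) i"
    have "Crossing A i j \<in> set (block n \<alpha> ?d (tail_pos \<alpha> A))"
      using nth_mem[of j "block n \<alpha> ?d (tail_pos \<alpha> A)"] tail_block[OF A] A(3)
      by (simp add: length_block[OF n])
    then have s: "Crossing A i j \<in> set (strand n \<alpha> ?d)"
      using positions_nth(1)[OF nano A(1)] by (auto simp: strand_block)
    have "?d < n - 1 \<or> ?d = n - 1"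
      using tail_strand_less[OF A(2), of "ltype \<alpha> A"] by linarith
    with s show ?thesis
      unfolding Crossing letters_def cable_def by auto
  qed
qed

text \<open>This explains \<open>cable_type\<close>: it assigns type \<open>a\<close> exactly when
  the tail precedes the head, which is settled by the strands and, on a common strand, by the type
  of \<open>A\<close>.\<close>

lemma tkey_less_hkey:
  assumes "A \<in> letters \<alpha>" "i < n" "j < n"
  defines "d \<equiv> tail_strand n (ltype \<alpha> A) i"
  shows "tkey (Crossing A i j) < hkey (Crossing A i j) \<longleftrightarrow> d < j \<or> d = j \<and> ltype \<alpha> A = Type_a"
    and "tkey (Crossing A i j) \<noteq> hkey (Crossing A i j)"
proof -
  note P = positions_nth[OF nano assms(1), folded len_def]
  consider "d < j \<or> d = j \<and> tail_pos \<alpha> A < head_pos \<alpha> A"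
    | "j < d \<or> j = d \<and> head_pos \<alpha> A < tail_pos \<alpha> A"
    using P(5) by linarith
  then show "tkey (Crossing A i j) < hkey (Crossing A i j) \<longleftrightarrow> d < j \<or> d = j \<and> ltype \<alpha> A = Type_a"
    and "tkey (Crossing A i j) \<noteq> hkey (Crossing A i j)"
    using key_less[of d j "tail_pos \<alpha> A" "head_pos \<alpha> A" j "n - 1 - d"]
      key_less[of j d "head_pos \<alpha> A" "tail_pos \<alpha> A" "n - 1 - d" j] P(1,2,6) assms(3) n
    unfolding tkey.simps hkey.simps d_def[symmetric] by (cases; auto)+
qed

lemma keyed_cable: "keyed (cable n \<alpha>) tkey hkey"
proof (rule keyedI[OF is_nanoword_cable[OF nano n] sorted_keyed_word map_snd_keyed_word])
  have in_strand: "(key i p k, block n \<alpha> i p ! k) \<in> set keyed_word" if "i < n" "p < len" "k < n" for i p k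
  proof -
    have "i < n - 1 \<or> i = n - 1" using that(1) by linarith
    then show ?thesis
      using that by (auto simp: keyed_word_def set_keyed_strand)
  qed
  fix X assume "X \<in> letters (cable n \<alpha>)"
  then consider A i j where "X = Crossing A i j" "A \<in> letters \<alpha>" "i < n" "j < n"
    | i where "X = Joint i" "i < n - 1"
    by (auto simp: letters_cable cable_crossings_def)
  then have "(tkey X, X) \<in> set keyed_word \<and> (hkey X, X) \<in> set keyed_word \<and> tkey X \<noteq> hkey X \<and>
      (ltype (cable n \<alpha>) X = Type_a \<longleftrightarrow> tkey X < hkey X)"
  proof cases
    case (1 A i j)
    let ?d = "tail_strand n (ltype \<alpha> A) i"
    have d: "?d < n" by (rule tail_strand_less[OF 1(3)])
    note P = positions_nth[OF nano 1(2), folded len_def]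
    have mem: "(tkey X, X) \<in> set keyed_word" "(hkey X, X) \<in> set keyed_word"
      using in_strand[OF d P(1) 1(4)] in_strand[OF 1(4) P(2), of "n - 1 - ?d"] n d
        tail_block[OF 1(2-4)] head_block[OF 1(2-4)] by (simp_all add: 1(1))
    note cmp = tkey_less_hkey[OF 1(2-4), folded 1(1)]
    have "ltype (cable n \<alpha>) X = Type_a \<longleftrightarrow> tkey X < hkey X"
      unfolding cmp(1) using P(6) by (auto simp: 1(1) cable_def tail_strand_def)
    with mem cmp(2) show ?thesis by blast
  next
    case (2 i)
    have "Joint i = (Joint (n - 2 - (n - 2 - i)) :: 'a cable_letter)"
      using 2(2) by simp
    then have "(hkey X, X) \<in> set keyed_word"
      using 2(2) unfolding 2(1) keyed_word_def
      by (auto intro!: image_eqI[of _ _ "n - 2 - i"])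
    moreover have "(tkey X, X) \<in> set keyed_word"
      using 2 by (auto simp: keyed_word_def)
    moreover have "tkey X < hkey X"
      using 2 by (auto intro!: key_less)
    ultimately show ?thesis
      by (simp add: 2(1) cable_def)
  qed
  then show "(tkey X, X) \<in> set keyed_word" "(hkey X, X) \<in> set keyed_word" "tkey X \<noteq> hkey X"
    "ltype (cable n \<alpha>) X = Type_a \<longleftrightarrow> tkey X < hkey X"
    by blast+
qed

text \<open>The weight of a letter of the cable at an occurrence of a crossing \<open>B\<^sub>i\<^sub>,\<^sub>j\<close> is a part
  depending only on the block of \<open>n\<close> parallel crossings in which the occurrence lies (\<open>spread\<close>),
  plus a sign if the letter starts or ends in the same block (\<open>tail_twist\<close>, \<open>head_twist\<close>). The
  constant term of \<open>spread\<close> is \<open>2\<close> if the arc passes the base point and \<open>0\<close> otherwise.\<close>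

fun spread :: "'a cable_letter option \<Rightarrow> nat \<Rightarrow> nat \<Rightarrow> int" where
  "spread None e q = 2"
| "spread (Some (Joint m)) e q = 1 + lex e m q len"
| "spread (Some (Crossing A i j)) e q =
     lex e (tail_strand n (ltype \<alpha> A) i) q (tail_pos \<alpha> A) - lex e j q (head_pos \<alpha> A) +
     (1 + sgn (tkey (Crossing A i j) - hkey (Crossing A i j)))"

text \<open>The weight at the head of \<open>Joint e\<close>. These heads come after all crossings,
  so only the constant term remains for a crossing. Among joints the order at the end of the word is
  reversed, which is how \<open>lex e m len len\<close> arises.\<close>

fun spread_end :: "'a cable_letter option \<Rightarrow> nat \<Rightarrow> int" where
  "spread_end None e = 2"
| "spread_end (Some (Joint m)) e = 1 + lex e m len len"
| "spread_end (Some (Crossing A i j)) e = 1 + sgn (tkey (Crossing A i j) - hkey (Crossing A i j))"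

fun tail_twist :: "'a cable_letter option \<Rightarrow> 'a \<Rightarrow> nat \<Rightarrow> nat \<Rightarrow> int" where
  "tail_twist (Some (Crossing A i j)) B e k =
     (if B = A then if e = tail_strand n (ltype \<alpha> A) i then sgn (int k - int j) else 0 else 0)"
| "tail_twist x B e k = 0"

text \<open>The reversed order in the block of a head absorbs the minus sign of the head in
  \<open>arc\<close>, so both twists carry a positive sign.\<close>

fun head_twist :: "'a cable_letter option \<Rightarrow> 'a \<Rightarrow> nat \<Rightarrow> nat \<Rightarrow> int" where
  "head_twist (Some (Crossing A i j)) B e k =
     (if B = A then if k = j then sgn (int e - int (tail_strand n (ltype \<alpha> A) i)) else 0 else 0)"
| "head_twist x B e k = 0"

text \<open>Names a crossing by the strands \<open>e\<close> of its tail and \<open>k\<close> of its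
  head. Up to the twists, the weight at the tail depends only on \<open>e\<close> and the one at the
  head only on \<open>k\<close>, so double sums factor.\<close>

definition crossing_at :: "'a \<Rightarrow> nat \<Rightarrow> nat \<Rightarrow> 'a cable_letter" where
  "crossing_at B e k = Crossing B (tail_index n (ltype \<alpha> B) e) k"

lemma element_cases:
  assumes "x \<in> elements (matrix_of (cable n \<alpha>))"
  obtains "x = None" | m where "x = Some (Joint m)" "m < n - 1"
  | A i j where "x = Some (Crossing A i j)" "A \<in> letters \<alpha>" "i < n" "j < n"
  using assms by (auto simp: letters_cable cable_crossings_def)

lemma last_lex: "e < n \<Longrightarrow> q < p \<Longrightarrow> lex e (n - 1) q p = -1"
  by (auto simp: lex_def sgn_if)

lemma weight_crossing:
  assumes x: "x \<in> elements (matrix_of (cable n \<alpha>))" and B: "B \<in> letters \<alpha>" "e < n" "k < n"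
  shows "weight tkey hkey x (tkey (crossing_at B e k)) = spread x e (tail_pos \<alpha> B) + tail_twist x B e k"
    and "weight tkey hkey x (hkey (crossing_at B e k)) = spread x k (head_pos \<alpha> B) + head_twist x B e k"
proof -
  note PB = positions_nth[OF nano B(1), folded len_def]
  have keys: "tkey (crossing_at B e k) = key e (tail_pos \<alpha> B) k"
    "hkey (crossing_at B e k) = key k (head_pos \<alpha> B) (n - 1 - e)"
    by (simp_all add: crossing_at_def tail_strand_index[OF B(2)])
  have "weight tkey hkey x (tkey (crossing_at B e k)) = spread x e (tail_pos \<alpha> B) + tail_twist x B e k \<and>
    weight tkey hkey x (hkey (crossing_at B e k)) = spread x k (head_pos \<alpha> B) + head_twist x B e k"
    using x
  proof (cases rule: element_cases)
    case (2 m)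
    have "sgn (key m len 0 - key (n - 1) len (n - 2 - m)) = -1"
      using 2(2) by (simp add: key_less)
    then show ?thesis
      using B(2,3) PB(1,2) 2(2) last_lex[OF B(2) PB(1)] last_lex[OF B(3) PB(2)]
      by (simp add: 2(1) keys arc_def sgn_key)
  next
    case (3 A i j)
    note PA = positions_nth[OF nano 3(2), folded len_def]
    have d: "tail_strand n (ltype \<alpha> A) i < n"
      by (rule tail_strand_less[OF 3(3)])
    have eq: "tail_pos \<alpha> B = tail_pos \<alpha> A \<longleftrightarrow> B = A" "head_pos \<alpha> B = head_pos \<alpha> A \<longleftrightarrow> B = A"
      "tail_pos \<alpha> B \<noteq> head_pos \<alpha> A" "head_pos \<alpha> B \<noteq> tail_pos \<alpha> A"
      using PA(3-5) PB(3-5) by metis+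
    have sub: "sgn (int (n - 1 - e) - int (n - 1 - f)) = - sgn (int e - int f)" if "f < n" for f
      using that B(2) by (auto simp: sgn_if)
    have flip: "sgn (int (tail_strand n (ltype \<alpha> A) i) - int e) =
        - sgn (int e - int (tail_strand n (ltype \<alpha> A) i))"
      by (simp add: sgn_if)
    show ?thesis
      using B(2,3) PA(1,2) PB(1,2) 3(4) d n
      by (simp add: 3(1) keys arc_def sgn_key eq sub[OF d] flip)
  qed simp
  then show "weight tkey hkey x (tkey (crossing_at B e k)) = spread x e (tail_pos \<alpha> B) + tail_twist x B e k"
    and "weight tkey hkey x (hkey (crossing_at B e k)) = spread x k (head_pos \<alpha> B) + head_twist x B e k"
    by blast+
qed

lemma weight_joint:
  assumes x: "x \<in> elements (matrix_of (cable n \<alpha>))" and e: "e < n - 1"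
  shows "weight tkey hkey x (tkey (Joint e)) = spread x e len"
    and "weight tkey hkey x (hkey (Joint e)) = spread_end x e"
proof -
  have "weight tkey hkey x (tkey (Joint e)) = spread x e len \<and>
    weight tkey hkey x (hkey (Joint e)) = spread_end x e"
    using x
  proof (cases rule: element_cases)
    case (2 m)
    have sub: "sgn (int (n - 2 - e) - int (n - 2 - m)) = - sgn (int e - int m)"
      using e 2(2) by (auto simp: sgn_if)
    have *: "sgn (key m len 0 - key (n - 1) len (n - 2 - m)) = -1"
      "sgn (key e len 0 - key (n - 1) len (n - 2 - m)) = -1"
      "sgn (key (n - 1) len (n - 2 - e) - key m len 0) = 1"
      using 2(2) e by (simp_all add: key_less)
    have "sgn (key (n - 1) len (n - 2 - e) - key (n - 1) len (n - 2 - m)) =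
        lex (n - 1) (n - 1) len len +
        (if n - 1 = n - 1 \<and> len = len then sgn (int (n - 2 - e) - int (n - 2 - m)) else 0)"
      by (rule sgn_key) (use n in auto)
    then have "sgn (key (n - 1) len (n - 2 - e) - key (n - 1) len (n - 2 - m)) = - sgn (int e - int m)"
      unfolding sub by (simp add: lex_def)
    moreover have "sgn (key e len 0 - key m len 0) = lex e m len len"
      using n by (simp add: sgn_key)
    ultimately show ?thesis
      using * by (simp add: 2(1) arc_def lex_def)
  next
    case (3 A i j)
    note PA = positions_nth[OF nano 3(2), folded len_def]
    have d: "tail_strand n (ltype \<alpha> A) i < n"
      by (rule tail_strand_less[OF 3(3)])
    have "tkey (Crossing A i j) < key (n - 1) len (n - 2 - e)"
      unfolding tkey.simps by (rule key_less) (use d 3(4) PA(1) in linarith)+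
    moreover have "hkey (Crossing A i j) < key (n - 1) len (n - 2 - e)"
      unfolding hkey.simps by (rule key_less) (use d 3(4) PA(2) in linarith)+
    ultimately have "sgn (key (n - 1) len (n - 2 - e) - tkey (Crossing A i j)) = 1"
      "sgn (key (n - 1) len (n - 2 - e) - hkey (Crossing A i j)) = 1"
      by simp_all
    then show ?thesis
      using d 3(4) PA(1,2) n e
      by (simp add: 3(1) arc_def sgn_key)
  qed simp
  then show "weight tkey hkey x (tkey (Joint e)) = spread x e len"
    and "weight tkey hkey x (hkey (Joint e)) = spread_end x e"
    by blast+
qed

section \<open>Summation over the parallel strands\<close>

lemma sum_sgn: "d < n \<Longrightarrow> (\<Sum>e<n. sgn (int e - int d)) = int n - 1 - 2 * int d"
proof -
  have "(\<Sum>e<m. sgn (int e - int d)) = (if m \<le> d then - int m else int m - 1 - 2 * int d)" for m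
    by (induction m) (auto simp: sgn_if)
  then show "d < n \<Longrightarrow> ?thesis" by simp
qed

lemma sum_lex: "d < n \<Longrightarrow> (\<Sum>e<n. lex e d q p) = int n - 1 - 2 * int d + sgn (int q - int p)"
  by (simp add: lex_def sum.distrib sum_sgn)

text \<open>Left unevaluated: these terms cancel later by symmetry in the two arguments.\<close>

definition sgn_product :: "nat \<Rightarrow> nat \<Rightarrow> int" where
  "sgn_product a b = (\<Sum>k<n. sgn (int k - int a) * sgn (int k - int b))"

lemma sgn_product_commute: "sgn_product a b = sgn_product b a"
  by (simp add: sgn_product_def mult.commute)

lemma sum_sgn_lex: "b < n \<Longrightarrow> (\<Sum>k<n. sgn (int k - int a) * lex k b q p) =
    sgn_product a b + sgn (int b - int a) * sgn (int q - int p)"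
proof -
  assume "b < n"
  have "sgn (int k - int a) * lex k b q p = sgn (int k - int a) * sgn (int k - int b) +
      (if k = b then sgn (int b - int a) * sgn (int q - int p) else 0)" for k
    by (simp add: lex_def)
  with \<open>b < n\<close> show ?thesis
    by (simp add: sgn_product_def sum.distrib)
qed

text \<open>The arc from strand \<open>d\<close> to strand \<open>j\<close> advances by
  \<open>j - d\<close> strands, plus \<open>n\<close> if it passes the base point of the cable. For
  type \<open>b\<close> the arc of \<open>A\<close> in the original word already passes the base
  point once; the 2 subtracted here is that passage, which belongs to \<open>[A]\<close> and not to
  \<open>r s\<close>.\<close>

lemma twice_class:
  assumes "A \<in> letters \<alpha>" "i < n" "j < n"
  defines "d \<equiv> tail_strand n (ltype \<alpha> A) i"
  shows "2 * ((int j - int i) mod int n) = 2 * (int j - int d) - (if ltype \<alpha> A = Type_a then 0 else 2) +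
    int n * (1 + sgn (tkey (Crossing A i j) - hkey (Crossing A i j)))"
proof -
  have s: "sgn (tkey (Crossing A i j) - hkey (Crossing A i j)) =
      (if d < j \<or> d = j \<and> ltype \<alpha> A = Type_a then -1 else 1)"
    using tkey_less_hkey[OF assms(1-3)] unfolding d_def by (auto simp: sgn_if)
  have m: "(int j - int i) mod int n = (if i \<le> j then int j - int i else int j - int i + int n)"
  proof (cases "i \<le> j")
    case False
    have "(int j - int i) mod int n = (int j - int i + int n) mod int n" by simp
    also have "\<dots> = int j - int i + int n"
      using False assms(2) by (intro mod_pos_pos_trivial) auto
    finally show ?thesis using False by simp
  qed (use assms(3) in simp)
  show ?thesis
  proof (cases "ltype \<alpha> A = Type_a")
    case True
    then show ?thesis
      unfolding s m by (auto simp: d_def tail_strand_def)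
  next
    case False
    have "d = (if i = 0 then n - 1 else i - 1)"
      using assms(2) pred_mod_iff[of "i - 1" n i] False by (auto simp: d_def tail_strand_def)
    then show ?thesis
      unfolding s m using assms(2,3) False by auto
  qed
qed

definition class_of :: "'a cable_letter option \<Rightarrow> 'a option \<times> int" where
  "class_of x = cable_class n None (map_option (map_cable_letter Some) x)"

definition old_weight :: "'a option \<Rightarrow> nat \<Rightarrow> int" where
  "old_weight g q = weight (\<lambda>c. int (tail_pos \<alpha> c)) (\<lambda>c. int (head_pos \<alpha> c)) g (int q)"

text \<open>The projection to the original curve: the right-hand side is the weight of
  \<open>g + r s\<close> in the original word, as \<open>s\<close> has weight 2.\<close>

lemma sum_spread:
  assumes x: "x \<in> elements (matrix_of (cable n \<alpha>))" and q: "q < len"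
  shows "(\<Sum>e<n. spread x e q) = old_weight (fst (class_of x)) q + 2 * snd (class_of x)"
  using x
proof (cases rule: element_cases)
  case 1
  then show ?thesis
    using n by (simp add: class_of_def old_weight_def algebra_simps)
next
  case (2 m)
  then show ?thesis
    using q by (simp add: class_of_def old_weight_def sum.distrib sum_lex)
next
  case (3 A i j)
  let ?d = "tail_strand n (ltype \<alpha> A) i"
  have d: "?d < n"
    by (rule tail_strand_less[OF 3(3)])
  have "sgn (int (tail_pos \<alpha> A) - int (head_pos \<alpha> A)) = (if ltype \<alpha> A = Type_a then -1 else 1)"
    using positions_nth(5,6)[OF nano 3(2)] by (auto simp: sgn_if)
  then show ?thesis
    using twice_class[OF 3(2-4)] d 3(4)
    by (cases "ltype \<alpha> A = Type_a")
      (simp_all add: 3(1) class_of_def old_weight_def arc_def sum.distrib sum_subtractf sum_lex algebra_simps)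
qed

definition twist_sum :: "'a cable_letter option \<Rightarrow> 'a cable_letter option \<Rightarrow> int" where
  "twist_sum x y = (\<Sum>B\<in>letters \<alpha>. \<Sum>e<n. \<Sum>k<n.
     tail_twist x B e k * spread y k (head_pos \<alpha> B) - head_twist x B e k * spread y e (tail_pos \<alpha> B))"

definition joint_sum :: "'a cable_letter option \<Rightarrow> 'a cable_letter option \<Rightarrow> int" where
  "joint_sum x y = (\<Sum>e<n - 1. spread x e len * spread_end y e - spread_end x e * spread y e len)"

lemma sum_delta_outer:
  fixes f :: "nat \<Rightarrow> int"
  assumes "d < n"
  shows "(\<Sum>e<n. \<Sum>k<n. if e = d then f k else 0) = sum f {..<n}"
    and "(\<Sum>e<n. \<Sum>k<n. if k = d then f e else 0) = sum f {..<n}"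
proof -
  have "(\<Sum>e<n. \<Sum>k<n. if e = d then f k else 0) = (\<Sum>e<n. if e = d then sum f {..<n} else 0)"
    by (intro sum.cong) auto
  then show "(\<Sum>e<n. \<Sum>k<n. if e = d then f k else 0) = sum f {..<n}"
    using assms by simp
qed (use assms in simp)

lemma twist_sum_crossing:
  assumes "A \<in> letters \<alpha>" "i < n" "j < n"
  shows "twist_sum (Some (Crossing A i j)) y =
    (\<Sum>k<n. sgn (int k - int j) * spread y k (head_pos \<alpha> A)) -
    (\<Sum>e<n. sgn (int e - int (tail_strand n (ltype \<alpha> A) i)) * spread y e (tail_pos \<alpha> A))"
proof -
  let ?d = "tail_strand n (ltype \<alpha> A) i"
  let ?F = "\<lambda>B e k. tail_twist (Some (Crossing A i j)) B e k * spread y k (head_pos \<alpha> B) -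
    head_twist (Some (Crossing A i j)) B e k * spread y e (tail_pos \<alpha> B)"
  have "twist_sum (Some (Crossing A i j)) y = (\<Sum>B\<in>{A}. \<Sum>e<n. \<Sum>k<n. ?F B e k)"
    unfolding twist_sum_def using assms(1) by (intro sum.mono_neutral_right) auto
  also have "\<dots> = (\<Sum>e<n. \<Sum>k<n. (if e = ?d then sgn (int k - int j) * spread y k (head_pos \<alpha> A) else 0)) -
      (\<Sum>e<n. \<Sum>k<n. (if k = j then sgn (int e - int ?d) * spread y e (tail_pos \<alpha> A) else 0))"
    unfolding sum_subtractf[symmetric] by (simp add: if_distrib[of "\<lambda>u. u * _"] cong: if_cong)
  also have "\<dots> = (\<Sum>k<n. sgn (int k - int j) * spread y k (head_pos \<alpha> A)) -
      (\<Sum>e<n. sgn (int e - int ?d) * spread y e (tail_pos \<alpha> A))"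
    using sum_delta_outer[OF tail_strand_less[OF assms(2)]] sum_delta_outer[OF assms(3)] by simp
  finally show ?thesis .
qed

lemma twist_sum_simps [simp]: "twist_sum None y = 0" "twist_sum (Some (Joint m)) y = 0"
  by (simp_all add: twist_sum_def)

text \<open>Each weight at a crossing is a spread plus a twist. Products of spreads factor over the
  two strands, mixed products form \<open>twist_sum\<close>, and products of two twists
  cancel.\<close>

lemma key_form_cable:
  assumes x: "x \<in> elements (matrix_of (cable n \<alpha>))" and y: "y \<in> elements (matrix_of (cable n \<alpha>))"
  shows "key_form (letters (cable n \<alpha>)) tkey hkey x y =
    (\<Sum>B\<in>letters \<alpha>.
       (\<Sum>e<n. spread x e (tail_pos \<alpha> B)) * (\<Sum>e<n. spread y e (head_pos \<alpha> B)) -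
       (\<Sum>e<n. spread x e (head_pos \<alpha> B)) * (\<Sum>e<n. spread y e (tail_pos \<alpha> B))) +
    (twist_sum x y - twist_sum y x + joint_sum x y)"
proof -
  let ?F = "\<lambda>c. weight tkey hkey x (tkey c) * weight tkey hkey y (hkey c) -
    weight tkey hkey x (hkey c) * weight tkey hkey y (tkey c)"
  let ?c = "\<lambda>(B, e, k). crossing_at B e k"
  let ?S = "letters \<alpha> \<times> {..<n} \<times> {..<n}"
  have bij: "bij_betw ?c ?S (cable_crossings n (letters \<alpha>))"
  proof (rule bij_betw_byWitness[where f' = "\<lambda>c. case c of
      Crossing B i j \<Rightarrow> (B, tail_strand n (ltype \<alpha> B) i, j) | Joint i \<Rightarrow> undefined"])
  qed (auto simp: crossing_at_def cable_crossings_def tail_strand_index tail_index_strand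
      tail_index_less tail_strand_less)
  have fin: "finite (cable_crossings n (letters \<alpha>))"
    using bij_betw_finite[OF bij] by simp
  have "key_form (letters (cable n \<alpha>)) tkey hkey x y =
      sum ?F (cable_crossings n (letters \<alpha>)) + sum ?F (Joint ` {..<n - 1})"
    unfolding key_form_def letters_cable by (rule sum.union_disjoint) (use fin in auto)
  also have "sum ?F (Joint ` {..<n - 1}) = joint_sum x y"
    unfolding joint_sum_def
    by (subst sum.reindex)
      (auto simp: inj_on_def weight_joint[OF x] weight_joint[OF y] simp del: tkey.simps hkey.simps
        One_nat_def intro!: sum.cong)
  also have "sum ?F (cable_crossings n (letters \<alpha>)) = (\<Sum>z\<in>?S. ?F (?c z))"
    by (rule sum.reindex_bij_betw[OF bij, symmetric])
  also have "\<dots> = (\<Sum>B\<in>letters \<alpha>. \<Sum>e<n. \<Sum>k<n. ?F (crossing_at B e k))"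
    by (simp add: sum.cartesian_product case_prod_unfold)
  also have "\<dots> = (\<Sum>B\<in>letters \<alpha>. \<Sum>e<n. \<Sum>k<n.
      (spread x e (tail_pos \<alpha> B) + tail_twist x B e k) * (spread y k (head_pos \<alpha> B) + head_twist y B e k) -
      (spread x k (head_pos \<alpha> B) + head_twist x B e k) * (spread y e (tail_pos \<alpha> B) + tail_twist y B e k))"
    by (intro sum.cong refl) (simp add: weight_crossing[OF x] weight_crossing[OF y])
  also have "\<dots> = (\<Sum>B\<in>letters \<alpha>. \<Sum>e<n. \<Sum>k<n.
      spread x e (tail_pos \<alpha> B) * spread y k (head_pos \<alpha> B) -
      spread y e (tail_pos \<alpha> B) * spread x k (head_pos \<alpha> B)) +
      (twist_sum x y - twist_sum y x) +
      (\<Sum>B\<in>letters \<alpha>. \<Sum>e<n. \<Sum>k<n.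
        tail_twist x B e k * head_twist y B e k - head_twist x B e k * tail_twist y B e k)"
    unfolding twist_sum_def sum.distrib[symmetric] sum_subtractf[symmetric]
    by (intro sum.cong refl) (simp add: algebra_simps)
  also have "(\<Sum>B\<in>letters \<alpha>. \<Sum>e<n. \<Sum>k<n.
        tail_twist x B e k * head_twist y B e k - head_twist x B e k * tail_twist y B e k) = 0"
  proof -
    have zero: "tail_twist z B e k = 0" "head_twist z B e k = 0"
      if "z = None \<or> (\<exists>m. z = Some (Joint m))" for z B e k
      using that by auto
    show ?thesis
    proof (cases "(x = None \<or> (\<exists>m. x = Some (Joint m))) \<or> (y = None \<or> (\<exists>m. y = Some (Joint m)))")
      case True
      then show ?thesis
        using zero by (elim disjE[of "x = None \<or> _"]) simp_all
    next
      case False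
      then obtain A i j A' i' j' where x': "x = Some (Crossing A i j)" and y': "y = Some (Crossing A' i' j')"
        using x y by (metis element_cases)
      have ij: "i < n" "j < n" "i' < n" "j' < n"
        using x y by (simp_all add: x' y' letters_cable)
      let ?d = "tail_strand n (ltype \<alpha> A) i" and ?d' = "tail_strand n (ltype \<alpha> A') i'"
      have d: "?d < n" "?d' < n"
        using tail_strand_less ij by blast+
      show ?thesis
      proof (rule sum.neutral, rule ballI)
        fix B assume "B \<in> letters \<alpha>"
        have s: "sgn (int j' - int j) = - sgn (int j - int j')" "sgn (int ?d' - int ?d) = - sgn (int ?d - int ?d')"
          by (simp_all add: sgn_if)
        have delta: "(\<Sum>e<n. \<Sum>k<n. if e = a then if k = b then c e k else 0 else 0) = c a b"
          if "a < n" "b < n" for a b and c :: "nat \<Rightarrow> nat \<Rightarrow> int"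
        proof -
          have "(\<Sum>e<n. \<Sum>k<n. if e = a then if k = b then c e k else 0 else 0) =
              (\<Sum>e<n. if e = a then c e b else 0)"
            using that(2) by (intro sum.cong) auto
          with that(1) show ?thesis by simp
        qed
        show "(\<Sum>e<n. \<Sum>k<n. tail_twist x B e k * head_twist y B e k -
            head_twist x B e k * tail_twist y B e k) = 0"
        proof (cases "B = A \<and> B = A'")
          case True
          then have "A' = A" "B = A" by auto
          have "(\<Sum>e<n. \<Sum>k<n. tail_twist x B e k * head_twist y B e k -
              head_twist x B e k * tail_twist y B e k) =
            (\<Sum>e<n. \<Sum>k<n. if e = ?d then if k = j' then sgn (int k - int j) * sgn (int e - int ?d') else 0 else 0) -
            (\<Sum>e<n. \<Sum>k<n. if e = ?d' then if k = j then sgn (int e - int ?d) * sgn (int k - int j') else 0 else 0)"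
            unfolding sum_subtractf[symmetric]
            by (intro sum.cong refl) (simp add: x' y' \<open>A' = A\<close> \<open>B = A\<close>)
          \<comment> \<open>Each double sum has a single nonzero place, and the two values agree
            because both sign factors are reversed.\<close>
          also have "\<dots> = 0"
            unfolding delta[OF d(1) ij(4)] delta[OF d(2) ij(2)] by (simp add: s)
          finally show ?thesis .
        next
          case False
          then show ?thesis
            by (cases "B = A") (simp_all add: x' y')
        qed
      qed
    qed
  qed
  also have "(\<Sum>B\<in>letters \<alpha>. \<Sum>e<n. \<Sum>k<n.
      spread x e (tail_pos \<alpha> B) * spread y k (head_pos \<alpha> B) -
      spread y e (tail_pos \<alpha> B) * spread x k (head_pos \<alpha> B)) =
    (\<Sum>B\<in>letters \<alpha>.
       (\<Sum>e<n. spread x e (tail_pos \<alpha> B)) * (\<Sum>e<n. spread y e (head_pos \<alpha> B)) -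
       (\<Sum>e<n. spread x e (head_pos \<alpha> B)) * (\<Sum>e<n. spread y e (tail_pos \<alpha> B)))"
    by (intro sum.cong refl) (simp only: sum_subtractf sum_product[symmetric], simp only: mult.commute)
  finally show ?thesis by simp
qed

section \<open>Cancellation of the twists against the joints\<close>

lemma joint_sum_skew: "joint_sum x y = - joint_sum y x"
  by (simp add: joint_sum_def sum_subtractf mult.commute)

text \<open>This is \<open>lex e a len p\<close> for \<open>p < len\<close>: on a common strand the
  joint follows every crossing.\<close>

definition shifted_sgn :: "nat \<Rightarrow> nat \<Rightarrow> int" where
  "shifted_sgn a e = sgn (int e - int a) + (if e = a then 1 else 0)"

lemma sum_shifted_sgn: "a < n \<Longrightarrow> (\<Sum>e<n. shifted_sgn a e) = int n - 2 * int a"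
  by (simp add: shifted_sgn_def sum.distrib sum_sgn)

lemma sum_shifted_sgn_mult:
  assumes "a < n"
  shows "(\<Sum>e<n. shifted_sgn a e * sgn (int e - int b)) = sgn_product a b + sgn (int a - int b)"
proof -
  have "shifted_sgn a e * sgn (int e - int b) = sgn (int e - int a) * sgn (int e - int b) +
      (if e = a then sgn (int a - int b) else 0)" for e
    by (simp add: shifted_sgn_def)
  with assms show ?thesis
    by (simp add: sgn_product_def sum.distrib)
qed

lemma spread_crossing_len:
  assumes "A \<in> letters \<alpha>"
  shows "spread (Some (Crossing A i j)) e len =
    shifted_sgn (tail_strand n (ltype \<alpha> A) i) e - shifted_sgn j e + spread_end (Some (Crossing A i j)) e"
  using positions_nth(1,2)[OF nano assms, folded len_def] by (simp add: lex_def shifted_sgn_def)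

lemma spread_last:
  assumes "x \<in> elements (matrix_of (cable n \<alpha>))"
  shows "spread x (n - 1) len = spread_end x (n - 1)"
  using assms
proof (cases rule: element_cases)
  case (3 A i j)
  have "shifted_sgn a (n - 1) = 1" if "a < n" for a
    using that by (auto simp: shifted_sgn_def)
  then show ?thesis
    using tail_strand_less[OF 3(3), of "ltype \<alpha> A"] 3(4)
    unfolding 3(1) spread_crossing_len[OF 3(2)] by simp
qed simp_all

text \<open>There is no joint \<open>n - 1\<close>, but its summand would vanish by
  \<open>spread_last\<close>. Including it makes the range agree with the sums over all
  strands.\<close>

lemma joint_sum_all:
  assumes "x \<in> elements (matrix_of (cable n \<alpha>))" "y \<in> elements (matrix_of (cable n \<alpha>))"
  shows "joint_sum x y = (\<Sum>e<n. spread x e len * spread_end y e - spread_end x e * spread y e len)"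
proof -
  let ?F = "\<lambda>e. spread x e len * spread_end y e - spread_end x e * spread y e len"
  have "?F (n - 1) = 0"
    unfolding spread_last[OF assms(1)] spread_last[OF assms(2)] by simp
  moreover have "sum ?F {..<n} = ?F (n - 1) + sum ?F {..<n - 1}"
    using n by (cases n) auto
  ultimately show ?thesis
    unfolding joint_sum_def by simp
qed

text \<open>The corrections coming from the blocks of \<open>n\<close> parallel crossings are cancelled by the
  contribution of the joints.\<close>

lemma twist_joint_cancel:
  assumes x: "x \<in> elements (matrix_of (cable n \<alpha>))" and y: "y \<in> elements (matrix_of (cable n \<alpha>))"
  shows "twist_sum x y - twist_sum y x + joint_sum x y = 0"
proof -
  have none: "twist_sum x None + joint_sum x None = 0"
    if x: "x = Some (Crossing A i j)" "A \<in> letters \<alpha>" "i < n" "j < n"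
      and mem: "x \<in> elements (matrix_of (cable n \<alpha>))" for x A i j
  proof -
    let ?d = "tail_strand n (ltype \<alpha> A) i"
    have d: "?d < n" by (rule tail_strand_less[OF x(3)])
    have none_mem: "None \<in> elements (matrix_of (cable n \<alpha>))" by simp
    have "joint_sum x None = (\<Sum>e<n. (shifted_sgn ?d e - shifted_sgn j e) * 2)"
      unfolding joint_sum_all[OF mem none_mem] unfolding x(1) spread_crossing_len[OF x(2)]
      by (intro sum.cong refl) (simp add: algebra_simps)
    also have "\<dots> = 4 * (int j - int ?d)"
      using d x(4) by (simp add: sum_distrib_right[symmetric] sum_subtractf sum_shifted_sgn)
    finally show ?thesis
      using d x(4) unfolding x(1) twist_sum_crossing[OF x(2-4)]
      by (simp add: sum_distrib_right[symmetric] sum_sgn)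
  qed
  have joint: "twist_sum x (Some (Joint m)) + joint_sum x (Some (Joint m)) = 0"
    if x: "x = Some (Crossing A i j)" "A \<in> letters \<alpha>" "i < n" "j < n" and m: "m < n - 1"
      and mem: "x \<in> elements (matrix_of (cable n \<alpha>))" "Some (Joint m) \<in> elements (matrix_of (cable n \<alpha>))"
    for x A i j m
  proof -
    let ?d = "tail_strand n (ltype \<alpha> A) i"
    have d: "?d < n" and m': "m < n" using tail_strand_less[OF x(3)] m by auto
    note P = positions_nth(1,2)[OF nano x(2), folded len_def]
    have flip: "sgn (int m - int a) = - sgn (int a - int m)" for a
      by (simp add: sgn_if)
    have "joint_sum x (Some (Joint m)) = (\<Sum>e<n. (shifted_sgn ?d e - shifted_sgn j e) * (1 + sgn (int e - int m)))"
      unfolding joint_sum_all[OF mem] unfolding x(1) spread_crossing_len[OF x(2)]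
      by (intro sum.cong refl) (simp add: algebra_simps lex_def)
    also have "\<dots> = 2 * (int j - int ?d) + (sgn_product ?d m + sgn (int ?d - int m))
        - (sgn_product j m + sgn (int j - int m))"
      using d x(4) sum_shifted_sgn_mult[OF d, of m] sum_shifted_sgn_mult[OF x(4), of m]
      by (simp add: algebra_simps sum.distrib sum_subtractf sum_shifted_sgn)
    finally have J: "joint_sum x (Some (Joint m)) = 2 * (int j - int ?d) +
        (sgn_product ?d m + sgn (int ?d - int m)) - (sgn_product j m + sgn (int j - int m))" .
    have "(\<Sum>k<n. sgn (int k - int a) * spread (Some (Joint m)) k q) =
        int n - 1 - 2 * int a + sgn_product a m + sgn (int a - int m)" if "a < n" "q < len" for a q
      using that sum_sgn_lex[OF m', of a q len]
      by (simp add: distrib_left sum.distrib sum_sgn flip)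
    then show ?thesis
      unfolding J unfolding x(1) twist_sum_crossing[OF x(2-4)] using d x(4) P by simp
  qed
  have crossing: "twist_sum x y - twist_sum y x + joint_sum x y = 0"
    if x: "x = Some (Crossing A i j)" "A \<in> letters \<alpha>" "i < n" "j < n"
      and y: "y = Some (Crossing B k l)" "B \<in> letters \<alpha>" "k < n" "l < n"
      and mem: "x \<in> elements (matrix_of (cable n \<alpha>))" "y \<in> elements (matrix_of (cable n \<alpha>))"
    for x y A B i j k l
  proof -
    let ?d = "tail_strand n (ltype \<alpha> A) i" and ?d' = "tail_strand n (ltype \<alpha> B) k"
    let ?t = "tail_pos \<alpha> A" and ?h = "head_pos \<alpha> A" and ?t' = "tail_pos \<alpha> B" and ?h' = "head_pos \<alpha> B"
    let ?s = "\<lambda>a b. sgn (int a - int b)"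
    define u where "u = spread_end x 0"
    define u' where "u' = spread_end y 0"
    have u: "spread_end x e = u" "spread_end y e = u'" for e
      by (simp_all add: x(1) y(1) u_def u'_def)
    have d: "?d < n" "?d' < n"
      using tail_strand_less x(3) y(3) by blast+
    have "joint_sum x y = (\<Sum>e<n. (shifted_sgn ?d e - shifted_sgn j e) * u' -
        u * (shifted_sgn ?d' e - shifted_sgn l e))"
      unfolding joint_sum_all[OF mem]
      unfolding x(1) y(1) spread_crossing_len[OF x(2)] spread_crossing_len[OF y(2)]
      unfolding x(1)[symmetric] y(1)[symmetric] u
      by (intro sum.cong refl) (simp add: algebra_simps)
    also have "\<dots> = 2 * u' * (int j - int ?d) - 2 * u * (int l - int ?d')"
      using d x(4) y(4)
      by (simp add: sum_subtractf sum_distrib_right[symmetric] sum_distrib_left[symmetric]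
          sum_shifted_sgn) (simp add: algebra_simps)
    finally have J: "joint_sum x y = 2 * u' * (int j - int ?d) - 2 * u * (int l - int ?d')" .
    have Sy: "(\<Sum>e<n. ?s e a * spread y e q) = sgn_product a ?d' + ?s ?d' a * ?s q ?t'
        - (sgn_product a l + ?s l a * ?s q ?h') + u' * (int n - 1 - 2 * int a)" if "a < n" for a q
      using that sum_sgn_lex[OF d(2), of a q ?t'] sum_sgn_lex[OF y(4), of a q ?h'] sum_sgn[OF that]
      by (simp add: y(1) u'_def distrib_left right_diff_distrib sum.distrib sum_subtractf
          sum_distrib_right[symmetric] del: tkey.simps hkey.simps)
        (simp add: algebra_simps)
    have Sx: "(\<Sum>e<n. ?s e a * spread x e q) = sgn_product a ?d + ?s ?d a * ?s q ?t
        - (sgn_product a j + ?s j a * ?s q ?h) + u * (int n - 1 - 2 * int a)" if "a < n" for a q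
      using that sum_sgn_lex[OF d(1), of a q ?t] sum_sgn_lex[OF x(4), of a q ?h] sum_sgn[OF that]
      by (simp add: x(1) u_def distrib_left right_diff_distrib sum.distrib sum_subtractf
          sum_distrib_right[symmetric] del: tkey.simps hkey.simps)
        (simp add: algebra_simps)
    \<comment> \<open>The terms with \<open>u\<close> and \<open>u'\<close> cancel against
      \<open>J\<close>. What remains is symmetric in \<open>x\<close> and \<open>y\<close>: a
      product of two signs is unchanged when both are reversed, and \<open>sgn_product\<close> is
      commutative.\<close>
    have flip: "?s a b * ?s p q = ?s b a * ?s q p" for a b p q
      by (simp add: sgn_if)
    have T: "twist_sum x y = (\<Sum>e<n. ?s e j * spread y e ?h) - (\<Sum>e<n. ?s e ?d * spread y e ?t)"
      "twist_sum y x = (\<Sum>e<n. ?s e l * spread x e ?h') - (\<Sum>e<n. ?s e ?d' * spread x e ?t')"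
      unfolding x(1) y(1) twist_sum_crossing[OF x(2-4)] twist_sum_crossing[OF y(2-4)] by (rule refl)+
    show ?thesis
      unfolding T J Sy[OF x(4)] Sy[OF d(1)] Sx[OF y(4)] Sx[OF d(2)]
      using flip[of ?d l ?h' ?t] flip[of j l ?h' ?h] flip[of ?d ?d' ?t' ?t] flip[of j ?d' ?t' ?h]
        sgn_product_commute[of l ?d] sgn_product_commute[of l j]
        sgn_product_commute[of ?d' ?d] sgn_product_commute[of ?d' j]
      by (simp add: algebra_simps)
  qed
  have simple: "joint_sum x y = 0"
    if "x = None \<or> (\<exists>m. x = Some (Joint m))" "y = None \<or> (\<exists>m. y = Some (Joint m))" for x y
    using that by (auto simp: joint_sum_def mult.commute)
  note skew = joint_sum_skew[of x y]
  show ?thesis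
    using x
  proof (cases rule: element_cases)
    case 1
    from y show ?thesis
      by (cases rule: element_cases) (use none[of y] simple[of x y] skew y 1 in auto)
  next
    case (2 m)
    from y show ?thesis
    proof (cases rule: element_cases)
      case (3 A i j)
      have "twist_sum y x + joint_sum y x = 0"
        using joint[OF 3 2(2) y] x unfolding 2(1) by blast
      with skew show ?thesis
        by (simp add: 2(1))
    qed (use simple[of x y] 2 in auto)
  next
    case (3 A i j)
    from y show ?thesis
    proof (cases rule: element_cases)
      case 1
      then show ?thesis using none[OF 3 x] by simp
    next
      case (2 m)
      then show ?thesis using joint[OF 3 2(2) x] y by simp
    next
      case c: (3 B k l)
      show ?thesis by (rule crossing[OF 3 c x y])
    qed
  qed
qed

lemma nanoword_form_cable:
  assumes x: "x \<in> elements (matrix_of (cable n \<alpha>))" and y: "y \<in> elements (matrix_of (cable n \<alpha>))"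
  shows "nanoword_form (cable n \<alpha>) x y = lift_form (matrix_of \<alpha>) (class_of x) (class_of y)"
proof -
  obtain g r where g: "class_of x = (g, r)" by (cases "class_of x")
  obtain k q where k: "class_of y = (k, q)" by (cases "class_of y")
  have mem: "fst (class_of z) \<in> elements (matrix_of \<alpha>)" if "z \<in> elements (matrix_of (cable n \<alpha>))" for z
    using that by (cases rule: element_cases) (auto simp: class_of_def)
  have gk: "g \<in> elements (matrix_of \<alpha>)" "k \<in> elements (matrix_of \<alpha>)"
    using mem[OF x] mem[OF y] g k by simp_all
  let ?t = "\<lambda>B. tail_pos \<alpha> B" and ?h = "\<lambda>B. head_pos \<alpha> B"
  let ?K = "key_form (letters \<alpha>) (\<lambda>c. int (tail_pos \<alpha> c)) (\<lambda>c. int (head_pos \<alpha> c))"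
  have K: "?K u v = (\<Sum>B\<in>letters \<alpha>. old_weight u (?t B) * old_weight v (?h B) -
      old_weight u (?h B) * old_weight v (?t B))" for u v
    by (simp add: key_form_def old_weight_def)
  have None: "old_weight None p = 2" for p
    by (simp add: old_weight_def)
  have "4 * nanoword_form (cable n \<alpha>) x y = key_form (letters (cable n \<alpha>)) tkey hkey x y"
    by (rule keyed_key_form[OF is_nanoword_cable[OF nano n] keyed_cable x y])
  also have "\<dots> = (\<Sum>B\<in>letters \<alpha>. (old_weight g (?t B) + 2 * r) * (old_weight k (?h B) + 2 * q) -
      (old_weight g (?h B) + 2 * r) * (old_weight k (?t B) + 2 * q))"
    unfolding key_form_cable[OF x y] twist_joint_cancel[OF x y] add_0_right
    by (intro sum.cong refl)
      (simp add: sum_spread[OF x] sum_spread[OF y] positions_nth(1,2)[OF nano] len_def g k)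
  \<comment> \<open>Since \<open>s\<close> has weight 2, the summands \<open>2 r\<close> and
    \<open>2 q\<close> are \<open>r\<close> and \<open>q\<close> times the weight of
    \<open>s\<close>; the products \<open>4 r q\<close> cancel in the determinant.\<close>
  also have "\<dots> = ?K g k + q * ?K g None + r * ?K None k"
    unfolding K None sum_distrib_left sum.distrib[symmetric]
    by (intro sum.cong refl) (simp add: algebra_simps)
  also have "\<dots> = 4 * lift_form (matrix_of \<alpha>) (class_of x) (class_of y)"
    using gk by (simp add: key_form_positions[OF nano] lift_form_def g k)
  finally show ?thesis by simp
qed

lemma matrix_of_cable: "matrix_of (cable n \<alpha>) \<cong>\<^sub>b cable_matrix n (matrix_of \<alpha>)"
proof -
  let ?F = "map_option (map_cable_letter Some)"
  have e: "elements (matrix_of (cable n \<alpha>)) =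
      insert None (Some ` (cable_crossings n (letters \<alpha>) \<union> Joint ` {..<n - 1}))"
    by (simp add: letters_cable)
  have "insert None (Some ` letters \<alpha>) - {None} = Some ` letters \<alpha>"
    by auto
  then have e': "elements (cable_matrix n (matrix_of \<alpha>)) =
      insert None (Some ` (cable_crossings n (Some ` letters \<alpha>) \<union> Joint ` {..<n - 1}))"
    by simp
  have cr: "map_cable_letter Some ` cable_crossings n G = cable_crossings n (Some ` G)" for G :: "'a set"
    by (force simp: cable_crossings_def)
  have jo: "map_cable_letter Some ` Joint ` {..<n - 1} = Joint ` {..<n - 1}"
    by (simp add: image_image)
  have "inj ?F"
    by (intro option.inj_map cable_letter.inj_map) (simp add: inj_def)
  moreover have "?F ` insert None (Some ` S) = insert None (Some ` map_cable_letter Some ` S)"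
    for S :: "'a cable_letter set"
    by (simp add: image_image)
  then have "?F ` elements (matrix_of (cable n \<alpha>)) = elements (cable_matrix n (matrix_of \<alpha>))"
    unfolding e e' by (simp only:) (simp only: image_Un cr jo)
  ultimately have "bij_betw ?F (elements (matrix_of (cable n \<alpha>))) (elements (cable_matrix n (matrix_of \<alpha>)))"
    unfolding bij_betw_def using inj_on_subset[OF _ subset_UNIV] by blast
  moreover have "form (cable_matrix n (matrix_of \<alpha>)) (?F x) (?F y) = form (matrix_of (cable n \<alpha>)) x y"
    if "x \<in> elements (matrix_of (cable n \<alpha>))" "y \<in> elements (matrix_of (cable n \<alpha>))" for x y
    using nanoword_form_cable[OF that] by (simp add: class_of_def)
  ultimately show ?thesis
    unfolding based_matrix_iso_def by (intro exI[of _ ?F]) simp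
qed

end

theorem theorem10p6:
  fixes \<Gamma> \<Gamma>' \<Gamma>\<^sub>n \<Gamma>\<^sub>n' :: virtual_string
    and M M' N N' :: "nat option based_matrix"
    and n :: nat
  assumes "is_P M \<Gamma>" and "is_P M' \<Gamma>'" and "M \<cong>\<^sub>b M'"
    and "n \<ge> 1"
    and "is_cable n \<Gamma> \<Gamma>\<^sub>n" and "is_cable n \<Gamma>' \<Gamma>\<^sub>n'"
    and "is_P N \<Gamma>\<^sub>n" and "is_P N' \<Gamma>\<^sub>n'"
  shows "N \<cong>\<^sub>b N'"
proof -
  have P: "\<exists>\<alpha>. is_nanoword \<alpha> \<and> represents \<alpha> \<Gamma> \<and> reduction\<^sup>*\<^sup>* (matrix_of \<alpha>) M \<and> primitive M
      \<and> matrix_of \<alpha> \<sim>\<^sub>b M"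
    if P: "is_P M \<Gamma>" for M :: "nat option based_matrix" and \<Gamma>
  proof -
    obtain \<alpha> where \<alpha>: "represents \<alpha> \<Gamma>" "reduction\<^sup>*\<^sup>* (matrix_of \<alpha>) M" "primitive M"
      using P unfolding is_P_def is_primitive_matrix_of_def by blast
    moreover have nw: "is_nanoword \<alpha>"
      using \<alpha>(1) by (simp add: represents_def)
    moreover note reductions_matrix_equiv[OF \<alpha>(2) is_based_matrix_matrix_of[OF nw]]
    ultimately show ?thesis
      by blast
  qed
  have cable: "\<exists>\<beta>. reduction\<^sup>*\<^sup>* (matrix_of \<beta>) N \<and> primitive N \<and> matrix_of \<beta> \<sim>\<^sub>b cable_matrix n M"
    if M: "is_P M \<Gamma>" and c: "is_cable n \<Gamma> \<Delta>" and N: "is_P N \<Delta>"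
    for M N :: "nat option based_matrix" and \<Gamma> \<Delta>
  proof -
    obtain \<alpha> :: "nat nanoword" where \<alpha>: "represents \<alpha> \<Gamma>" "matrix_of \<alpha> \<sim>\<^sub>b M"
      using P[OF M] by blast
    obtain \<gamma> :: "nat nanoword" where \<gamma>: "represents \<gamma> \<Gamma>" "represents (cable n \<gamma>) \<Delta>"
      using c unfolding is_cable_def by blast
    obtain \<beta> where \<beta>: "represents \<beta> \<Delta>" "reduction\<^sup>*\<^sup>* (matrix_of \<beta>) N" "primitive N"
      using P[OF N] by blast
    have "is_nanoword \<gamma>" "is_nanoword (cable n \<gamma>)"
      using \<gamma> by (simp_all add: represents_def)
    then interpret cabled_nanoword n \<gamma>
      using assms(4) by unfold_locales
    \<comment> \<open>Three representatives have been chosen independently: \<open>\<alpha>\<close>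
      reduces to \<open>M\<close>, \<open>\<gamma>\<close> is the one that is cabled, and
      \<open>\<beta>\<close> reduces to \<open>N\<close>. Homotopy invariance links
      \<open>\<beta>\<close> to the cable of \<open>\<gamma>\<close>, and \<open>\<gamma>\<close> to
      \<open>\<alpha>\<close>.\<close>
    have "matrix_of \<beta> \<sim>\<^sub>b matrix_of (cable n \<gamma>)"
      by (rule represents_matrix_equiv[OF \<beta>(1) \<gamma>(2)])
    also have "matrix_of (cable n \<gamma>) \<sim>\<^sub>b cable_matrix n (matrix_of \<gamma>)"
      using iso_matrix_equiv[OF matrix_of_cable] is_based_matrix_matrix_of \<open>is_nanoword (cable n \<gamma>)\<close>
      by blast
    also have "cable_matrix n (matrix_of \<gamma>) \<sim>\<^sub>b cable_matrix n M"
      using cable_matrix_equiv[OF matrix_equiv_trans[OF represents_matrix_equiv[OF \<gamma>(1) \<alpha>(1)] \<alpha>(2)]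
          assms(4)] .
    finally show ?thesis
      using \<beta>(2,3) by blast
  qed
  obtain \<beta> where \<beta>: "reduction\<^sup>*\<^sup>* (matrix_of \<beta>) N" "primitive N" "matrix_of \<beta> \<sim>\<^sub>b cable_matrix n M"
    using cable[OF assms(1,5,7)] by blast
  obtain \<beta>' where \<beta>': "reduction\<^sup>*\<^sup>* (matrix_of \<beta>') N'" "primitive N'" "matrix_of \<beta>' \<sim>\<^sub>b cable_matrix n M'"
    using cable[OF assms(2,6,8)] by blast
  have "is_based_matrix M"
    using P[OF assms(1)] by (auto simp: matrix_equiv_def)
  note \<beta>(3)
  also have "cable_matrix n M \<sim>\<^sub>b cable_matrix n M'"
    using cable_matrix_equiv[OF iso_matrix_equiv[OF assms(3) \<open>is_based_matrix M\<close>] assms(4)] .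
  also note matrix_equiv_sym[OF \<beta>'(3)]
  finally show ?thesis
    by (rule matrix_equiv_primitive[OF _ \<beta>(1,2) \<beta>'(1,2)])
qed

end
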